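(* Let $R$ be a partially ordered commutative ring. Then the following are equivalent: (i) There exists a compact Hausdorff space $X$ such that $R$ is isomorphic (as a partially ordered commutative ring) to a subring of $\mathscr{C}_{\mathrm{a.e.}}(X)$. (ii) $R$ is localizable and the extended Gelfand transformation $\widehat{\cdot}\colon R \to \mathscr{C}_\approx(\mathcal{D}_{\mathrm{loc}}(R))$ is an order embedding. (iii) $R$ is archimedean and localizable. (iv) $R$ is archimedean and strongly localizable. Moreover, if these equivalent statements hold, then every $\mathrm{O}_{s<\infty}$ with $s\in\mathrm{Loc}(R)$ is dense in $\mathcal{K}(R)$, so that the map sending the $\approx$-class in $\mathscr{C}_\approx(\mathcal{D}_{\mathrm{loc}}(R))$ of a function $f$ to its class in $\mathscr{C}_{\mathrm{a.e.}}(\mathcal{K}(R))$ is a well-defined positive ring morphism and order embedding $\mathscr{C}_\approx(\mathcal{D}_{\mathrm{loc}}(R)) \to \mathscr{C}_{\mathrm{a.e.}}(\mathcal{K}(R))$.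
   Context: All rings are commutative with unit $1$; subrings contain $1$; ring morphisms are unital. A partially ordered commutative ring is a commutative ring $R$ with a partial order $\le$ such that $r\le s$ implies $r+t\le s+t$, and whose positive cone $R^+=\{r: 0\le r\}$ is closed under multiplication and contains all squares; subrings carry the induced order. A ring morphism $\Phi\colon R\to S$ of such rings is positive if $\Phi(R^+)\subseteq S^+$, an order embedding if it is positive and $\Phi^{-1}(S^+)\subseteq R^+$; an isomorphism is a bijective ring morphism with $\Phi,\Phi^{-1}$ positive. $\mathbb{N}=\{1,2,\dots\}$, $\mathbb{N}_0=\mathbb{N}\cup\{0\}$. $R$ is archimedean if whenever $g,h\in R$ satisfy $kg+h\in R^+$ for all $k\in\mathbb{N}$, then $g\in R^+$. $\mathrm{Loc}(R)$ is the set of $s\in 1+R^+$ such that for all $r\in R$, $rs\in R^+$ implies $r\in R^+$. $R$ is localizable if for every $r\in R$ there is $s\in\mathrm{Loc}(R)$ with $-s\le r\le s$; strongly localizable if $r^2\in R^+$ for all $r$ and $\mathrm{Loc}(R)=1+R^+$. Admissible domains: for a topological space $Y$, an admissible set of domains is a set $\mathcal{D}$ of open subsets of $Y$ with $Y\in\mathcal{D}$ and $A\cap B\in\mathcal{D}$ for $A,B\in\mathcal{D}$. On $\bigcup_{A\in\mathcal{D}}\mathscr{C}(A)$ ($\mathscr{C}(A)$ = continuous real functions on $A$) define $f+g$, $fg$ pointwise on $\operatorname{dom} f\cap\operatorname{dom} g$; $f\approx g$ iff there is $A\in\mathcal{D}$, $A\subseteq\operatorname{dom}f\cap\operatorname{dom}g$,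 with $f|_A=g|_A$. The quotient $\mathscr{C}_\approx(\mathcal{D})$ is a commutative ring, partially ordered by $[f]\le[g]$ iff there is $A\in\mathcal{D}$, $A\subseteq \operatorname{dom}f\cap\operatorname{dom}g$, with $f|_A\le g|_A$ pointwise. $\mathscr{C}_{\mathrm{a.e.}}(X):=\mathscr{C}_\approx(\mathcal{D})$ for $\mathcal{D}$ the set of dense open subsets of $X$. Extended Gelfand transformation: elements of $\mathrm{Loc}(R)$ are non-zero-divisors; the localization $R_{\mathrm{loc}}$ consists of fractions $r/s$ ($r\in R$, $s\in\mathrm{Loc}(R)$), $r/s=r'/s'$ iff $rs'=r's$, with the usual operations, ordered by $p/q\le r/s$ iff $ps\le rq$ in $R$. Let $R^{\mathrm{bd}}_{\mathrm{loc}}=\{a\in R_{\mathrm{loc}}:\exists n\in\mathbb{N}_0,\ -n\le a\le n\}$, a subring with the induced order. $\mathcal{K}(R)$ is the set of ring morphisms $\varphi\colon R^{\mathrm{bd}}_{\mathrm{loc}}\to\mathbb{R}$ with $\varphi(a)\ge0$ for all $a\ge0$, with the weak-$*$ topology (generated by the sets $\{\varphi:\varphi(a)\in V\}$, $a\in R^{\mathrm{bd}}_{\mathrm{loc}}$, $V\subseteq\mathbb{R}$ open). For $s\in\mathrm{Loc}(R)$ put $\mathrm{O}_{s<\infty}=\{\varphi\in\mathcal{K}(R):\varphi(1/s)>0\}$ and $\mathcal{D}_{\mathrm{loc}}(R)=\{\mathrm{O}_{s<\infty}:s\in\mathrm{Loc}(R)\}$ (an admissible set of domains on $\mathcal{K}(R)$).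 For localizable $R$ and $r\in R$, $\widehat r\in\mathscr{C}_\approx(\mathcal{D}_{\mathrm{loc}}(R))$ is the class of $r_s\colon\mathrm{O}_{s<\infty}\to\mathbb{R}$, $\varphi\mapsto\varphi(1/s)^{-1}\varphi(r/s)$, where $s\in\mathrm{Loc}(R)$ is any element with $r/s\in R^{\mathrm{bd}}_{\mathrm{loc}}$ (the class does not depend on the choice of $s$). *)

theory Defs
  imports "HOL-Analysis.Analysis" "HOL-Algebra.Ring" "HOL-Algebra.RingHom" "HOL-Algebra.Subrings"
begin

definition po_cring :: "'a ring \<Rightarrow> ('a \<Rightarrow> 'a \<Rightarrow> bool) \<Rightarrow> bool" where
  "po_cring R leq \<longleftrightarrow> cring R
     \<and> (\<forall>x\<in>carrier R. leq x x)
     \<and> (\<forall>x\<in>carrier R. \<forall>y\<in>carrier R. leq x y \<and> leq y x \<longrightarrow> x = y)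
     \<and> (\<forall>x\<in>carrier R. \<forall>y\<in>carrier R. \<forall>z\<in>carrier R. leq x y \<and> leq y z \<longrightarrow> leq x z)
     \<and> (\<forall>r\<in>carrier R. \<forall>s\<in>carrier R. \<forall>t\<in>carrier R. leq r s \<longrightarrow> leq (r \<oplus>\<^bsub>R\<^esub> t) (s \<oplus>\<^bsub>R\<^esub> t))
     \<and> (\<forall>r\<in>carrier R. \<forall>s\<in>carrier R. leq \<zero>\<^bsub>R\<^esub> r \<and> leq \<zero>\<^bsub>R\<^esub> s \<longrightarrow> leq \<zero>\<^bsub>R\<^esub> (r \<otimes>\<^bsub>R\<^esub> s))
     \<and> (\<forall>r\<in>carrier R. leq \<zero>\<^bsub>R\<^esub> (r \<otimes>\<^bsub>R\<^esub> r))"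

definition pos_cone :: "'a ring \<Rightarrow> ('a \<Rightarrow> 'a \<Rightarrow> bool) \<Rightarrow> 'a set" where
  "pos_cone R leq = {r \<in> carrier R. leq \<zero>\<^bsub>R\<^esub> r}"

definition positive_map :: "('a, 'c) ring_scheme \<Rightarrow> ('a \<Rightarrow> 'a \<Rightarrow> bool) \<Rightarrow>
    ('b, 'd) ring_scheme \<Rightarrow> ('b \<Rightarrow> 'b \<Rightarrow> bool) \<Rightarrow> ('a \<Rightarrow> 'b) \<Rightarrow> bool" where
  "positive_map R leR S leS \<Phi> \<longleftrightarrow>
     (\<forall>r\<in>carrier R. leR \<zero>\<^bsub>R\<^esub> r \<longrightarrow> leS \<zero>\<^bsub>S\<^esub> (\<Phi> r))"

definition order_embedding :: "('a, 'c) ring_scheme \<Rightarrow> ('a \<Rightarrow> 'a \<Rightarrow> bool) \<Rightarrow>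
    ('b, 'd) ring_scheme \<Rightarrow> ('b \<Rightarrow> 'b \<Rightarrow> bool) \<Rightarrow> ('a \<Rightarrow> 'b) \<Rightarrow> bool" where
  "order_embedding R leR S leS \<Phi> \<longleftrightarrow>
     \<Phi> \<in> ring_hom R S \<and> positive_map R leR S leS \<Phi>
     \<and> (\<forall>r\<in>carrier R. leS \<zero>\<^bsub>S\<^esub> (\<Phi> r) \<longrightarrow> leR \<zero>\<^bsub>R\<^esub> r)"

definition po_iso :: "('a, 'c) ring_scheme \<Rightarrow> ('a \<Rightarrow> 'a \<Rightarrow> bool) \<Rightarrow>
    ('b, 'd) ring_scheme \<Rightarrow> ('b \<Rightarrow> 'b \<Rightarrow> bool) \<Rightarrow> ('a \<Rightarrow> 'b) \<Rightarrow> bool" where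
  "po_iso R leR S leS \<Phi> \<longleftrightarrow>
     \<Phi> \<in> ring_iso R S \<and> positive_map R leR S leS \<Phi>
     \<and> positive_map S leS R leR (inv_into (carrier R) \<Phi>)"

definition archimedean :: "'a ring \<Rightarrow> ('a \<Rightarrow> 'a \<Rightarrow> bool) \<Rightarrow> bool" where
  "archimedean R leq \<longleftrightarrow>
     (\<forall>g\<in>carrier R. \<forall>h\<in>carrier R.
        (\<forall>k::nat. k \<ge> 1 \<longrightarrow> ([k] \<cdot>\<^bsub>R\<^esub> g) \<oplus>\<^bsub>R\<^esub> h \<in> pos_cone R leq) \<longrightarrow> g \<in> pos_cone R leq)"

definition Loc :: "'a ring \<Rightarrow> ('a \<Rightarrow> 'a \<Rightarrow> bool) \<Rightarrow> 'a set" where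
  "Loc R leq = {s. (\<exists>p\<in>pos_cone R leq. s = \<one>\<^bsub>R\<^esub> \<oplus>\<^bsub>R\<^esub> p)
                \<and> (\<forall>r\<in>carrier R. r \<otimes>\<^bsub>R\<^esub> s \<in> pos_cone R leq \<longrightarrow> r \<in> pos_cone R leq)}"

definition localizable :: "'a ring \<Rightarrow> ('a \<Rightarrow> 'a \<Rightarrow> bool) \<Rightarrow> bool" where
  "localizable R leq \<longleftrightarrow>
     (\<forall>r\<in>carrier R. \<exists>s\<in>Loc R leq. leq (\<ominus>\<^bsub>R\<^esub> s) r \<and> leq r s)"

definition strongly_localizable :: "'a ring \<Rightarrow> ('a \<Rightarrow> 'a \<Rightarrow> bool) \<Rightarrow> bool" where
  "strongly_localizable R leq \<longleftrightarrow>
     (\<forall>r\<in>carrier R. r \<otimes>\<^bsub>R\<^esub> r \<in> pos_cone R leq)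
     \<and> Loc R leq = {\<one>\<^bsub>R\<^esub> \<oplus>\<^bsub>R\<^esub> p | p. p \<in> pos_cone R leq}"

type_synonym 'x pfun = "'x set \<times> ('x \<Rightarrow> real)"

text \<open>A function with domain: a pair (A, f) with A in D and f continuous on A
  (values of f outside A are irrelevant).\<close>

definition pfuns :: "'x topology \<Rightarrow> 'x set set \<Rightarrow> 'x pfun set" where
  "pfuns T D = {(A, f). A \<in> D \<and> continuous_map (subtopology T A) euclideanreal f}"

definition approx_rel :: "'x set set \<Rightarrow> 'x pfun \<Rightarrow> 'x pfun \<Rightarrow> bool" where
  "approx_rel D p q \<longleftrightarrow> (\<exists>C\<in>D. C \<subseteq> fst p \<inter> fst q \<and> (\<forall>x\<in>C. snd p x = snd q x))"

definition acls :: "'x topology \<Rightarrow> 'x set set \<Rightarrow> 'x pfun \<Rightarrow> 'x pfun set" where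
  "acls T D p = {q \<in> pfuns T D. approx_rel D q p}"

definition padd :: "'x pfun \<Rightarrow> 'x pfun \<Rightarrow> 'x pfun" where
  "padd p q = (fst p \<inter> fst q, \<lambda>x. snd p x + snd q x)"

definition pmult :: "'x pfun \<Rightarrow> 'x pfun \<Rightarrow> 'x pfun" where
  "pmult p q = (fst p \<inter> fst q, \<lambda>x. snd p x * snd q x)"

definition Capprox :: "'x topology \<Rightarrow> 'x set set \<Rightarrow> ('x pfun set) ring" where
  "Capprox T D =
     \<lparr> carrier = acls T D ` pfuns T D,
       mult = (\<lambda>c d. acls T D (pmult (SOME p. p \<in> c) (SOME q. q \<in> d))),
       one = acls T D (topspace T, \<lambda>_. 1),
       zero = acls T D (topspace T, \<lambda>_. 0),
       add = (\<lambda>c d. acls T D (padd (SOME p. p \<in> c) (SOME q. q \<in> d))) \<rparr>"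

definition Capprox_le :: "'x set set \<Rightarrow> 'x pfun set \<Rightarrow> 'x pfun set \<Rightarrow> bool" where
  "Capprox_le D c d \<longleftrightarrow>
     (\<exists>p\<in>c. \<exists>q\<in>d. \<exists>A\<in>D. A \<subseteq> fst p \<inter> fst q \<and> (\<forall>x\<in>A. snd p x \<le> snd q x))"

definition dense_opens :: "'x topology \<Rightarrow> 'x set set" where
  "dense_opens X = {A. openin X A \<and> X closure_of A = topspace X}"

definition Cae :: "'x topology \<Rightarrow> ('x pfun set) ring" where
  "Cae X = Capprox X (dense_opens X)"

definition Cae_le :: "'x topology \<Rightarrow> 'x pfun set \<Rightarrow> 'x pfun set \<Rightarrow> bool" where
  "Cae_le X = Capprox_le (dense_opens X)"

definition iso_to_subring_Cae :: "'a ring \<Rightarrow> ('a \<Rightarrow> 'a \<Rightarrow> bool) \<Rightarrow> 'x topology \<Rightarrow> bool" where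
  "iso_to_subring_Cae R leq X \<longleftrightarrow>
     (\<exists>S \<Phi>. subring S (Cae X) \<and> po_iso R leq ((Cae X)\<lparr>carrier := S\<rparr>) (Cae_le X) \<Phi>)"

definition frac_cls :: "'a ring \<Rightarrow> ('a \<Rightarrow> 'a \<Rightarrow> bool) \<Rightarrow> 'a \<times> 'a \<Rightarrow> ('a \<times> 'a) set" where
  "frac_cls R leq x = {(r', s'). r' \<in> carrier R \<and> s' \<in> Loc R leq
                        \<and> fst x \<otimes>\<^bsub>R\<^esub> s' = r' \<otimes>\<^bsub>R\<^esub> snd x}"

definition Rloc :: "'a ring \<Rightarrow> ('a \<Rightarrow> 'a \<Rightarrow> bool) \<Rightarrow> (('a \<times> 'a) set) ring" where
  "Rloc R leq =
     \<lparr> carrier = frac_cls R leq ` (carrier R \<times> Loc R leq),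
       mult = (\<lambda>a b. let (r, s) = (SOME x. x \<in> a); (r', s') = (SOME x. x \<in> b)
                      in frac_cls R leq (r \<otimes>\<^bsub>R\<^esub> r', s \<otimes>\<^bsub>R\<^esub> s')),
       one = frac_cls R leq (\<one>\<^bsub>R\<^esub>, \<one>\<^bsub>R\<^esub>),
       zero = frac_cls R leq (\<zero>\<^bsub>R\<^esub>, \<one>\<^bsub>R\<^esub>),
       add = (\<lambda>a b. let (r, s) = (SOME x. x \<in> a); (r', s') = (SOME x. x \<in> b)
                      in frac_cls R leq ((r \<otimes>\<^bsub>R\<^esub> s') \<oplus>\<^bsub>R\<^esub> (r' \<otimes>\<^bsub>R\<^esub> s), s \<otimes>\<^bsub>R\<^esub> s')) \<rparr>"

definition Rloc_le :: "'a ring \<Rightarrow> ('a \<Rightarrow> 'a \<Rightarrow> bool) \<Rightarrow> ('a \<times> 'a) set \<Rightarrow> ('a \<times> 'a) set \<Rightarrow> bool" where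
  "Rloc_le R leq a b \<longleftrightarrow>
     (\<exists>(p, q)\<in>a. \<exists>(r, s)\<in>b. leq (p \<otimes>\<^bsub>R\<^esub> s) (r \<otimes>\<^bsub>R\<^esub> q))"

definition Rloc_bd :: "'a ring \<Rightarrow> ('a \<Rightarrow> 'a \<Rightarrow> bool) \<Rightarrow> ('a \<times> 'a) set set" where
  "Rloc_bd R leq = {a \<in> carrier (Rloc R leq). \<exists>n::nat.
      Rloc_le R leq (\<ominus>\<^bsub>Rloc R leq\<^esub> ([n] \<cdot>\<^bsub>Rloc R leq\<^esub> \<one>\<^bsub>Rloc R leq\<^esub>)) a
      \<and> Rloc_le R leq a ([n] \<cdot>\<^bsub>Rloc R leq\<^esub> \<one>\<^bsub>Rloc R leq\<^esub>)}"

definition Kspec :: "'a ring \<Rightarrow> ('a \<Rightarrow> 'a \<Rightarrow> bool) \<Rightarrow> (('a \<times> 'a) set \<Rightarrow> real) set" where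
  "Kspec R leq = {\<phi>. \<phi> \<in> extensional (Rloc_bd R leq)
     \<and> (\<forall>a\<in>Rloc_bd R leq. \<forall>b\<in>Rloc_bd R leq.
           \<phi> (a \<oplus>\<^bsub>Rloc R leq\<^esub> b) = \<phi> a + \<phi> b \<and> \<phi> (a \<otimes>\<^bsub>Rloc R leq\<^esub> b) = \<phi> a * \<phi> b)
     \<and> \<phi> \<one>\<^bsub>Rloc R leq\<^esub> = 1
     \<and> (\<forall>a\<in>Rloc_bd R leq. Rloc_le R leq \<zero>\<^bsub>Rloc R leq\<^esub> a \<longrightarrow> \<phi> a \<ge> 0)}"

definition Ktop :: "'a ring \<Rightarrow> ('a \<Rightarrow> 'a \<Rightarrow> bool) \<Rightarrow> (('a \<times> 'a) set \<Rightarrow> real) topology" where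
  "Ktop R leq = topology_generated_by
     {{\<phi> \<in> Kspec R leq. \<phi> a \<in> V} | a V. a \<in> Rloc_bd R leq \<and> open V}"

definition Ofin :: "'a ring \<Rightarrow> ('a \<Rightarrow> 'a \<Rightarrow> bool) \<Rightarrow> 'a \<Rightarrow> (('a \<times> 'a) set \<Rightarrow> real) set" where
  "Ofin R leq s = {\<phi> \<in> Kspec R leq. \<phi> (frac_cls R leq (\<one>\<^bsub>R\<^esub>, s)) > 0}"

definition Dloc :: "'a ring \<Rightarrow> ('a \<Rightarrow> 'a \<Rightarrow> bool) \<Rightarrow> (('a \<times> 'a) set \<Rightarrow> real) set set" where
  "Dloc R leq = {Ofin R leq s | s. s \<in> Loc R leq}"

text \<open>Extended Gelfand transformation (for localizable R).\<close>

definition gelfand :: "'a ring \<Rightarrow> ('a \<Rightarrow> 'a \<Rightarrow> bool) \<Rightarrow> 'a \<Rightarrow> (('a \<times> 'a) set \<Rightarrow> real) pfun set" where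
  "gelfand R leq r =
     (let s = (SOME s. s \<in> Loc R leq \<and> frac_cls R leq (r, s) \<in> Rloc_bd R leq)
      in acls (Ktop R leq) (Dloc R leq)
           (Ofin R leq s, \<lambda>\<phi>. inverse (\<phi> (frac_cls R leq (\<one>\<^bsub>R\<^esub>, s))) * \<phi> (frac_cls R leq (r, s))))"

end

theory Submission
  imports Defs "HOL-Decision_Procs.Commutative_Ring"
begin

text \<open>
  A fraction \<open>a\<close> of the bounded part of the localization that is not positive is separated from the
  positive cone by a real character: for some \<open>k\<close> the element \<open>c = k a + 1\<close> is not positive, \<open>- c\<close> can be
  adjoined to the cone without making \<open>- 1\<close> positive, and a maximal such cone is a total preorder, whose
  Dedekind cuts define the character. If the Gelfand transform of \<open>r\<close> is nonnegative on the domain of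
  \<open>t\<close>, then every character is nonnegative on \<open>r / (s t)\<close>, because \<open>1 / t\<close> vanishes off that domain; hence
  \<open>r\<close> is positive. The same multiplication by \<open>1 / t\<close> shows that the domains are dense. Conversely, the
  pointwise order on almost everywhere defined continuous functions is archimedean and admits division by
  functions that are at least \<open>1\<close>, because a continuous function that is nonnegative on a dense set is
  nonnegative on its whole domain.
\<close>

section \<open>Quadratic cones and their real characters\<close>

text \<open>Division by integers is not part of the cone structure. It enters only as cancellation:
  if a positive multiple \<open>n x\<close> is positive, so is \<open>x\<close>. Real values are
  therefore suprema of fractions \<open>m / n\<close> with \<open>n x - m\<close> positive, and all
  estimates are made with integer multiples. For \<open>R\<close> this cancellation is itself a
  consequence of being archimedean and localizable, because an element of \<open>Loc\<close> that
  bounds \<open>x\<close> absorbs the remainder of \<open>k\<close> modulo \<open>n\<close>.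
  Characters live on bounded fractions because a real-valued cut needs every element to lie below
  some integer. An unbounded \<open>r\<close> is reached through \<open>r / s\<close>, and the
  denominators are removed at the end by the cancellation built into \<open>Loc\<close>. The step
  from localizable to strongly localizable is indirect: \<open>R\<close> is first represented by
  functions on its own character space, and there division by \<open>1 + p\<close> with
  \<open>p\<close> positive is pointwise.\<close>

locale quad_cone = cring R for R (structure) +
  fixes P :: "'a set"
  assumes P_sub: "P \<subseteq> carrier R"
    and P_add: "x \<in> P \<Longrightarrow> y \<in> P \<Longrightarrow> x \<oplus> y \<in> P"
    and P_mult: "x \<in> P \<Longrightarrow> y \<in> P \<Longrightarrow> x \<otimes> y \<in> P"
    and P_sq: "x \<in> carrier R \<Longrightarrow> x \<otimes> x \<in> P"
begin

lemma P_carr: "x \<in> P \<Longrightarrow> x \<in> carrier R"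
  using P_sub by blast

lemma P_zero: "\<zero> \<in> P" and P_one: "\<one> \<in> P"
  using P_sq[of \<zero>] P_sq[of \<one>] by simp_all

lemma P_of_nat: "\<guillemotleft>n\<guillemotright>\<^sub>\<nat> \<in> P"
  by (induction n) (simp_all add: P_zero P_one P_add)

lemma P_of_int: "0 \<le> i \<Longrightarrow> \<guillemotleft>i\<guillemotright> \<in> P"
  by (simp add: of_integer_def P_of_nat)

text \<open>Closure under products rests on \<open>x \<otimes> x \<in> P\<close>: the term of degree
  two in \<open>x\<close> moves into the part free of \<open>x\<close>.\<close>

lemma adjoin_cone:
  assumes x: "x \<in> carrier R"
  shows "quad_cone R {p \<oplus> x \<otimes> q | p q. p \<in> P \<and> q \<in> P}" (is "quad_cone R ?Q")
proof -
  have "u \<oplus> v \<in> ?Q \<and> u \<otimes> v \<in> ?Q" if uv: "u \<in> ?Q" "v \<in> ?Q" for u v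
  proof -
    obtain p q p' q' where P: "p \<in> P" "q \<in> P" "p' \<in> P" "q' \<in> P"
      and e: "u = p \<oplus> x \<otimes> q" "v = p' \<oplus> x \<otimes> q'"
      using uv by auto
    have c: "p \<in> carrier R" "q \<in> carrier R" "p' \<in> carrier R" "q' \<in> carrier R"
      using P P_carr by auto
    have "u \<oplus> v = (p \<oplus> p') \<oplus> x \<otimes> (q \<oplus> q')"
      unfolding e using c x by algebra
    moreover have "u \<otimes> v = (p \<otimes> p' \<oplus> (x \<otimes> x) \<otimes> (q \<otimes> q')) \<oplus> x \<otimes> (p \<otimes> q' \<oplus> q \<otimes> p')"
      unfolding e using c x by algebra
    moreover have "p \<oplus> p' \<in> P" "q \<oplus> q' \<in> P" "p \<otimes> q' \<oplus> q \<otimes> p' \<in> P"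
      "p \<otimes> p' \<oplus> (x \<otimes> x) \<otimes> (q \<otimes> q') \<in> P"
      using P P_add P_mult P_sq[OF x] by simp_all
    ultimately show ?thesis by blast
  qed
  moreover have "u \<in> ?Q" if "u \<in> P" for u
    using that P_carr[OF that] x P_zero by (intro CollectI exI[of _ u] exI[of _ \<zero>]) simp
  ultimately show ?thesis
    by unfold_locales (use x P_carr P_sq in auto)
qed

text \<open>If neither \<open>x\<close> nor \<open>\<ominus> x\<close> lay in a maximal cone,
  adjoining either would produce \<open>\<ominus> \<one>\<close>, and the product of the two
  resulting equations would place \<open>\<ominus> \<one>\<close> in the maximal cone
  already.\<close>

lemma total_extension:
  assumes "\<ominus> \<one> \<notin> P"
  obtains Q where "P \<subseteq> Q" "quad_cone R Q" "\<ominus> \<one> \<notin> Q"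
    "\<And>x. x \<in> carrier R \<Longrightarrow> x \<in> Q \<or> \<ominus> x \<in> Q"
proof -
  define \<A> where "\<A> = {Q. P \<subseteq> Q \<and> quad_cone R Q \<and> \<ominus> \<one> \<notin> Q}"
  have "\<exists>M\<in>\<A>. \<forall>X\<in>\<A>. M \<subseteq> X \<longrightarrow> X = M"
  proof (rule subset_Zorn_nonempty)
    show "\<A> \<noteq> {}"
      using assms quad_cone_axioms by (auto simp: \<A>_def)
    fix \<C> assume C: "\<C> \<noteq> {}" "subset.chain \<A> \<C>"
    then have CA: "\<And>Q. Q \<in> \<C> \<Longrightarrow> P \<subseteq> Q \<and> quad_cone R Q \<and> \<ominus> \<one> \<notin> Q"
      by (auto simp: \<A>_def subset.chain_def)
    have pair: "\<exists>Q\<in>\<C>. x \<in> Q \<and> y \<in> Q" if xy: "x \<in> \<Union>\<C>" "y \<in> \<Union>\<C>" for x y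
    proof -
      obtain A B where "A \<in> \<C>" "x \<in> A" "B \<in> \<C>" "y \<in> B" using xy by blast
      moreover have "A \<subseteq> B \<or> B \<subseteq> A"
        using C(2) calculation by (auto simp: subset_chain_def)
      ultimately show ?thesis by blast
    qed
    have "quad_cone R (\<Union>\<C>)"
    proof unfold_locales
      show "\<Union>\<C> \<subseteq> carrier R"
        using CA quad_cone.P_sub by blast
      show "x \<oplus> y \<in> \<Union>\<C>" "x \<otimes> y \<in> \<Union>\<C>" if "x \<in> \<Union>\<C>" "y \<in> \<Union>\<C>" for x y
        using pair[OF that] CA quad_cone.P_add quad_cone.P_mult by (metis Union_iff)+
      show "x \<otimes> x \<in> \<Union>\<C>" if "x \<in> carrier R" for x
        using C(1) CA quad_cone.P_sq[OF _ that] by blast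
    qed
    then show "\<Union>\<C> \<in> \<A>"
      using CA C(1) by (auto simp: \<A>_def)
  qed
  then obtain Q where "Q \<in> \<A>" and max: "\<And>X. X \<in> \<A> \<Longrightarrow> Q \<subseteq> X \<Longrightarrow> X = Q"
    by auto
  then have Q: "P \<subseteq> Q" "quad_cone R Q" "\<ominus> \<one> \<notin> Q"
    unfolding \<A>_def by auto
  interpret Q: quad_cone R Q by fact
  have ext: "\<exists>p\<in>Q. \<exists>q\<in>Q. \<ominus> \<one> = p \<oplus> x \<otimes> q" if x: "x \<in> carrier R" "x \<notin> Q" for x
  proof (rule ccontr)
    assume no: "\<not> ?thesis"
    let ?Q = "{p \<oplus> x \<otimes> q | p q. p \<in> Q \<and> q \<in> Q}"
    have sub: "Q \<subseteq> ?Q"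
    proof
      fix u assume u: "u \<in> Q"
      then have "u = u \<oplus> x \<otimes> \<zero>" using x Q.P_carr by simp
      then show "u \<in> ?Q" using u Q.P_zero by blast
    qed
    have "\<ominus> \<one> \<notin> ?Q"
      using no by blast
    then have "?Q = Q"
      using Q.adjoin_cone[OF x(1)] sub Q(1) max by (auto simp: \<A>_def)
    moreover have "x = \<zero> \<oplus> x \<otimes> \<one>" using x by simp
    ultimately show False
      using x(2) Q.P_zero Q.P_one by blast
  qed
  have "x \<in> Q \<or> \<ominus> x \<in> Q" if x: "x \<in> carrier R" for x
  proof (rule ccontr)
    assume "\<not> (x \<in> Q \<or> \<ominus> x \<in> Q)"
    then obtain p q p' q' where P: "p \<in> Q" "q \<in> Q" "p' \<in> Q" "q' \<in> Q"
      and e: "\<ominus> \<one> = p \<oplus> x \<otimes> q" "\<ominus> \<one> = p' \<oplus> (\<ominus> x) \<otimes> q'"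
      using ext[of x] ext[of "\<ominus> x"] x by auto
    have c: "p \<in> carrier R" "q \<in> carrier R" "p' \<in> carrier R" "q' \<in> carrier R"
      using P Q.P_carr by auto
    \<comment> \<open>Solved for the terms in \<open>x\<close>, the equations read
      \<open>x q = - 1 - p\<close> and \<open>(- x) q' = - 1 - p'\<close>. Their product equals
      \<open>(1 + p) (1 + p')\<close>, so the right-hand side collapses to \<open>- 1\<close> while
      the left-hand side is a combination of elements of \<open>Q\<close>.\<close>
    have "p \<oplus> p' \<oplus> p \<otimes> p' \<oplus> (x \<otimes> x) \<otimes> (q \<otimes> q')
        = (\<one> \<oplus> p) \<otimes> (\<one> \<oplus> p') \<ominus> \<one> \<ominus> (x \<otimes> q) \<otimes> ((\<ominus> x) \<otimes> q')"
      using c x by algebra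
    moreover have "x \<otimes> q = (p \<oplus> x \<otimes> q) \<ominus> p" "(\<ominus> x) \<otimes> q' = (p' \<oplus> (\<ominus> x) \<otimes> q') \<ominus> p'"
      using c x by algebra+
    then have "x \<otimes> q = \<ominus> \<one> \<ominus> p" "(\<ominus> x) \<otimes> q' = \<ominus> \<one> \<ominus> p'"
      unfolding e[symmetric] .
    moreover have "(\<one> \<oplus> p) \<otimes> (\<one> \<oplus> p') \<ominus> \<one> \<ominus> (\<ominus> \<one> \<ominus> p) \<otimes> (\<ominus> \<one> \<ominus> p') = \<ominus> \<one>"
      using c by algebra
    ultimately have "p \<oplus> p' \<oplus> p \<otimes> p' \<oplus> (x \<otimes> x) \<otimes> (q \<otimes> q') = \<ominus> \<one>"
      by simp
    then show False
      using P Q(3) by (metis Q.P_add Q.P_mult Q.P_sq x)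
  qed
  with Q that show thesis by blast
qed

end

section \<open>Real values of the elements of a total cone\<close>

lemma eq_zero_if_inverse_bounded:
  fixes a C :: real
  assumes "\<And>n::nat. n > 0 \<Longrightarrow> \<bar>a\<bar> \<le> C / real n"
  shows "a = 0"
proof (rule ccontr)
  assume "a \<noteq> 0"
  then obtain n :: nat where n: "C < real n * \<bar>a\<bar>"
    using reals_Archimedean3[of "\<bar>a\<bar>"] by auto
  have "C \<ge> 0" using assms[of 1] by simp
  with n have "n > 0" by (cases n) auto
  then show False
    using assms[of n] n by (simp add: field_simps)
qed

locale total_cone = quad_cone +
  assumes neg_one: "\<ominus> \<one> \<notin> P"
    and total: "x \<in> carrier R \<Longrightarrow> x \<in> P \<or> \<ominus> x \<in> P"
    and bounded: "x \<in> carrier R \<Longrightarrow> \<exists>n. \<guillemotleft>n\<guillemotright> \<ominus> x \<in> P"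
begin

lemma of_int_P_iff: "\<guillemotleft>i\<guillemotright> \<in> P \<longleftrightarrow> 0 \<le> i"
proof
  assume i: "\<guillemotleft>i\<guillemotright> \<in> P"
  show "0 \<le> i"
  proof (rule ccontr)
    assume "\<not> 0 \<le> i"
    then have "\<guillemotleft>- 1 - i\<guillemotright> \<in> P" by (intro P_of_int) simp
    then have "\<guillemotleft>i + (- 1 - i)\<guillemotright> \<in> P" unfolding of_int_add using i P_add by blast
    moreover have "\<guillemotleft>i + (- 1 - i)\<guillemotright> = \<guillemotleft>- 1\<guillemotright>" by (rule arg_cong[of _ _ "of_integer R"]) simp
    moreover have "\<guillemotleft>- 1\<guillemotright> = \<ominus> \<one>" by simp
    ultimately show False using neg_one by simp
  qed
qed (rule P_of_int)

text \<open>Eliminating \<open>x\<close> from the two conditions leaves the integer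
  \<open>n m' - n' m\<close> in the cone, and integers in the cone are nonnegative.\<close>

lemma lower_le_upper:
  assumes x: "x \<in> carrier R" and nn: "n > 0" "n' > 0"
    and l: "\<guillemotleft>n\<guillemotright> \<otimes> x \<ominus> \<guillemotleft>m\<guillemotright> \<in> P" and u: "\<guillemotleft>m'\<guillemotright> \<ominus> \<guillemotleft>n'\<guillemotright> \<otimes> x \<in> P"
  shows "of_int m / of_int n \<le> (of_int m' / of_int n' :: real)"
proof -
  have id: "c' \<otimes> (c \<otimes> x \<ominus> d) \<oplus> c \<otimes> (d' \<ominus> c' \<otimes> x) = c \<otimes> d' \<ominus> c' \<otimes> d"
    if "c \<in> carrier R" "c' \<in> carrier R" "d \<in> carrier R" "d' \<in> carrier R" for c c' d d'
    using that x by algebra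
  have "\<guillemotleft>n'\<guillemotright> \<otimes> (\<guillemotleft>n\<guillemotright> \<otimes> x \<ominus> \<guillemotleft>m\<guillemotright>) \<oplus> \<guillemotleft>n\<guillemotright> \<otimes> (\<guillemotleft>m'\<guillemotright> \<ominus> \<guillemotleft>n'\<guillemotright> \<otimes> x) \<in> P"
    using nn l u by (intro P_add P_mult P_of_int) auto
  then have "\<guillemotleft>n * m' - n' * m\<guillemotright> \<in> P"
    by (simp add: id)
  then have "n' * m \<le> n * m'"
    unfolding of_int_P_iff by simp
  then have "real_of_int (n' * m) \<le> real_of_int (n * m')"
    by (rule of_int_le_iff[THEN iffD2])
  then show ?thesis
    using nn by (simp add: field_simps)
qed

text \<open>Without such an \<open>m\<close>, totality would raise the lower bound \<open>m0\<close>
  by one again and again, past the upper bound given by \<open>bounded\<close>.\<close>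

lemma floor_exists:
  assumes x: "x \<in> carrier R" and m0: "x \<ominus> \<guillemotleft>m0\<guillemotright> \<in> P"
  shows "\<exists>m\<ge>m0. x \<ominus> \<guillemotleft>m\<guillemotright> \<in> P \<and> \<guillemotleft>m + 1\<guillemotright> \<ominus> x \<in> P"
proof (rule ccontr)
  assume no: "\<not> ?thesis"
  have all: "x \<ominus> \<guillemotleft>m\<guillemotright> \<in> P" if "m0 \<le> m" for m
    using that
  proof (induction rule: int_ge_induct)
    case base show ?case by (rule m0)
  next
    case (step i)
    have "\<guillemotleft>i + 1\<guillemotright> \<ominus> x \<notin> P" using no step by blast
    then have "\<ominus> (\<guillemotleft>i + 1\<guillemotright> \<ominus> x) \<in> P" using total[of "\<guillemotleft>i + 1\<guillemotright> \<ominus> x"] x by (metis minus_closed of_int_closed)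
    moreover have "\<ominus> (c \<ominus> x) = x \<ominus> c" if "c \<in> carrier R" for c
      using that x by algebra
    ultimately show ?case by (metis of_int_closed)
  qed
  obtain n where n: "\<guillemotleft>n\<guillemotright> \<ominus> x \<in> P" using bounded[OF x] by blast
  define k where "k = max m0 (n + 1)"
  have "(\<guillemotleft>n\<guillemotright> \<ominus> x) \<oplus> (x \<ominus> \<guillemotleft>k\<guillemotright>) \<in> P"
    using all[of k] n by (intro P_add) (auto simp: k_def)
  moreover have "(c \<ominus> x) \<oplus> (x \<ominus> d) = c \<ominus> d" if "c \<in> carrier R" "d \<in> carrier R" for c d
    using that x by algebra
  ultimately have "\<guillemotleft>n - k\<guillemotright> \<in> P" by simp
  then show False unfolding of_int_P_iff by (simp add: k_def)
qed

lemma lower_bounded: "x \<in> carrier R \<Longrightarrow> \<exists>n. x \<ominus> \<guillemotleft>n\<guillemotright> \<in> P"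
proof -
  assume x: "x \<in> carrier R"
  obtain n where "\<guillemotleft>n\<guillemotright> \<ominus> (\<ominus> x) \<in> P" using bounded[of "\<ominus> x"] x by auto
  moreover have "\<guillemotleft>n\<guillemotright> \<ominus> (\<ominus> x) = x \<ominus> \<guillemotleft>- n\<guillemotright>"
    using x by (simp add: a_minus_def a_comm)
  ultimately show ?thesis by metis
qed

text \<open>The supremum of the lower Dedekind cut of \<open>x\<close>; rationals appear as pairs of
  integers because the ring need not contain them.\<close>

definition real_value :: "'a \<Rightarrow> real" where
  "real_value x = Sup {of_int m / of_int n | m n. n > 0 \<and> \<guillemotleft>n\<guillemotright> \<otimes> x \<ominus> \<guillemotleft>m\<guillemotright> \<in> P}"

context
  fixes x assumes x: "x \<in> carrier R"
begin

lemma real_value_ge: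
  assumes "n > 0" "\<guillemotleft>n\<guillemotright> \<otimes> x \<ominus> \<guillemotleft>m\<guillemotright> \<in> P"
  shows "of_int m / of_int n \<le> real_value x"
  unfolding real_value_def
proof (rule cSup_upper)
  obtain b where "\<guillemotleft>b\<guillemotright> \<ominus> \<guillemotleft>1\<guillemotright> \<otimes> x \<in> P" using bounded[OF x] x by auto
  then show "bdd_above {of_int m / of_int n :: real | m n. n > 0 \<and> \<guillemotleft>n\<guillemotright> \<otimes> x \<ominus> \<guillemotleft>m\<guillemotright> \<in> P}"
    using lower_le_upper[OF x, of _ 1] by (intro bdd_aboveI[of _ "of_int b / of_int 1"]) fastforce
qed (use assms in blast)

lemma real_value_le:
  assumes "n > 0" "\<guillemotleft>m\<guillemotright> \<ominus> \<guillemotleft>n\<guillemotright> \<otimes> x \<in> P"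
  shows "real_value x \<le> of_int m / of_int n"
  unfolding real_value_def
proof (rule cSup_least)
  obtain b where "\<guillemotleft>1\<guillemotright> \<otimes> x \<ominus> \<guillemotleft>b\<guillemotright> \<in> P" using lower_bounded[OF x] x by auto
  then show "{of_int m / of_int n :: real | m n. n > 0 \<and> \<guillemotleft>n\<guillemotright> \<otimes> x \<ominus> \<guillemotleft>m\<guillemotright> \<in> P} \<noteq> {}"
    using zero_less_one by blast
qed (use lower_le_upper[OF x] assms in blast)

lemma real_value_nonneg: "x \<in> P \<Longrightarrow> 0 \<le> real_value x"
  using real_value_ge[of 1 0] x by simp

end

text \<open>The integer parts of \<open>n x\<close> and \<open>n y\<close> confine both sides to the
  same interval of length \<open>2 / n\<close>.\<close>

lemma real_value_add:
  assumes x: "x \<in> carrier R" and y: "y \<in> carrier R"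
  shows "real_value (x \<oplus> y) = real_value x + real_value y"
proof -
  have "\<bar>real_value (x \<oplus> y) - (real_value x + real_value y)\<bar> \<le> 2 / real k" if k: "k > 0" for k :: nat
  proof -
    define n where "n = int k"
    have n: "n > 0" "of_int n = real k" using k by (simp_all add: n_def)
    obtain m where m: "\<guillemotleft>n\<guillemotright> \<otimes> x \<ominus> \<guillemotleft>m\<guillemotright> \<in> P" "\<guillemotleft>m + 1\<guillemotright> \<ominus> \<guillemotleft>n\<guillemotright> \<otimes> x \<in> P"
      using floor_exists[of "\<guillemotleft>n\<guillemotright> \<otimes> x"] lower_bounded[of "\<guillemotleft>n\<guillemotright> \<otimes> x"] x by auto
    obtain m' where m': "\<guillemotleft>n\<guillemotright> \<otimes> y \<ominus> \<guillemotleft>m'\<guillemotright> \<in> P" "\<guillemotleft>m' + 1\<guillemotright> \<ominus> \<guillemotleft>n\<guillemotright> \<otimes> y \<in> P"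
      using floor_exists[of "\<guillemotleft>n\<guillemotright> \<otimes> y"] lower_bounded[of "\<guillemotleft>n\<guillemotright> \<otimes> y"] y by auto
    have id: "(c \<otimes> x \<ominus> d) \<oplus> (c \<otimes> y \<ominus> e) = c \<otimes> (x \<oplus> y) \<ominus> (d \<oplus> e)"
      "(d \<ominus> c \<otimes> x) \<oplus> (e \<ominus> c \<otimes> y) = (d \<oplus> e) \<ominus> c \<otimes> (x \<oplus> y)"
      if "c \<in> carrier R" "d \<in> carrier R" "e \<in> carrier R" for c d e
      using that x y by algebra+
    have "\<guillemotleft>n\<guillemotright> \<otimes> (x \<oplus> y) \<ominus> \<guillemotleft>m + m'\<guillemotright> \<in> P"
      using P_add[OF m(1) m'(1)] by (simp only: id of_int_closed of_int_add)
    moreover have "\<guillemotleft>(m + 1) + (m' + 1)\<guillemotright> \<ominus> \<guillemotleft>n\<guillemotright> \<otimes> (x \<oplus> y) \<in> P"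
      using P_add[OF m(2) m'(2)] unfolding id(2)[OF of_int_closed of_int_closed of_int_closed]
      by (simp only: of_int_add)
    ultimately have "of_int (m + m') / of_int n \<le> real_value (x \<oplus> y)"
      "real_value (x \<oplus> y) \<le> of_int ((m + 1) + (m' + 1)) / of_int n"
      using x y n by (intro real_value_ge real_value_le; simp)+
    then show ?thesis
      using real_value_ge[OF x n(1) m(1)] real_value_le[OF x n(1) m(2)]
        real_value_ge[OF y n(1) m'(1)] real_value_le[OF y n(1) m'(2)] n
      by (simp add: add_divide_distrib)
  qed
  then show ?thesis using eq_zero_if_inverse_bounded by (metis eq_iff_diff_eq_0)
qed

lemma real_value_minus: "x \<in> carrier R \<Longrightarrow> real_value (\<ominus> x) = - real_value x"
proof -
  assume x: "x \<in> carrier R"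
  have "real_value (\<zero> \<oplus> \<zero>) = real_value \<zero> + real_value \<zero>" by (rule real_value_add) auto
  then have "real_value \<zero> = 0" by simp
  then show ?thesis using real_value_add[of x "\<ominus> x"] x by (simp add: r_neg)
qed

text \<open>Squares are treated first because \<open>x\<close> may then be replaced by
  \<open>\<ominus> x\<close>, so that by totality it can be taken in the cone. There the integer
  part of \<open>n x\<close> can be chosen nonnegative, and squaring preserves inequalities.\<close>

lemma real_value_square:
  assumes x: "x \<in> carrier R"
  shows "real_value (x \<otimes> x) = real_value x * real_value x"
proof -
  have pos: "real_value (x \<otimes> x) = real_value x * real_value x" if xP: "x \<in> P" for x
  proof -
    have x: "x \<in> carrier R" using P_carr xP .
    have "\<bar>real_value (x \<otimes> x) - real_value x * real_value x\<bar> \<le> (2 * real_value x + 1) / real k"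
      if k: "k > 0" for k :: nat
    proof -
      define n where "n = int k"
      have n: "n > 0" "of_int n = real k" using k by (simp_all add: n_def)
      have "\<guillemotleft>n\<guillemotright> \<otimes> x \<in> P" using xP n by (intro P_mult P_of_int) auto
      then obtain m where m: "m \<ge> 0" "\<guillemotleft>n\<guillemotright> \<otimes> x \<ominus> \<guillemotleft>m\<guillemotright> \<in> P" "\<guillemotleft>m + 1\<guillemotright> \<ominus> \<guillemotleft>n\<guillemotright> \<otimes> x \<in> P"
        using floor_exists[of "\<guillemotleft>n\<guillemotright> \<otimes> x" 0] x by auto
      \<comment> \<open>The difference of squares turns bounds on \<open>n x\<close> into bounds on
        \<open>n^2 x^2\<close>: the factor with the plus sign is in the cone since \<open>x\<close>
        and the integer are.\<close>
      have id: "(c \<otimes> x \<ominus> d) \<otimes> (c \<otimes> x \<oplus> d) = (c \<otimes> c) \<otimes> (x \<otimes> x) \<ominus> d \<otimes> d"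
        "(d \<ominus> c \<otimes> x) \<otimes> (c \<otimes> x \<oplus> d) = d \<otimes> d \<ominus> (c \<otimes> c) \<otimes> (x \<otimes> x)"
        if "c \<in> carrier R" "d \<in> carrier R" for c d
        using that x by algebra+
      have p: "\<guillemotleft>n\<guillemotright> \<otimes> x \<oplus> \<guillemotleft>m\<guillemotright> \<in> P" "\<guillemotleft>n\<guillemotright> \<otimes> x \<oplus> \<guillemotleft>m + 1\<guillemotright> \<in> P"
        using n m xP by (intro P_add P_mult P_of_int; simp)+
      have lo: "\<guillemotleft>n * n\<guillemotright> \<otimes> (x \<otimes> x) \<ominus> \<guillemotleft>m * m\<guillemotright> \<in> P"
        using P_mult[OF m(2) p(1)] unfolding id(1)[OF of_int_closed of_int_closed] by (simp only: of_int_mult)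
      have hi: "\<guillemotleft>(m + 1) * (m + 1)\<guillemotright> \<ominus> \<guillemotleft>n * n\<guillemotright> \<otimes> (x \<otimes> x) \<in> P"
        using P_mult[OF m(3) p(2)] unfolding id(2)[OF of_int_closed of_int_closed] by (simp only: of_int_mult)
      define a where "a = real_of_int m / real k"
      define b where "b = real_of_int (m + 1) / real k"
      define v where "v = real_value x"
      have ab: "0 \<le> a" "a \<le> v" "v \<le> b"
        using real_value_ge[OF x n(1) m(2)] real_value_le[OF x n(1) m(3)] m(1) n k
        by (simp_all add: a_def b_def v_def)
      have ba: "b = a + 1 / real k" by (simp add: a_def b_def add_divide_distrib)
      have "real_of_int (m * m) / of_int (n * n) = a * a" "real_of_int ((m + 1) * (m + 1)) / of_int (n * n) = b * b"
        using n by (simp_all add: a_def b_def)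
      then have w: "a * a \<le> real_value (x \<otimes> x)" "real_value (x \<otimes> x) \<le> b * b"
        using real_value_ge[OF _ _ lo] real_value_le[OF _ _ hi] x n by auto
      have v: "a * a \<le> v * v" "v * v \<le> b * b" using ab by (auto intro!: mult_mono)
      have "b * b - a * a = (2 * a + 1 / real k) / real k" using k by (simp add: ba field_simps)
      also have "\<dots> \<le> (2 * v + 1) / real k" using k ab by (intro divide_right_mono add_mono) auto
      finally show ?thesis using v w by (simp add: v_def)
    qed
    then show ?thesis using eq_zero_if_inverse_bounded by (metis eq_iff_diff_eq_0)
  qed
  have "(\<ominus> x) \<otimes> (\<ominus> x) = x \<otimes> x" using x by algebra
  then show ?thesis
    using pos[of x] pos[of "\<ominus> x"] total[OF x] real_value_minus[OF x] by auto
qed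

text \<open>Polarization: the square of \<open>x \<oplus> y\<close> determines twice the product,
  and the factor 2 is cancelled in the reals.\<close>

lemma real_value_mult:
  assumes x: "x \<in> carrier R" and y: "y \<in> carrier R"
  shows "real_value (x \<otimes> y) = real_value x * real_value y"
proof -
  have "(x \<oplus> y) \<otimes> (x \<oplus> y) = (x \<otimes> x \<oplus> y \<otimes> y) \<oplus> (x \<otimes> y \<oplus> x \<otimes> y)"
    using x y by algebra
  then have "real_value ((x \<oplus> y) \<otimes> (x \<oplus> y)) = real_value ((x \<otimes> x \<oplus> y \<otimes> y) \<oplus> (x \<otimes> y \<oplus> x \<otimes> y))"
    by simp
  then show ?thesis
    using x y by (simp add: real_value_square real_value_add algebra_simps)
qed

lemma real_value_one: "real_value \<one> = 1"
  using real_value_ge[of \<one> 1 1] real_value_le[of \<one> 1 1] P_zero by (simp add: r_neg a_minus_def)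

end

text \<open>\<open>unperforated\<close> stands in for division by integers, and \<open>arch\<close>
  is the archimedean property with the unit as the fixed summand.\<close>

locale arch_cone = quad_cone +
  assumes bounded: "x \<in> carrier R \<Longrightarrow> \<exists>n. \<guillemotleft>n\<guillemotright> \<ominus> x \<in> P"
    and unperforated: "x \<in> carrier R \<Longrightarrow> n > 0 \<Longrightarrow> \<guillemotleft>n\<guillemotright> \<otimes> x \<in> P \<Longrightarrow> x \<in> P"
    and arch: "x \<in> carrier R \<Longrightarrow> (\<And>k. k > 0 \<Longrightarrow> \<guillemotleft>k\<guillemotright> \<otimes> x \<oplus> \<one> \<in> P) \<Longrightarrow> x \<in> P"
begin

text \<open>For real functions, \<open>q\<close> nonnegative and \<open>c q\<close> at least 1 force
  \<open>c\<close> to be positive at each point. The algebraic substitute raises some lower bound of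
  \<open>c\<close> to 0 in finitely many steps of size \<open>1 / n\<close>, where \<open>n\<close>
  bounds \<open>q\<close> from above.\<close>

lemma nonneg_if_multiple_ge_one:
  assumes c: "c \<in> carrier R" and q: "q \<in> P" and cq: "c \<otimes> q \<ominus> \<one> \<in> P"
  shows "c \<in> P"
proof -
  have qc: "q \<in> carrier R" using P_carr q .
  obtain n0 where n0: "\<guillemotleft>n0\<guillemotright> \<ominus> q \<in> P" using bounded[OF qc] by blast
  define n where "n = max 1 n0"
  have n: "n > 0" by (simp add: n_def)
  have "(\<guillemotleft>n0\<guillemotright> \<ominus> q) \<oplus> \<guillemotleft>n - n0\<guillemotright> \<in> P" by (intro P_add n0 P_of_int) (simp add: n_def)
  moreover have "(d \<ominus> q) \<oplus> (e \<ominus> d) = e \<ominus> q" if "d \<in> carrier R" "e \<in> carrier R" for d e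
    using that qc by algebra
  ultimately have nq: "\<guillemotleft>n\<guillemotright> \<ominus> q \<in> P" by simp
  \<comment> \<open>Multiplying by \<open>n - q\<close> improves the lower bound \<open>- (j + 1) / n\<close> of \<open>c\<close> to \<open>- j / n\<close>.\<close>
  have step: "\<guillemotleft>n\<guillemotright> \<otimes> c \<oplus> \<guillemotleft>j\<guillemotright> \<in> P" if j: "\<guillemotleft>n\<guillemotright> \<otimes> c \<oplus> \<guillemotleft>j + 1\<guillemotright> \<in> P" "0 \<le> j" for j
  proof (rule unperforated[OF _ n])
    have "(\<guillemotleft>n\<guillemotright> \<ominus> q) \<otimes> (\<guillemotleft>n\<guillemotright> \<otimes> c \<oplus> \<guillemotleft>j + 1\<guillemotright>) \<oplus> \<guillemotleft>n\<guillemotright> \<otimes> (c \<otimes> q \<ominus> \<one>) \<oplus> \<guillemotleft>j + 1\<guillemotright> \<otimes> q \<in> P"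
      using j n by (intro P_add[OF P_add] P_mult nq j q cq P_of_int) auto
    moreover have "(d \<ominus> q) \<otimes> (d \<otimes> c \<oplus> (e \<oplus> \<one>)) \<oplus> d \<otimes> (c \<otimes> q \<ominus> \<one>) \<oplus> (e \<oplus> \<one>) \<otimes> q = d \<otimes> (d \<otimes> c \<oplus> e)"
      if "d \<in> carrier R" "e \<in> carrier R" for d e
      using that c qc by algebra
    ultimately show "\<guillemotleft>n\<guillemotright> \<otimes> (\<guillemotleft>n\<guillemotright> \<otimes> c \<oplus> \<guillemotleft>j\<guillemotright>) \<in> P"
      by simp
  qed (use c in simp)
  obtain m0 where m0: "\<guillemotleft>m0\<guillemotright> \<ominus> \<ominus> (\<guillemotleft>n\<guillemotright> \<otimes> c) \<in> P" using bounded[of "\<ominus> (\<guillemotleft>n\<guillemotright> \<otimes> c)"] c by auto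
  define m where "m = nat (max 0 m0)"
  have "(\<guillemotleft>m0\<guillemotright> \<ominus> \<ominus> (\<guillemotleft>n\<guillemotright> \<otimes> c)) \<oplus> \<guillemotleft>int m - m0\<guillemotright> \<in> P" by (intro P_add m0 P_of_int) (simp add: m_def)
  moreover have "(d \<ominus> \<ominus> (f \<otimes> c)) \<oplus> (e \<ominus> d) = f \<otimes> c \<oplus> e" if "d \<in> carrier R" "e \<in> carrier R" "f \<in> carrier R" for d e f
    using that c by algebra
  ultimately have "\<guillemotleft>n\<guillemotright> \<otimes> c \<oplus> \<guillemotleft>int m\<guillemotright> \<in> P" by simp
  then have "\<guillemotleft>n\<guillemotright> \<otimes> c \<oplus> \<guillemotleft>int 0\<guillemotright> \<in> P"
  proof (induction m)
    case (Suc m)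
    then show ?case using step[of "int m"] by (simp add: add.commute)
  qed
  then show ?thesis using unperforated[OF c n] c by simp
qed

text \<open>A case of the Kadison--Dubois representation theorem.\<close>

theorem character_separation:
  assumes a: "a \<in> carrier R" "a \<notin> P"
  obtains \<phi> :: "'a \<Rightarrow> real" where
    "\<And>x y. x \<in> carrier R \<Longrightarrow> y \<in> carrier R \<Longrightarrow> \<phi> (x \<oplus> y) = \<phi> x + \<phi> y"
    "\<And>x y. x \<in> carrier R \<Longrightarrow> y \<in> carrier R \<Longrightarrow> \<phi> (x \<otimes> y) = \<phi> x * \<phi> y"
    "\<phi> \<one> = 1" "\<And>x. x \<in> P \<Longrightarrow> \<phi> x \<ge> 0" "\<phi> a < 0"
proof -
  \<comment> \<open>The shift by \<open>\<one>\<close> buys strictness. A character that is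
    nonpositive on \<open>a\<close> would not be enough, but nonpositivity on \<open>k a + 1\<close>
    forces the value at \<open>a\<close> to be negative.\<close>
  obtain k where k: "k > 0" "\<guillemotleft>k\<guillemotright> \<otimes> a \<oplus> \<one> \<notin> P" using arch a by blast
  define c where "c = \<guillemotleft>k\<guillemotright> \<otimes> a \<oplus> \<one>"
  have c: "c \<in> carrier R" "c \<notin> P" using k a by (simp_all add: c_def)
  let ?Q = "{p \<oplus> (\<ominus> c) \<otimes> q | p q. p \<in> P \<and> q \<in> P}"
  interpret Q0: quad_cone R ?Q by (rule adjoin_cone) (use c in simp)
  \<comment> \<open>An equation \<open>- 1 = p - c q\<close> says that \<open>c q - 1\<close> is the
    element \<open>p\<close> of the cone, which would make \<open>c\<close> positive.\<close>
  have "\<ominus> \<one> \<notin> ?Q"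
  proof
    assume "\<ominus> \<one> \<in> ?Q"
    then obtain p q where pq: "p \<in> P" "q \<in> P" "\<ominus> \<one> = p \<oplus> (\<ominus> c) \<otimes> q" by blast
    then have pqc: "p \<in> carrier R" "q \<in> carrier R" using P_carr by auto
    have "c \<otimes> q \<ominus> \<one> = c \<otimes> q \<oplus> (p \<oplus> (\<ominus> c) \<otimes> q)" using pq(3) by (simp add: a_minus_def)
    also have "\<dots> = p" using pqc c by algebra
    finally show False using nonneg_if_multiple_ge_one[OF c(1) pq(2)] pq(1) c(2) by simp
  qed
  then obtain Q where Q: "?Q \<subseteq> Q" "quad_cone R Q" "\<ominus> \<one> \<notin> Q"
    "\<And>x. x \<in> carrier R \<Longrightarrow> x \<in> Q \<or> \<ominus> x \<in> Q"
    using Q0.total_extension by blast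
  interpret Q: quad_cone R Q by fact
  have PQ: "p \<in> Q" if p: "p \<in> P" for p
  proof -
    have "p = p \<oplus> (\<ominus> c) \<otimes> \<zero>" using P_carr[OF p] c by simp
    then have "p \<in> ?Q" using p P_zero by blast
    then show ?thesis using Q(1) by blast
  qed
  interpret Q: total_cone R Q
    by unfold_locales (use Q bounded PQ in blast)+
  have "\<ominus> c = \<zero> \<oplus> (\<ominus> c) \<otimes> \<one>" using c by simp
  then have "\<ominus> c \<in> ?Q" using P_zero P_one by blast
  then have "0 \<le> Q.real_value (\<ominus> c)" using Q(1) c by (intro Q.real_value_nonneg) auto
  then have "Q.real_value c \<le> 0" using Q.real_value_minus c by simp
  moreover have "Q.real_value c = Q.real_value \<guillemotleft>k\<guillemotright> * Q.real_value a + 1"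
    using a by (simp add: c_def Q.real_value_add Q.real_value_mult Q.real_value_one)
  moreover have "0 \<le> Q.real_value \<guillemotleft>k\<guillemotright>" using k by (intro Q.real_value_nonneg Q.P_of_int) auto
  ultimately have "Q.real_value a < 0" by (smt (verit) mult_nonneg_nonneg)
  then show thesis
    using that[of Q.real_value] Q.real_value_add Q.real_value_mult Q.real_value_one
      Q.real_value_nonneg PQ P_carr by blast
qed

end

section \<open>The localization\<close>

lemma (in cring) diff_eqI: "a \<ominus> b = \<zero> \<Longrightarrow> a \<in> carrier R \<Longrightarrow> b \<in> carrier R \<Longrightarrow> a = b"
  using eq_diff0 by blast

lemma (in ring) add_pow_eq_of_nat: "x \<in> carrier R \<Longrightarrow> [n] \<cdot> x = \<guillemotleft>n\<guillemotright>\<^sub>\<nat> \<otimes> x"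
  by (induction n) (simp_all add: l_distr a_comm)

lemma (in ring) of_int_of_nat: "\<guillemotleft>int n\<guillemotright> = \<guillemotleft>n\<guillemotright>\<^sub>\<nat>"
  by (simp add: of_integer_def)

locale po_ring = cring R for R :: "'a ring" (structure) +
  fixes leq :: "'a \<Rightarrow> 'a \<Rightarrow> bool"
  assumes po: "po_cring R leq"
begin

abbreviation "P \<equiv> pos_cone R leq"
abbreviation "S \<equiv> Loc R leq"
abbreviation "L \<equiv> Rloc R leq"
abbreviation "B \<equiv> Rloc_bd R leq"
abbreviation "fr r s \<equiv> frac_cls R leq (r, s)"

lemma leq_antisym: "x \<in> carrier R \<Longrightarrow> y \<in> carrier R \<Longrightarrow> leq x y \<Longrightarrow> leq y x \<Longrightarrow> x = y"
  using po[unfolded po_cring_def, THEN conjunct2, THEN conjunct2, THEN conjunct1] by simp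

lemma leq_trans: "x \<in> carrier R \<Longrightarrow> y \<in> carrier R \<Longrightarrow> z \<in> carrier R \<Longrightarrow> leq x y \<Longrightarrow> leq y z \<Longrightarrow> leq x z"
  using po[unfolded po_cring_def, THEN conjunct2, THEN conjunct2, THEN conjunct2, THEN conjunct1] by blast

lemma leq_add: "x \<in> carrier R \<Longrightarrow> y \<in> carrier R \<Longrightarrow> z \<in> carrier R \<Longrightarrow> leq x y \<Longrightarrow> leq (x \<oplus> z) (y \<oplus> z)"
  using po unfolding po_cring_def by blast

lemma leq_mult: "x \<in> carrier R \<Longrightarrow> y \<in> carrier R \<Longrightarrow> leq \<zero> x \<Longrightarrow> leq \<zero> y \<Longrightarrow> leq \<zero> (x \<otimes> y)"
  using po unfolding po_cring_def by blast

lemma leq_sq: "x \<in> carrier R \<Longrightarrow> leq \<zero> (x \<otimes> x)"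
  using po unfolding po_cring_def by blast

sublocale quad_cone R "pos_cone R leq"
proof unfold_locales
  fix x y assume xy: "x \<in> P" "y \<in> P"
  then have c: "x \<in> carrier R" "y \<in> carrier R" "leq \<zero> x" "leq \<zero> y" by (auto simp: pos_cone_def)
  have "leq y (x \<oplus> y)" using leq_add[of \<zero> x y] c by simp
  then show "x \<oplus> y \<in> P" using leq_trans[of \<zero> y "x \<oplus> y"] c by (simp add: pos_cone_def)
  show "x \<otimes> y \<in> P" using c by (simp add: leq_mult pos_cone_def)
qed (auto simp: leq_sq pos_cone_def)

lemma leq_iff:
  assumes c: "x \<in> carrier R" "y \<in> carrier R"
  shows "leq x y \<longleftrightarrow> y \<ominus> x \<in> P"
proof
  assume "leq x y"
  then have "leq (x \<oplus> (\<ominus> x)) (y \<oplus> (\<ominus> x))" using c by (intro leq_add) auto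
  then show "y \<ominus> x \<in> P" using c by (simp add: pos_cone_def a_minus_def r_neg)
next
  assume "y \<ominus> x \<in> P"
  then have "leq (\<zero> \<oplus> x) ((y \<ominus> x) \<oplus> x)" using c by (intro leq_add) (auto simp: pos_cone_def)
  moreover have "(y \<ominus> x) \<oplus> x = y" using c by algebra
  ultimately show "leq x y" using c by simp
qed

lemma P_antisym: "x \<in> P \<Longrightarrow> \<ominus> x \<in> P \<Longrightarrow> x = \<zero>"
proof -
  assume a: "x \<in> P" "\<ominus> x \<in> P"
  have c: "x \<in> carrier R" using a(1) by (rule P_carr)
  have "leq \<zero> x" "leq x \<zero>" using a c by (simp_all add: leq_iff a_minus_def)
  then show "x = \<zero>" using c leq_antisym by blast
qed

lemma Loc_P: "s \<in> S \<Longrightarrow> s \<in> P"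
proof -
  assume "s \<in> S"
  then obtain p where "p \<in> P" "s = \<one> \<oplus> p" unfolding Loc_def by blast
  then show ?thesis using P_add[OF P_one] by simp
qed

lemma Loc_carr: "s \<in> S \<Longrightarrow> s \<in> carrier R"
  using Loc_P P_carr by blast

lemma Loc_minus_one: "s \<in> S \<Longrightarrow> s \<ominus> \<one> \<in> P"
proof -
  assume "s \<in> S"
  then obtain p where p: "p \<in> P" "s = \<one> \<oplus> p" unfolding Loc_def by blast
  then have "p \<in> carrier R" using P_carr by blast
  then have "s \<ominus> \<one> = p" unfolding p(2) by algebra
  then show ?thesis using p by simp
qed

lemma Loc_cancel: "s \<in> S \<Longrightarrow> r \<in> carrier R \<Longrightarrow> r \<otimes> s \<in> P \<Longrightarrow> r \<in> P"
  unfolding Loc_def by (drule CollectD, erule conjE, drule (1) bspec, erule mp)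

lemma LocI: "s \<in> carrier R \<Longrightarrow> s \<ominus> \<one> \<in> P \<Longrightarrow> (\<And>r. r \<in> carrier R \<Longrightarrow> r \<otimes> s \<in> P \<Longrightarrow> r \<in> P) \<Longrightarrow> s \<in> S"
proof -
  assume a: "s \<in> carrier R" "s \<ominus> \<one> \<in> P" "\<And>r. r \<in> carrier R \<Longrightarrow> r \<otimes> s \<in> P \<Longrightarrow> r \<in> P"
  have "s = \<one> \<oplus> (s \<ominus> \<one>)" using a(1) by algebra
  then have "\<exists>p\<in>P. s = \<one> \<oplus> p" using a(2) by (rule bexI)
  moreover have "\<forall>r\<in>carrier R. r \<otimes> s \<in> P \<longrightarrow> r \<in> P" by (intro ballI impI) (erule (1) a(3))
  ultimately show ?thesis unfolding Loc_def by (intro CollectI conjI)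
qed

lemma Loc_one: "\<one> \<in> S"
  by (rule LocI) (simp_all add: a_minus_def r_neg P_zero)

lemma Loc_mult:
  assumes s: "s \<in> S" "t \<in> S"
  shows "s \<otimes> t \<in> S"
proof (rule LocI)
  have c: "s \<in> carrier R" "t \<in> carrier R" using s Loc_carr by auto
  show "s \<otimes> t \<in> carrier R" using c by simp
  have "s \<otimes> t \<ominus> \<one> = (s \<ominus> \<one>) \<otimes> t \<oplus> (t \<ominus> \<one>)" using c by algebra
  then show "s \<otimes> t \<ominus> \<one> \<in> P" using s by (simp add: P_add P_mult Loc_minus_one Loc_P)
  fix r assume r: "r \<in> carrier R" "r \<otimes> (s \<otimes> t) \<in> P"
  then have "(r \<otimes> s) \<otimes> t \<in> P" using c by (simp add: m_assoc)
  then show "r \<in> P" using s r c Loc_cancel by (meson m_closed)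
qed

lemma Loc_cancel_iff: "s \<in> S \<Longrightarrow> r \<in> carrier R \<Longrightarrow> r \<otimes> s \<in> P \<longleftrightarrow> r \<in> P"
  by (rule iffI, erule (2) Loc_cancel, erule P_mult, erule Loc_P)

text \<open>The definition of \<open>Loc\<close> cancels positivity only; applied to
  \<open>r\<close> and to \<open>\<ominus> r\<close> it cancels equations as well, by
  antisymmetry.\<close>

lemma Loc_cancel_zero:
  assumes s: "s \<in> S" and r: "r \<in> carrier R" and e: "r \<otimes> s = \<zero>"
  shows "r = \<zero>"
proof -
  have "(\<ominus> r) \<otimes> s = \<ominus> (r \<otimes> s)" using r Loc_carr[OF s] by algebra
  then have "r \<in> P" "\<ominus> r \<in> P" using e r P_zero Loc_cancel[OF s r] Loc_cancel[OF s, of "\<ominus> r"] by simp_all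
  then show ?thesis by (rule P_antisym)
qed

lemma Loc_cancel_eq:
  assumes s: "s \<in> S" and r: "r \<in> carrier R" "r' \<in> carrier R" and e: "r \<otimes> s = r' \<otimes> s"
  shows "r = r'"
proof -
  have "(r \<ominus> r') \<otimes> s = r \<otimes> s \<ominus> r' \<otimes> s" using r Loc_carr[OF s] by algebra
  also have "\<dots> = \<zero>" using e r Loc_carr[OF s] by (simp add: a_minus_def r_neg)
  finally have "r \<ominus> r' = \<zero>" using r Loc_cancel_zero[OF s, of "r \<ominus> r'"] by simp
  then show ?thesis using r by (rule diff_eqI)
qed

section \<open>Arithmetic and order of fractions\<close>

lemma mem_fr: "x \<in> fr r s \<longleftrightarrow> fst x \<in> carrier R \<and> snd x \<in> S \<and> r \<otimes> snd x = fst x \<otimes> s"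
  by (cases x) (simp add: frac_cls_def)

text \<open>Transitivity of the relation between fractions: the intermediate denominator
  \<open>s\<close> is cancelled as an element of \<open>Loc\<close>.\<close>

lemma fr_eqI:
  assumes c: "r \<in> carrier R" "r' \<in> carrier R" "s \<in> S" "s' \<in> S" and e: "r \<otimes> s' = r' \<otimes> s"
  shows "fr r s = fr r' s'"
proof -
  have sub: "fr r s \<subseteq> fr r' s'"
    if c: "r \<in> carrier R" "r' \<in> carrier R" "s \<in> S" "s' \<in> S" and e: "r \<otimes> s' = r' \<otimes> s" for r r' s s'
  proof
    fix x assume "x \<in> fr r s"
    then have x: "fst x \<in> carrier R" "snd x \<in> S" "r \<otimes> snd x = fst x \<otimes> s" by (auto simp: mem_fr)
    note cc = c(1,2) Loc_carr[OF c(3)] Loc_carr[OF c(4)] x(1) Loc_carr[OF x(2)]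
    define u v where "u = fst x" "v = snd x"
    have uv: "u \<in> carrier R" "v \<in> carrier R" using cc by (simp_all add: u_v_def)
    have "(r' \<otimes> v) \<otimes> s = (r' \<otimes> s) \<otimes> v" using cc uv by algebra
    also have "\<dots> = (r \<otimes> v) \<otimes> s'" unfolding e[symmetric] using cc uv by algebra
    also have "\<dots> = (u \<otimes> s) \<otimes> s'" using x by (simp add: u_v_def)
    also have "\<dots> = (u \<otimes> s') \<otimes> s" using cc uv by algebra
    finally have "r' \<otimes> v = u \<otimes> s'" using cc uv Loc_cancel_eq[OF c(3), of "r' \<otimes> v" "u \<otimes> s'"] by simp
    then show "x \<in> fr r' s'" using x by (simp add: mem_fr u_v_def)
  qed
  show ?thesis using sub[OF c e] sub[OF c(2,1,4,3) e[symmetric]] by auto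
qed

lemma fr_self: "r \<in> carrier R \<Longrightarrow> s \<in> S \<Longrightarrow> (r, s) \<in> fr r s"
  by (simp add: mem_fr)

lemma fr_some:
  assumes "r \<in> carrier R" "s \<in> S"
  obtains r' s' where "(SOME x. x \<in> fr r s) = (r', s')" "r' \<in> carrier R" "s' \<in> S" "r \<otimes> s' = r' \<otimes> s"
proof -
  have "(SOME x. x \<in> fr r s) \<in> fr r s"
    using fr_self[OF assms] by (rule someI)
  then show thesis using that[of "fst (SOME x. x \<in> fr r s)" "snd (SOME x. x \<in> fr r s)"] by (simp add: mem_fr)
qed

text \<open>\<open>Rloc\<close> multiplies representatives picked by \<open>SOME\<close>; this lemma
  and the next one replace them by any given representatives.\<close>

lemma Rloc_mult:
  assumes c: "r \<in> carrier R" "r' \<in> carrier R" "s \<in> S" "s' \<in> S"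
  shows "fr r s \<otimes>\<^bsub>L\<^esub> fr r' s' = fr (r \<otimes> r') (s \<otimes> s')"
proof -
  obtain a b where ab: "(SOME x. x \<in> fr r s) = (a, b)" "a \<in> carrier R" "b \<in> S" "r \<otimes> b = a \<otimes> s"
    using fr_some c by blast
  obtain a' b' where ab': "(SOME x. x \<in> fr r' s') = (a', b')" "a' \<in> carrier R" "b' \<in> S" "r' \<otimes> b' = a' \<otimes> s'"
    using fr_some c by blast
  note cc = c(1,2) Loc_carr[OF c(3)] Loc_carr[OF c(4)] ab(2) ab'(2) Loc_carr[OF ab(3)] Loc_carr[OF ab'(3)]
  have "(a \<otimes> a') \<otimes> (s \<otimes> s') = (a \<otimes> s) \<otimes> (a' \<otimes> s')" using cc by algebra
  also have "\<dots> = (r \<otimes> r') \<otimes> (b \<otimes> b')" unfolding ab(4)[symmetric] ab'(4)[symmetric] using cc by algebra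
  finally have "fr (a \<otimes> a') (b \<otimes> b') = fr (r \<otimes> r') (s \<otimes> s')"
    using cc c ab ab' by (intro fr_eqI) (auto intro: Loc_mult)
  then show ?thesis by (simp add: Rloc_def ab ab')
qed

lemma Rloc_add:
  assumes c: "r \<in> carrier R" "r' \<in> carrier R" "s \<in> S" "s' \<in> S"
  shows "fr r s \<oplus>\<^bsub>L\<^esub> fr r' s' = fr ((r \<otimes> s') \<oplus> (r' \<otimes> s)) (s \<otimes> s')"
proof -
  obtain a b where ab: "(SOME x. x \<in> fr r s) = (a, b)" "a \<in> carrier R" "b \<in> S" "r \<otimes> b = a \<otimes> s"
    using fr_some c by blast
  obtain a' b' where ab': "(SOME x. x \<in> fr r' s') = (a', b')" "a' \<in> carrier R" "b' \<in> S" "r' \<otimes> b' = a' \<otimes> s'"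
    using fr_some c by blast
  note cc = c(1,2) Loc_carr[OF c(3)] Loc_carr[OF c(4)] ab(2) ab'(2) Loc_carr[OF ab(3)] Loc_carr[OF ab'(3)]
  have "((a \<otimes> b') \<oplus> (a' \<otimes> b)) \<otimes> (s \<otimes> s') = (a \<otimes> s) \<otimes> (b' \<otimes> s') \<oplus> (a' \<otimes> s') \<otimes> (b \<otimes> s)" using cc by algebra
  also have "\<dots> = ((r \<otimes> s') \<oplus> (r' \<otimes> s)) \<otimes> (b \<otimes> b')"
    unfolding ab(4)[symmetric] ab'(4)[symmetric] using cc by algebra
  finally have "fr ((a \<otimes> b') \<oplus> (a' \<otimes> b)) (b \<otimes> b') = fr ((r \<otimes> s') \<oplus> (r' \<otimes> s)) (s \<otimes> s')"
    using cc c ab ab' by (intro fr_eqI) (auto intro: Loc_mult)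
  then show ?thesis by (simp add: Rloc_def ab ab')
qed

lemma Rloc_zero: "\<zero>\<^bsub>L\<^esub> = fr \<zero> \<one>" and Rloc_one: "\<one>\<^bsub>L\<^esub> = fr \<one> \<one>"
  by (simp_all add: Rloc_def)

lemma fr_carrier [simp]: "r \<in> carrier R \<Longrightarrow> s \<in> S \<Longrightarrow> fr r s \<in> carrier L"
  by (auto simp: Rloc_def)

lemma Rloc_cases:
  assumes "x \<in> carrier L"
  obtains r s where "x = fr r s" "r \<in> carrier R" "s \<in> S"
  using assms by (auto simp: Rloc_def)

lemma Rloc_add_same:
  assumes c: "r \<in> carrier R" "r' \<in> carrier R" "s \<in> S"
  shows "fr r s \<oplus>\<^bsub>L\<^esub> fr r' s = fr (r \<oplus> r') s"
proof -
  note cc = c(1,2) Loc_carr[OF c(3)]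
  have "(r \<otimes> s \<oplus> r' \<otimes> s) \<otimes> s = (r \<oplus> r') \<otimes> (s \<otimes> s)" using cc by algebra
  then show ?thesis using c cc by (simp add: Rloc_add, intro fr_eqI) (auto intro: Loc_mult)
qed

lemma Rloc_cring: "cring L"
proof (rule cringI)
  show "abelian_group L"
  proof (rule abelian_groupI)
    fix x y assume "x \<in> carrier L" "y \<in> carrier L"
    then obtain r s r' s' where x: "x = fr r s" "r \<in> carrier R" "s \<in> S"
      and y: "y = fr r' s'" "r' \<in> carrier R" "s' \<in> S" using Rloc_cases by metis
    have cc: "s \<in> carrier R" "s' \<in> carrier R" using x y Loc_carr by auto
    show "x \<oplus>\<^bsub>L\<^esub> y \<in> carrier L" using x y cc by (simp add: Rloc_add Loc_mult)
    show "x \<oplus>\<^bsub>L\<^esub> y = y \<oplus>\<^bsub>L\<^esub> x" using x y cc by (simp add: Rloc_add a_comm m_comm)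
    fix z assume "z \<in> carrier L"
    then obtain r'' s'' where z: "z = fr r'' s''" "r'' \<in> carrier R" "s'' \<in> S" using Rloc_cases by metis
    have c3: "s'' \<in> carrier R" using z Loc_carr by auto
    have "((r \<otimes> s' \<oplus> r' \<otimes> s) \<otimes> s'' \<oplus> r'' \<otimes> (s \<otimes> s')) = (r \<otimes> (s' \<otimes> s'') \<oplus> (r' \<otimes> s'' \<oplus> r'' \<otimes> s') \<otimes> s)"
      using x(2) y(2) z(2) cc c3 by algebra
    then show "x \<oplus>\<^bsub>L\<^esub> y \<oplus>\<^bsub>L\<^esub> z = x \<oplus>\<^bsub>L\<^esub> (y \<oplus>\<^bsub>L\<^esub> z)"
      using x y z cc c3 by (simp add: Rloc_add Loc_mult m_assoc)
  next
    show "\<zero>\<^bsub>L\<^esub> \<in> carrier L" by (simp add: Rloc_zero Loc_one)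
  next
    fix x assume "x \<in> carrier L"
    then obtain r s where x: "x = fr r s" "r \<in> carrier R" "s \<in> S" using Rloc_cases by metis
    have cc: "s \<in> carrier R" using x Loc_carr by auto
    show "\<zero>\<^bsub>L\<^esub> \<oplus>\<^bsub>L\<^esub> x = x" using x cc by (simp add: Rloc_zero Rloc_add Loc_one)
    have "fr (\<ominus> r) s \<oplus>\<^bsub>L\<^esub> x = fr \<zero> s" using x by (simp add: Rloc_add_same l_neg)
    also have "\<dots> = \<zero>\<^bsub>L\<^esub>" using x cc by (simp add: Rloc_zero, intro fr_eqI) (auto simp: Loc_one)
    finally show "\<exists>y\<in>carrier L. y \<oplus>\<^bsub>L\<^esub> x = \<zero>\<^bsub>L\<^esub>" using x by (intro bexI[of _ "fr (\<ominus> r) s"]) auto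
  qed
next
  show "comm_monoid L"
  proof (rule comm_monoidI)
    fix x y assume "x \<in> carrier L" "y \<in> carrier L"
    then obtain r s r' s' where x: "x = fr r s" "r \<in> carrier R" "s \<in> S"
      and y: "y = fr r' s'" "r' \<in> carrier R" "s' \<in> S" using Rloc_cases by metis
    have cc: "s \<in> carrier R" "s' \<in> carrier R" using x y Loc_carr by auto
    show "x \<otimes>\<^bsub>L\<^esub> y \<in> carrier L" using x y cc by (simp add: Rloc_mult Loc_mult)
    show "x \<otimes>\<^bsub>L\<^esub> y = y \<otimes>\<^bsub>L\<^esub> x" using x y cc by (simp add: Rloc_mult m_comm)
    fix z assume "z \<in> carrier L"
    then obtain r'' s'' where z: "z = fr r'' s''" "r'' \<in> carrier R" "s'' \<in> S" using Rloc_cases by metis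
    then show "x \<otimes>\<^bsub>L\<^esub> y \<otimes>\<^bsub>L\<^esub> z = x \<otimes>\<^bsub>L\<^esub> (y \<otimes>\<^bsub>L\<^esub> z)"
      using x y z cc Loc_carr by (simp add: Rloc_mult Loc_mult m_assoc)
  next
    show "\<one>\<^bsub>L\<^esub> \<in> carrier L" by (simp add: Rloc_one Loc_one)
  next
    fix x assume "x \<in> carrier L"
    then obtain r s where x: "x = fr r s" "r \<in> carrier R" "s \<in> S" using Rloc_cases by metis
    then show "\<one>\<^bsub>L\<^esub> \<otimes>\<^bsub>L\<^esub> x = x" using Loc_carr by (simp add: Rloc_one Rloc_mult Loc_one)
  qed
next
  fix x y z assume "x \<in> carrier L" "y \<in> carrier L" "z \<in> carrier L"
  then obtain r s r' s' r'' s'' where x: "x = fr r s" "r \<in> carrier R" "s \<in> S"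
    and y: "y = fr r' s'" "r' \<in> carrier R" "s' \<in> S" and z: "z = fr r'' s''" "r'' \<in> carrier R" "s'' \<in> S"
    using Rloc_cases by metis
  have cc: "s \<in> carrier R" "s' \<in> carrier R" "s'' \<in> carrier R" using x y z Loc_carr by auto
  \<comment> \<open>The two sides of distributivity carry denominators that differ by a factor
    \<open>s''\<close>, so they are compared after cross-multiplication.\<close>
  have "((r \<otimes> s' \<oplus> r' \<otimes> s) \<otimes> r'') \<otimes> ((s \<otimes> s'') \<otimes> (s' \<otimes> s''))
    = ((r \<otimes> r'') \<otimes> (s' \<otimes> s'') \<oplus> (r' \<otimes> r'') \<otimes> (s \<otimes> s'')) \<otimes> ((s \<otimes> s') \<otimes> s'')"
    using x(2) y(2) z(2) cc by algebra
  then show "(x \<oplus>\<^bsub>L\<^esub> y) \<otimes>\<^bsub>L\<^esub> z = x \<otimes>\<^bsub>L\<^esub> z \<oplus>\<^bsub>L\<^esub> y \<otimes>\<^bsub>L\<^esub> z"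
    using x y z cc by (simp add: Rloc_add Rloc_mult Loc_mult, intro fr_eqI) (auto intro: Loc_mult)
qed

sublocale L: cring "Rloc R leq" by (rule Rloc_cring)

lemma Rloc_neg: "r \<in> carrier R \<Longrightarrow> s \<in> S \<Longrightarrow> \<ominus>\<^bsub>L\<^esub> fr r s = fr (\<ominus> r) s"
proof -
  assume c: "r \<in> carrier R" "s \<in> S"
  have "fr (\<ominus> r) s \<oplus>\<^bsub>L\<^esub> fr r s = fr \<zero> s" using c by (simp add: Rloc_add_same l_neg)
  also have "\<dots> = \<zero>\<^bsub>L\<^esub>" using c Loc_carr by (simp add: Rloc_zero, intro fr_eqI) (auto simp: Loc_one)
  finally show ?thesis using c by (intro L.minus_equality) auto
qed

lemma Rloc_minus_same: "r \<in> carrier R \<Longrightarrow> r' \<in> carrier R \<Longrightarrow> s \<in> S \<Longrightarrow> fr r s \<ominus>\<^bsub>L\<^esub> fr r' s = fr (r \<ominus> r') s"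
  by (simp add: a_minus_def Rloc_neg Rloc_add_same)

lemma Rloc_of_nat: "\<guillemotleft>n\<guillemotright>\<^sub>\<nat>\<^bsub>L\<^esub> = fr \<guillemotleft>n\<guillemotright>\<^sub>\<nat> \<one>"
  by (induction n) (simp_all add: Rloc_zero Rloc_one Rloc_add_same Loc_one)

lemma Rloc_of_int: "\<guillemotleft>i\<guillemotright>\<^bsub>L\<^esub> = fr \<guillemotleft>i\<guillemotright> \<one>"
  by (simp add: of_integer_def Rloc_of_nat Rloc_neg Loc_one)

lemma Rloc_of_int': "s \<in> S \<Longrightarrow> \<guillemotleft>i\<guillemotright>\<^bsub>L\<^esub> = fr (\<guillemotleft>i\<guillemotright> \<otimes> s) s"
  unfolding Rloc_of_int using Loc_carr by (intro fr_eqI) (auto simp: Loc_one)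

definition LP :: "('a \<times> 'a) set set" where
  "LP = {a \<in> carrier L. Rloc_le R leq \<zero>\<^bsub>L\<^esub> a}"

text \<open>\<open>Rloc_le\<close> asks for some pair of representatives. Multiplying by their
  denominators and cancelling the others carries the inequality over to any given pair.\<close>

lemma Rloc_le_iff:
  assumes c: "p \<in> carrier R" "q \<in> S" "r \<in> carrier R" "s \<in> S"
  shows "Rloc_le R leq (fr p q) (fr r s) \<longleftrightarrow> r \<otimes> q \<ominus> p \<otimes> s \<in> P"
proof -
  have eq: "(r' \<otimes> q' \<ominus> p' \<otimes> s' \<in> P) = (r \<otimes> q \<ominus> p \<otimes> s \<in> P)"
    if m: "(p', q') \<in> fr p q" "(r', s') \<in> fr r s" for p' q' r' s'
  proof -
    have e: "p' \<in> carrier R" "q' \<in> S" "p \<otimes> q' = p' \<otimes> q" "r' \<in> carrier R" "s' \<in> S" "r \<otimes> s' = r' \<otimes> s"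
      using m by (auto simp: mem_fr)
    note cc = c(1,3) Loc_carr[OF c(2)] Loc_carr[OF c(4)] e(1,4) Loc_carr[OF e(2)] Loc_carr[OF e(5)]
    have "(r \<otimes> q \<ominus> p \<otimes> s) \<otimes> (q' \<otimes> s') = (r \<otimes> s') \<otimes> (q \<otimes> q') \<ominus> (p \<otimes> q') \<otimes> (s \<otimes> s')"
      using cc by algebra
    also have "\<dots> = (r' \<otimes> q' \<ominus> p' \<otimes> s') \<otimes> (q \<otimes> s)" unfolding e(3,6) using cc by algebra
    finally show ?thesis
      using Loc_cancel_iff[OF Loc_mult[OF e(2,5)], of "r \<otimes> q \<ominus> p \<otimes> s"]
        Loc_cancel_iff[OF Loc_mult[OF c(2,4)], of "r' \<otimes> q' \<ominus> p' \<otimes> s'"] cc by simp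
  qed
  have "Rloc_le R leq (fr p q) (fr r s) \<longleftrightarrow>
    (\<exists>p' q' r' s'. (p', q') \<in> fr p q \<and> (r', s') \<in> fr r s \<and> leq (p' \<otimes> s') (r' \<otimes> q'))"
    unfolding Rloc_le_def by blast
  also have "\<dots> \<longleftrightarrow> (\<exists>p' q' r' s'. (p', q') \<in> fr p q \<and> (r', s') \<in> fr r s \<and> r \<otimes> q \<ominus> p \<otimes> s \<in> P)"
  proof -
    have "leq (p' \<otimes> s') (r' \<otimes> q') \<longleftrightarrow> r \<otimes> q \<ominus> p \<otimes> s \<in> P" if "(p', q') \<in> fr p q" "(r', s') \<in> fr r s" for p' q' r' s'
      using eq[OF that] that Loc_carr by (subst leq_iff) (auto simp: mem_fr)
    then show ?thesis by blast
  qed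
  also have "\<dots> \<longleftrightarrow> r \<otimes> q \<ominus> p \<otimes> s \<in> P" using fr_self c by blast
  finally show ?thesis .
qed

lemma fr_LP_iff: "r \<in> carrier R \<Longrightarrow> s \<in> S \<Longrightarrow> fr r s \<in> LP \<longleftrightarrow> r \<in> P"
  using Loc_carr by (simp add: LP_def Rloc_zero Rloc_le_iff Loc_one a_minus_def)

lemma Rloc_le_iff_LP:
  assumes "x \<in> carrier L" "y \<in> carrier L"
  shows "Rloc_le R leq x y \<longleftrightarrow> y \<ominus>\<^bsub>L\<^esub> x \<in> LP"
proof -
  obtain r s r' s' where x: "x = fr r s" "r \<in> carrier R" "s \<in> S"
    and y: "y = fr r' s'" "r' \<in> carrier R" "s' \<in> S" using Rloc_cases assms by metis
  have cc: "s \<in> carrier R" "s' \<in> carrier R" using x y Loc_carr by auto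
  have "y \<ominus>\<^bsub>L\<^esub> x = fr (r' \<otimes> s \<ominus> r \<otimes> s') (s' \<otimes> s)"
    using x y cc by (simp add: a_minus_def Rloc_neg Rloc_add l_minus)
  then show ?thesis using x y cc by (simp add: Rloc_le_iff fr_LP_iff Loc_mult)
qed

sublocale L: quad_cone "Rloc R leq" LP
proof unfold_locales
  show "LP \<subseteq> carrier L" by (auto simp: LP_def)
next
  fix x y assume xy: "x \<in> LP" "y \<in> LP"
  then have "x \<in> carrier L" "y \<in> carrier L" by (auto simp: LP_def)
  then obtain r s r' s' where x: "x = fr r s" "r \<in> carrier R" "s \<in> S"
    and y: "y = fr r' s'" "r' \<in> carrier R" "s' \<in> S" using Rloc_cases by metis
  have cc: "s \<in> carrier R" "s' \<in> carrier R" "r \<in> P" "r' \<in> P" using x y Loc_carr xy fr_LP_iff by auto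
  then show "x \<oplus>\<^bsub>L\<^esub> y \<in> LP" "x \<otimes>\<^bsub>L\<^esub> y \<in> LP"
    using x y by (simp_all add: Rloc_add Rloc_mult fr_LP_iff Loc_mult P_add P_mult Loc_P)
next
  fix x assume "x \<in> carrier L"
  then obtain r s where "x = fr r s" "r \<in> carrier R" "s \<in> S" using Rloc_cases by metis
  then show "x \<otimes>\<^bsub>L\<^esub> x \<in> LP" by (simp add: Rloc_mult fr_LP_iff Loc_mult P_sq)
qed

text \<open>Boundedness by integers of the ring instead of multiples of the unit, so that the
  arithmetic of \<open>of_integer\<close> and \<open>L.P_of_int\<close> applies to the
  bounds.\<close>

lemma B_iff: "a \<in> B \<longleftrightarrow> a \<in> carrier L \<and> (\<exists>n\<ge>0. \<guillemotleft>n\<guillemotright>\<^bsub>L\<^esub> \<ominus>\<^bsub>L\<^esub> a \<in> LP \<and> \<guillemotleft>n\<guillemotright>\<^bsub>L\<^esub> \<oplus>\<^bsub>L\<^esub> a \<in> LP)"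
proof -
  have "[n] \<cdot>\<^bsub>L\<^esub> \<one>\<^bsub>L\<^esub> = \<guillemotleft>int n\<guillemotright>\<^bsub>L\<^esub>" for n
    by (simp add: L.add_pow_eq_of_nat L.of_int_of_nat)
  moreover have "a \<ominus>\<^bsub>L\<^esub> (\<ominus>\<^bsub>L\<^esub> c) = c \<oplus>\<^bsub>L\<^esub> a" if "a \<in> carrier L" "c \<in> carrier L" for c
    using that by (simp add: a_minus_def L.a_comm)
  ultimately have "a \<in> B \<longleftrightarrow> a \<in> carrier L \<and> (\<exists>n. \<guillemotleft>int n\<guillemotright>\<^bsub>L\<^esub> \<ominus>\<^bsub>L\<^esub> a \<in> LP \<and> \<guillemotleft>int n\<guillemotright>\<^bsub>L\<^esub> \<oplus>\<^bsub>L\<^esub> a \<in> LP)"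
    by (auto simp: Rloc_bd_def Rloc_le_iff_LP)
  then show ?thesis by (metis of_nat_0_le_iff zero_le_imp_eq_int)
qed

end

section \<open>Bounded elements and characters\<close>

text \<open>Negation is defined by a description over the carrier, so restricting the carrier
  changes the term, although not its value.\<close>

lemma (in ring) a_inv_subring:
  assumes H: "subring H R" and x: "x \<in> H"
  shows "\<ominus>\<^bsub>R\<lparr>carrier := H\<rparr>\<^esub> x = \<ominus> x"
proof -
  have "add_monoid (R\<lparr>carrier := H\<rparr>) = (add_monoid R)\<lparr>carrier := H\<rparr>" by simp
  then show ?thesis
    using add.m_inv_consistent[OF subring.axioms(1)[OF H] x] by (simp add: a_inv_def)
qed

lemma (in ring) of_int_subring:
  assumes H: "subring H R"
  shows "\<guillemotleft>i\<guillemotright>\<^bsub>R\<lparr>carrier := H\<rparr>\<^esub> = \<guillemotleft>i\<guillemotright>"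
proof -
  have n: "\<guillemotleft>n\<guillemotright>\<^sub>\<nat>\<^bsub>R\<lparr>carrier := H\<rparr>\<^esub> = \<guillemotleft>n\<guillemotright>\<^sub>\<nat>" for n
    by (simp add: of_natural_def)
  have "\<guillemotleft>n\<guillemotright>\<^sub>\<nat> \<in> H" for n
    by (induction n) (simp_all add: subringE[OF H])
  then show ?thesis by (simp add: of_integer_def n a_inv_subring[OF H])
qed

context po_ring
begin

abbreviation "K \<equiv> Kspec R leq"

lemma B_carr: "a \<in> B \<Longrightarrow> a \<in> carrier L"
  by (simp add: B_iff)

lemma fr_B_iff:
  assumes r: "r \<in> carrier R" and s: "s \<in> S"
  shows "fr r s \<in> B \<longleftrightarrow> (\<exists>n\<ge>0. \<guillemotleft>n\<guillemotright> \<otimes> s \<ominus> r \<in> P \<and> \<guillemotleft>n\<guillemotright> \<otimes> s \<oplus> r \<in> P)"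
  using assms Loc_carr by (simp add: B_iff Rloc_of_int'[OF s] Rloc_minus_same Rloc_add_same fr_LP_iff)

lemma inverse_B: "s \<in> S \<Longrightarrow> fr \<one> s \<in> B"
  using Loc_carr Loc_minus_one P_one Loc_P by (subst fr_B_iff) (auto intro!: exI[of _ 1] P_add)

text \<open>As \<open>t\<close> is at least 1, the bound \<open>n\<close> for \<open>r / s\<close>
  is still a bound after enlarging the denominator. This makes common denominators available inside
  the bounded part.\<close>

lemma fr_B_mult_denom:
  assumes r: "r \<in> carrier R" and s: "s \<in> S" "t \<in> S" and b: "fr r s \<in> B"
  shows "fr r (s \<otimes> t) \<in> B"
proof -
  obtain n where n: "n \<ge> 0" "\<guillemotleft>n\<guillemotright> \<otimes> s \<ominus> r \<in> P" "\<guillemotleft>n\<guillemotright> \<otimes> s \<oplus> r \<in> P"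
    using b fr_B_iff[OF r s(1)] by auto
  note c = r Loc_carr[OF s(1)] Loc_carr[OF s(2)]
  have "c \<otimes> (s \<otimes> t) \<ominus> r = (c \<otimes> s) \<otimes> (t \<ominus> \<one>) \<oplus> (c \<otimes> s \<ominus> r)"
    "c \<otimes> (s \<otimes> t) \<oplus> r = (c \<otimes> s) \<otimes> (t \<ominus> \<one>) \<oplus> (c \<otimes> s \<oplus> r)" if "c \<in> carrier R" for c
    using that c by algebra+
  moreover have "(\<guillemotleft>n\<guillemotright> \<otimes> s) \<otimes> (t \<ominus> \<one>) \<in> P"
    using n s by (intro P_mult P_of_int Loc_P Loc_minus_one) auto
  ultimately show ?thesis
    using r s n by (subst fr_B_iff) (auto intro!: exI[of _ n] P_add Loc_mult)
qed

lemma B_subring: "subring B L"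
proof (rule L.subringI)
  show "B \<subseteq> carrier L" using B_carr by blast
  show "\<one>\<^bsub>L\<^esub> \<in> B" unfolding Rloc_one by (rule inverse_B[OF Loc_one])
next
  fix a assume a: "a \<in> B"
  then obtain n where n: "n \<ge> 0" "\<guillemotleft>n\<guillemotright>\<^bsub>L\<^esub> \<ominus>\<^bsub>L\<^esub> a \<in> LP" "\<guillemotleft>n\<guillemotright>\<^bsub>L\<^esub> \<oplus>\<^bsub>L\<^esub> a \<in> LP" by (auto simp: B_iff)
  then show "\<ominus>\<^bsub>L\<^esub> a \<in> B"
    using B_carr[OF a] by (auto simp: B_iff a_minus_def intro!: exI[of _ n])
next
  fix a b assume ab: "a \<in> B" "b \<in> B"
  note c = B_carr[OF ab(1)] B_carr[OF ab(2)]
  obtain n where n: "n \<ge> 0" "\<guillemotleft>n\<guillemotright>\<^bsub>L\<^esub> \<ominus>\<^bsub>L\<^esub> a \<in> LP" "\<guillemotleft>n\<guillemotright>\<^bsub>L\<^esub> \<oplus>\<^bsub>L\<^esub> a \<in> LP" using ab by (auto simp: B_iff)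
  obtain m where m: "m \<ge> 0" "\<guillemotleft>m\<guillemotright>\<^bsub>L\<^esub> \<ominus>\<^bsub>L\<^esub> b \<in> LP" "\<guillemotleft>m\<guillemotright>\<^bsub>L\<^esub> \<oplus>\<^bsub>L\<^esub> b \<in> LP" using ab by (auto simp: B_iff)
  note nm = L.P_of_int[OF n(1)] L.P_of_int[OF m(1)]
  have add: "(N \<oplus>\<^bsub>L\<^esub> M) \<ominus>\<^bsub>L\<^esub> (a \<oplus>\<^bsub>L\<^esub> b) = (N \<ominus>\<^bsub>L\<^esub> a) \<oplus>\<^bsub>L\<^esub> (M \<ominus>\<^bsub>L\<^esub> b)"
    "(N \<oplus>\<^bsub>L\<^esub> M) \<oplus>\<^bsub>L\<^esub> (a \<oplus>\<^bsub>L\<^esub> b) = (N \<oplus>\<^bsub>L\<^esub> a) \<oplus>\<^bsub>L\<^esub> (M \<oplus>\<^bsub>L\<^esub> b)"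
    if "N \<in> carrier L" "M \<in> carrier L" for N M
    using that c by algebra+
  \<comment> \<open>The bound \<open>3 n m\<close>, because \<open>n m\<close> would need a division by 2.\<close>
  have mult: "((N \<otimes>\<^bsub>L\<^esub> M) \<oplus>\<^bsub>L\<^esub> (N \<otimes>\<^bsub>L\<^esub> M) \<oplus>\<^bsub>L\<^esub> (N \<otimes>\<^bsub>L\<^esub> M)) \<ominus>\<^bsub>L\<^esub> (a \<otimes>\<^bsub>L\<^esub> b)
      = (N \<ominus>\<^bsub>L\<^esub> a) \<otimes>\<^bsub>L\<^esub> (M \<oplus>\<^bsub>L\<^esub> b) \<oplus>\<^bsub>L\<^esub> N \<otimes>\<^bsub>L\<^esub> (M \<ominus>\<^bsub>L\<^esub> b) \<oplus>\<^bsub>L\<^esub> M \<otimes>\<^bsub>L\<^esub> (N \<oplus>\<^bsub>L\<^esub> a)"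
    "((N \<otimes>\<^bsub>L\<^esub> M) \<oplus>\<^bsub>L\<^esub> (N \<otimes>\<^bsub>L\<^esub> M) \<oplus>\<^bsub>L\<^esub> (N \<otimes>\<^bsub>L\<^esub> M)) \<oplus>\<^bsub>L\<^esub> (a \<otimes>\<^bsub>L\<^esub> b)
      = (N \<ominus>\<^bsub>L\<^esub> a) \<otimes>\<^bsub>L\<^esub> (M \<ominus>\<^bsub>L\<^esub> b) \<oplus>\<^bsub>L\<^esub> N \<otimes>\<^bsub>L\<^esub> (M \<oplus>\<^bsub>L\<^esub> b) \<oplus>\<^bsub>L\<^esub> M \<otimes>\<^bsub>L\<^esub> (N \<oplus>\<^bsub>L\<^esub> a)"
    if "N \<in> carrier L" "M \<in> carrier L" for N M
    using that c by algebra+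
  have "\<guillemotleft>n + m\<guillemotright>\<^bsub>L\<^esub> \<ominus>\<^bsub>L\<^esub> (a \<oplus>\<^bsub>L\<^esub> b) \<in> LP" "\<guillemotleft>n + m\<guillemotright>\<^bsub>L\<^esub> \<oplus>\<^bsub>L\<^esub> (a \<oplus>\<^bsub>L\<^esub> b) \<in> LP"
    unfolding L.of_int_add add[OF L.of_int_closed L.of_int_closed] using n m by (auto intro: L.P_add)
  then show "a \<oplus>\<^bsub>L\<^esub> b \<in> B"
    unfolding B_iff using c n m by (intro conjI exI[of _ "n + m"]) auto
  have "\<guillemotleft>n * m + n * m + n * m\<guillemotright>\<^bsub>L\<^esub> \<ominus>\<^bsub>L\<^esub> (a \<otimes>\<^bsub>L\<^esub> b) \<in> LP" "\<guillemotleft>n * m + n * m + n * m\<guillemotright>\<^bsub>L\<^esub> \<oplus>\<^bsub>L\<^esub> (a \<otimes>\<^bsub>L\<^esub> b) \<in> LP"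
    unfolding L.of_int_add L.of_int_mult mult[OF L.of_int_closed L.of_int_closed] using n m nm
    by (auto intro!: L.P_add L.P_mult)
  then show "a \<otimes>\<^bsub>L\<^esub> b \<in> B"
    unfolding B_iff using c n m by (intro conjI exI[of _ "n * m + n * m + n * m"]) auto
qed

lemmas B_one = subringE(3)[OF B_subring] and B_zero = subringE(2)[OF B_subring]
  and B_neg = subringE(5)[OF B_subring] and B_mult = subringE(6)[OF B_subring]
  and B_add = subringE(7)[OF B_subring]

lemma B_minus: "a \<in> B \<Longrightarrow> b \<in> B \<Longrightarrow> a \<ominus>\<^bsub>L\<^esub> b \<in> B"
  by (simp add: a_minus_def B_add B_neg)

lemma B_of_nat: "\<guillemotleft>n\<guillemotright>\<^sub>\<nat>\<^bsub>L\<^esub> \<in> B"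
  by (induction n) (simp_all add: B_zero B_one B_add)

lemma B_of_int: "\<guillemotleft>i\<guillemotright>\<^bsub>L\<^esub> \<in> B"
  by (simp add: of_integer_def B_of_nat B_neg)

lemma KI:
  assumes "\<phi> \<in> extensional B"
    "\<And>a b. a \<in> B \<Longrightarrow> b \<in> B \<Longrightarrow> \<phi> (a \<oplus>\<^bsub>L\<^esub> b) = \<phi> a + \<phi> b"
    "\<And>a b. a \<in> B \<Longrightarrow> b \<in> B \<Longrightarrow> \<phi> (a \<otimes>\<^bsub>L\<^esub> b) = \<phi> a * \<phi> b"
    "\<phi> \<one>\<^bsub>L\<^esub> = 1" "\<And>a. a \<in> B \<Longrightarrow> a \<in> LP \<Longrightarrow> \<phi> a \<ge> 0"
  shows "\<phi> \<in> K"
  using assms B_carr by (simp add: Kspec_def LP_def)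

context
  fixes \<phi> assumes K: "\<phi> \<in> K"
begin

lemma K_ext: "\<phi> \<in> extensional B"
  using K by (simp add: Kspec_def)

lemma K_add: "a \<in> B \<Longrightarrow> b \<in> B \<Longrightarrow> \<phi> (a \<oplus>\<^bsub>L\<^esub> b) = \<phi> a + \<phi> b"
  and K_mult: "a \<in> B \<Longrightarrow> b \<in> B \<Longrightarrow> \<phi> (a \<otimes>\<^bsub>L\<^esub> b) = \<phi> a * \<phi> b"
  and K_one: "\<phi> \<one>\<^bsub>L\<^esub> = 1"
  and K_nonneg: "a \<in> B \<Longrightarrow> a \<in> LP \<Longrightarrow> \<phi> a \<ge> 0"
  using K by (simp_all add: Kspec_def LP_def)

lemma K_zero: "\<phi> \<zero>\<^bsub>L\<^esub> = 0"
  using K_add[OF B_zero B_zero] by simp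

lemma K_neg: "a \<in> B \<Longrightarrow> \<phi> (\<ominus>\<^bsub>L\<^esub> a) = - \<phi> a"
  using K_add[OF _ B_neg, of a a] B_carr[of a] K_zero by (simp add: L.r_neg)

lemma K_minus: "a \<in> B \<Longrightarrow> b \<in> B \<Longrightarrow> \<phi> (a \<ominus>\<^bsub>L\<^esub> b) = \<phi> a - \<phi> b"
  by (simp add: a_minus_def K_add B_neg K_neg)

lemma K_of_nat: "\<phi> \<guillemotleft>n\<guillemotright>\<^sub>\<nat>\<^bsub>L\<^esub> = real n"
  by (induction n) (simp_all add: K_zero K_one K_add B_one B_of_nat)

lemma K_of_int: "\<phi> \<guillemotleft>i\<guillemotright>\<^bsub>L\<^esub> = of_int i"
  by (simp add: of_integer_def K_of_nat B_of_nat K_neg)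

lemma K_inverse_nonneg: "s \<in> S \<Longrightarrow> 0 \<le> \<phi> (fr \<one> s)"
  by (simp add: K_nonneg inverse_B fr_LP_iff P_one)

lemma K_inverse_mult: "s \<in> S \<Longrightarrow> t \<in> S \<Longrightarrow> \<phi> (fr \<one> (s \<otimes> t)) = \<phi> (fr \<one> s) * \<phi> (fr \<one> t)"
  using K_mult[OF inverse_B inverse_B, of s t] by (simp add: Rloc_mult)

end

lemma archimedeanD:
  assumes "archimedean R leq" "g \<in> carrier R" "h \<in> carrier R"
    and "\<And>k. k > 0 \<Longrightarrow> \<guillemotleft>k\<guillemotright> \<otimes> g \<oplus> h \<in> P"
  shows "g \<in> P"
proof -
  have "[k] \<cdot> g \<oplus> h \<in> P" if "k \<ge> 1" for k :: nat
    using assms(4)[of "int k"] that assms(2) by (simp add: add_pow_eq_of_nat of_int_of_nat)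
  then show ?thesis using assms(1-3) unfolding archimedean_def by blast
qed

lemma localizableD:
  assumes "localizable R leq" "r \<in> carrier R"
  obtains s where "s \<in> S" "s \<ominus> r \<in> P" "s \<oplus> r \<in> P"
proof -
  obtain s where s: "s \<in> S" "leq (\<ominus> s) r" "leq r s" using assms by (auto simp: localizable_def)
  have "r \<ominus> (\<ominus> s) = s \<oplus> r" using Loc_carr[OF s(1)] assms(2) by algebra
  then show thesis using s assms(2) Loc_carr[OF s(1)] that[of s] by (simp add: leq_iff)
qed

text \<open>With \<open>k = a n + b\<close> and \<open>0 \<le> b \<le> n\<close>, the part
  \<open>a n x\<close> is positive by assumption, and the remainder \<open>b x\<close> is at least
  \<open>- n s\<close> when \<open>s\<close> bounds \<open>x\<close>. Thus \<open>k x + n s\<close>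
  is positive for every \<open>k\<close>.\<close>

lemma unperforated:
  assumes ar: "archimedean R leq" and lo: "localizable R leq"
    and x: "x \<in> carrier R" and n: "n > 0" and nx: "\<guillemotleft>n\<guillemotright> \<otimes> x \<in> P"
  shows "x \<in> P"
proof -
  obtain s where s: "s \<in> S" "s \<oplus> x \<in> P" using localizableD[OF lo x] by metis
  have sc: "s \<in> carrier R" using s Loc_carr by blast
  show ?thesis
  proof (rule archimedeanD[OF ar x, of "\<guillemotleft>n\<guillemotright> \<otimes> s"])
    fix k :: int assume k: "k > 0"
    define a b where "a = k div n" "b = k mod n"
    have ab: "k = a * n + b" "0 \<le> a" "0 \<le> b" "b \<le> n"
      using n k by (auto simp: a_b_def pos_imp_zdiv_nonneg_iff less_imp_le)
    have "\<guillemotleft>a\<guillemotright> \<otimes> (\<guillemotleft>n\<guillemotright> \<otimes> x) \<oplus> \<guillemotleft>b\<guillemotright> \<otimes> (s \<oplus> x) \<oplus> \<guillemotleft>n - b\<guillemotright> \<otimes> s \<in> P"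
      using ab by (intro P_add[OF P_add] P_mult[OF _ nx] P_mult[OF _ s(2)] P_mult[OF _ Loc_P[OF s(1)]] P_of_int) auto
    moreover have "c \<otimes> (d \<otimes> x) \<oplus> e \<otimes> (s \<oplus> x) \<oplus> (d \<ominus> e) \<otimes> s = (c \<otimes> d \<oplus> e) \<otimes> x \<oplus> d \<otimes> s"
      if "c \<in> carrier R" "d \<in> carrier R" "e \<in> carrier R" for c d e
      using that x sc by algebra
    ultimately show "\<guillemotleft>k\<guillemotright> \<otimes> x \<oplus> \<guillemotleft>n\<guillemotright> \<otimes> s \<in> P" by (simp add: ab(1))
  qed (use sc in simp)
qed

text \<open>Reduction to \<open>character_separation\<close> in the ring carried by
  \<open>B\<close>; the properties required of its cone are inherited from \<open>R\<close> after
  clearing denominators.\<close>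

theorem K_separation:
  assumes ar: "archimedean R leq" and lo: "localizable R leq"
    and a: "a \<in> B" and pos: "\<And>\<phi>. \<phi> \<in> K \<Longrightarrow> 0 \<le> \<phi> a"
  shows "a \<in> LP"
proof (rule ccontr)
  assume na: "a \<notin> LP"
  let ?A = "L\<lparr>carrier := B\<rparr>"
  have "subcring B L" by (rule L.subcringI'[OF B_subring])
  then interpret A: cring ?A using L.subcring_iff B_carr by blast
  have Aint: "\<guillemotleft>n\<guillemotright>\<^bsub>?A\<^esub> = \<guillemotleft>n\<guillemotright>\<^bsub>L\<^esub>" for n by (rule L.of_int_subring[OF B_subring])
  have Aminus: "x \<ominus>\<^bsub>?A\<^esub> y = x \<ominus>\<^bsub>L\<^esub> y" if "y \<in> B" for x y
    using that by (simp add: a_minus_def L.a_inv_subring[OF B_subring])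
  interpret A: arch_cone ?A "LP \<inter> B"
  proof unfold_locales
    show "LP \<inter> B \<subseteq> carrier ?A" by simp
  next
    fix x y assume "x \<in> LP \<inter> B" "y \<in> LP \<inter> B"
    then show "x \<oplus>\<^bsub>?A\<^esub> y \<in> LP \<inter> B" "x \<otimes>\<^bsub>?A\<^esub> y \<in> LP \<inter> B"
      by (auto simp: L.P_add L.P_mult B_add B_mult)
  next
    fix x assume "x \<in> carrier ?A"
    then show "x \<otimes>\<^bsub>?A\<^esub> x \<in> LP \<inter> B" using B_carr by (simp add: L.P_sq B_mult)
  next
    fix x assume "x \<in> carrier ?A"
    then have x: "x \<in> B" by simp
    then obtain n where "\<guillemotleft>n\<guillemotright>\<^bsub>L\<^esub> \<ominus>\<^bsub>L\<^esub> x \<in> LP" by (auto simp: B_iff)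
    then show "\<exists>n. \<guillemotleft>n\<guillemotright>\<^bsub>?A\<^esub> \<ominus>\<^bsub>?A\<^esub> x \<in> LP \<inter> B"
      using x by (intro exI[of _ n]) (simp only: Aint Aminus, simp add: B_minus B_of_int)
  next
    fix x and n :: int assume x: "x \<in> carrier ?A" and n: "0 < n" and h: "\<guillemotleft>n\<guillemotright>\<^bsub>?A\<^esub> \<otimes>\<^bsub>?A\<^esub> x \<in> LP \<inter> B"
    obtain r s where rs: "x = fr r s" "r \<in> carrier R" "s \<in> S" using x Rloc_cases[OF B_carr[of x]] by auto
    have "\<guillemotleft>n\<guillemotright>\<^bsub>L\<^esub> \<otimes>\<^bsub>L\<^esub> x = fr (\<guillemotleft>n\<guillemotright> \<otimes> r) s"
      using rs Loc_carr by (simp add: Rloc_of_int Rloc_mult Loc_one)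
    then have "\<guillemotleft>n\<guillemotright> \<otimes> r \<in> P" using h rs unfolding Aint by (simp add: fr_LP_iff)
    then have "r \<in> P" using unperforated[OF ar lo rs(2) n] by simp
    then show "x \<in> LP \<inter> B" using rs x by (simp add: fr_LP_iff)
  next
    fix x assume x: "x \<in> carrier ?A" and h: "\<And>k. k > 0 \<Longrightarrow> \<guillemotleft>k\<guillemotright>\<^bsub>?A\<^esub> \<otimes>\<^bsub>?A\<^esub> x \<oplus>\<^bsub>?A\<^esub> \<one>\<^bsub>?A\<^esub> \<in> LP \<inter> B"
    obtain r s where rs: "x = fr r s" "r \<in> carrier R" "s \<in> S" using x Rloc_cases[OF B_carr[of x]] by auto
    have sc: "s \<in> carrier R" using rs Loc_carr by blast
    have "r \<in> P"
    \<comment> \<open>The denominator serves as the fixed summand: the numerator of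
      \<open>k x + 1\<close> is \<open>k r + s\<close>.\<close>
    proof (rule archimedeanD[OF ar rs(2) sc])
      fix k :: int assume k: "k > 0"
      have "\<guillemotleft>k\<guillemotright>\<^bsub>L\<^esub> \<otimes>\<^bsub>L\<^esub> x \<oplus>\<^bsub>L\<^esub> \<one>\<^bsub>L\<^esub> = fr (\<guillemotleft>k\<guillemotright> \<otimes> r \<oplus> s) s"
        using rs sc by (simp add: Rloc_of_int Rloc_mult Rloc_one Rloc_add Loc_one)
      then show "\<guillemotleft>k\<guillemotright> \<otimes> r \<oplus> s \<in> P" using h[OF k] rs sc unfolding Aint by (simp add: fr_LP_iff)
    qed
    then show "x \<in> LP \<inter> B" using rs x by (simp add: fr_LP_iff)
  qed
  have aA: "a \<in> carrier ?A" "a \<notin> LP \<inter> B" using a na by simp_all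
  obtain \<phi> :: "('a \<times> 'a) set \<Rightarrow> real" where \<phi>:
    "\<And>x y. x \<in> carrier ?A \<Longrightarrow> y \<in> carrier ?A \<Longrightarrow> \<phi> (x \<oplus>\<^bsub>?A\<^esub> y) = \<phi> x + \<phi> y"
    "\<And>x y. x \<in> carrier ?A \<Longrightarrow> y \<in> carrier ?A \<Longrightarrow> \<phi> (x \<otimes>\<^bsub>?A\<^esub> y) = \<phi> x * \<phi> y"
    "\<phi> \<one>\<^bsub>?A\<^esub> = 1" "\<And>x. x \<in> LP \<inter> B \<Longrightarrow> \<phi> x \<ge> 0" "\<phi> a < 0"
    using A.character_separation[OF aA] by blast
  \<comment> \<open>The values outside \<open>B\<close> are erased because \<open>Kspec\<close>
    consists of extensional functions, so that a character is determined by its values on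
    \<open>B\<close>.\<close>
  have "restrict \<phi> B \<in> K"
    by (rule KI) (use \<phi> in \<open>auto simp: B_add B_mult B_one\<close>)
  then show False using pos[of "restrict \<phi> B"] a \<phi>(5) by simp
qed

end

section \<open>The character space\<close>

lemma square_lt_four: "(y::real) * y < 4 \<Longrightarrow> \<bar>y\<bar> < 2"
proof (rule ccontr)
  assume "y * y < 4" "\<not> \<bar>y\<bar> < 2"
  then have "2 * 2 \<le> \<bar>y\<bar> * \<bar>y\<bar>" by (intro mult_mono) auto
  with \<open>y * y < 4\<close> show False by (simp add: abs_mult_self_eq)
qed

lemma square_frac_le_one: "(x - of_int \<lfloor>x\<rfloor>) * (x - of_int \<lfloor>x\<rfloor>) \<le> (1::real)"
proof -
  have "0 \<le> x - of_int \<lfloor>x\<rfloor>" "x - of_int \<lfloor>x\<rfloor> \<le> 1" by linarith+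
  then show ?thesis using mult_le_one by blast
qed

context po_ring
begin

abbreviation "T \<equiv> Ktop R leq"

lemma Ktop_basic: "a \<in> B \<Longrightarrow> open V \<Longrightarrow> openin T {\<phi> \<in> K. \<phi> a \<in> V}"
  unfolding Ktop_def by (rule topology_generated_by_Basis) blast

lemma topspace_Ktop: "topspace T = K"
proof
  show "topspace T \<subseteq> K" unfolding Ktop_def topology_generated_by_topspace by auto
  show "K \<subseteq> topspace T" using openin_subset[OF Ktop_basic[OF B_one open_UNIV]] by simp
qed

lemma continuous_eval: "a \<in> B \<Longrightarrow> continuous_map T euclideanreal (\<lambda>\<phi>. \<phi> a)"
  by (simp add: continuous_map_def topspace_Ktop Ktop_basic)

lemma K_eqI:
  assumes "\<phi> \<in> K" "\<psi> \<in> K" "\<And>a. a \<in> B \<Longrightarrow> \<phi> a = \<psi> a"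
  shows "\<phi> = \<psi>"
  using K_ext[OF assms(1)] K_ext[OF assms(2)] assms(3) by (rule extensionalityI)

lemma Hausdorff_Ktop: "Hausdorff_space T"
  unfolding Hausdorff_space_def topspace_Ktop
proof (intro allI impI, elim conjE)
  fix \<phi> \<psi> assume K: "\<phi> \<in> K" "\<psi> \<in> K" "\<phi> \<noteq> \<psi>"
  then obtain a where a: "a \<in> B" "\<phi> a \<noteq> \<psi> a" using K_eqI by blast
  obtain U V where UV: "open U" "open V" "\<phi> a \<in> U" "\<psi> a \<in> V" "U \<inter> V = {}"
    using hausdorff[OF a(2)] by auto
  show "\<exists>U V. openin T U \<and> openin T V \<and> \<phi> \<in> U \<and> \<psi> \<in> V \<and> disjnt U V"
    using K UV Ktop_basic[OF a(1)]
    by (intro exI[of _ "{\<phi> \<in> K. \<phi> a \<in> U}"] exI[of _ "{\<phi> \<in> K. \<phi> a \<in> V}"]) (auto simp: disjnt_def)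
qed

lemma K_bounded:
  assumes "a \<in> B"
  shows "\<exists>n::int. \<forall>\<phi>\<in>K. \<phi> a \<in> {- of_int n..of_int n}"
proof -
  obtain n where n: "\<guillemotleft>n\<guillemotright>\<^bsub>L\<^esub> \<ominus>\<^bsub>L\<^esub> a \<in> LP" "\<guillemotleft>n\<guillemotright>\<^bsub>L\<^esub> \<oplus>\<^bsub>L\<^esub> a \<in> LP" using assms by (auto simp: B_iff)
  have "\<phi> a \<in> {- of_int n..of_int n}" if K: "\<phi> \<in> K" for \<phi>
    using K_nonneg[OF K B_minus[OF B_of_int assms] n(1)] K_nonneg[OF K B_add[OF B_of_int assms] n(2)]
    by (simp add: K_minus[OF K] K_add[OF K] K_of_int[OF K] B_of_int assms)
  then show ?thesis by blast
qed

text \<open>Tychonoff: \<open>K\<close> is closed in the product topology and contained in a product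
  of compact intervals. Continuity of the identity from the product topology on \<open>K\<close> to
  \<open>T\<close> then carries compactness over.\<close>

lemma compact_Ktop: "compact_space T"
proof -
  define X where "X = product_topology (\<lambda>_::('a \<times> 'a) set. euclideanreal) B"
  have tX: "topspace X = extensional B" by (simp add: X_def PiE_UNIV_domain PiE_def)
  have proj: "continuous_map X euclideanreal (\<lambda>\<phi>. \<phi> a)" if "a \<in> B" for a
    using that unfolding X_def by (rule continuous_map_product_projection)
  obtain n where n: "\<And>a \<phi>. a \<in> B \<Longrightarrow> \<phi> \<in> K \<Longrightarrow> \<phi> a \<in> {- of_int (n a)..of_int (n a :: int)}"
    using K_bounded by metis
  \<comment> \<open>Each algebraic relation becomes the preimage of a closed set of reals under one
    continuous function of \<open>\<phi>\<close>, hence the differences.\<close>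
  define C1 where "C1 a b = {\<phi> \<in> topspace X. \<phi> (a \<oplus>\<^bsub>L\<^esub> b) - (\<phi> a + \<phi> b) \<in> {0}}" for a b
  define C2 where "C2 a b = {\<phi> \<in> topspace X. \<phi> (a \<otimes>\<^bsub>L\<^esub> b) - \<phi> a * \<phi> b \<in> {0}}" for a b
  define C3 where "C3 = {\<phi> \<in> topspace X. \<phi> \<one>\<^bsub>L\<^esub> \<in> {1}}"
  define C4 where "C4 a = {\<phi> \<in> topspace X. \<phi> a \<in> {0..}}" for a
  define \<F> where "\<F> = insert C3 (C4 ` (B \<inter> LP) \<union> case_prod C1 ` (B \<times> B) \<union> case_prod C2 ` (B \<times> B))"
  have mem: "\<phi> \<in> \<Inter>\<F> \<longleftrightarrow> \<phi> \<in> C3 \<and> (\<forall>a\<in>B \<inter> LP. \<phi> \<in> C4 a) \<and> (\<forall>a\<in>B. \<forall>b\<in>B. \<phi> \<in> C1 a b \<and> \<phi> \<in> C2 a b)" for \<phi>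
    unfolding \<F>_def by auto
  have KF: "K = \<Inter>\<F>"
  proof (intro equalityI subsetI)
    fix \<phi> assume K: "\<phi> \<in> K"
    show "\<phi> \<in> \<Inter>\<F>" unfolding mem C1_def C2_def C3_def C4_def tX
      using K_ext[OF K] K_add[OF K] K_mult[OF K] K_one[OF K] K_nonneg[OF K] by auto
  next
    fix \<phi> assume "\<phi> \<in> \<Inter>\<F>"
    then have m: "\<phi> \<in> C3" "\<And>a. a \<in> B \<Longrightarrow> a \<in> LP \<Longrightarrow> \<phi> \<in> C4 a" "\<And>a b. a \<in> B \<Longrightarrow> b \<in> B \<Longrightarrow> \<phi> \<in> C1 a b"
      "\<And>a b. a \<in> B \<Longrightarrow> b \<in> B \<Longrightarrow> \<phi> \<in> C2 a b" unfolding mem by blast+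
    show "\<phi> \<in> K"
      by (rule KI) (use m in \<open>auto simp: C1_def C2_def C3_def C4_def tX\<close>)
  qed
  have C1: "closedin X (C1 a b)" and C2: "closedin X (C2 a b)" if "a \<in> B" "b \<in> B" for a b
    unfolding C1_def C2_def
    using that by (intro closedin_continuous_map_preimage[where Y = euclideanreal] continuous_intros proj B_add B_mult; simp)+
  have C3: "closedin X C3"
    unfolding C3_def using proj[OF B_one] by (rule closedin_continuous_map_preimage) simp
  have C4: "closedin X (C4 a)" if "a \<in> B" for a
    unfolding C4_def using proj[OF that] by (rule closedin_continuous_map_preimage) simp
  have "closedin X K"
    unfolding KF by (rule closedin_Inter) (auto simp: \<F>_def C1 C2 C3 C4)
  moreover have "compactin X (PiE B (\<lambda>a. {- of_int (n a)..of_int (n a)}))"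
    unfolding X_def compactin_PiE by simp
  moreover have "K \<subseteq> PiE B (\<lambda>a. {- of_int (n a)..of_int (n a)})"
    using n K_ext by (simp add: PiE_def Pi_def subset_iff)
  ultimately have "compactin X K" using closed_compactin by blast
  then have "compactin (subtopology X K) K" by simp
  moreover have "continuous_map (subtopology X K) T (\<lambda>\<phi>. \<phi>)"
    unfolding Ktop_def
  proof (rule continuous_on_generated_topo)
    fix U assume "U \<in> {{\<phi> \<in> K. \<phi> a \<in> V} |a V. a \<in> B \<and> open V}"
    then obtain a V where aV: "U = {\<phi> \<in> K. \<phi> a \<in> V}" "a \<in> B" "open V" by blast
    have "openin X {\<phi> \<in> topspace X. \<phi> a \<in> V}"
      using proj[OF aV(2)] aV(3) by (intro openin_continuous_map_preimage) auto
    moreover have "(\<lambda>\<phi>. \<phi>) -` U \<inter> topspace (subtopology X K) = {\<phi> \<in> topspace X. \<phi> a \<in> V} \<inter> K"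
      using aV(1) by auto
    ultimately show "openin (subtopology X K) ((\<lambda>\<phi>. \<phi>) -` U \<inter> topspace (subtopology X K))"
      using openin_subtopology by fastforce
  next
    show "(\<lambda>\<phi>. \<phi>) ` topspace (subtopology X K) \<subseteq> \<Union> {{\<phi> \<in> K. \<phi> a \<in> V} |a V. a \<in> B \<and> open V}"
      using topspace_Ktop unfolding Ktop_def topology_generated_by_topspace by auto
  qed
  ultimately have "compactin T ((\<lambda>\<phi>. \<phi>) ` K)" by (rule image_compactin)
  then show ?thesis by (simp add: compact_space_def topspace_Ktop)
qed

text \<open>Only integer multiples of the unit are available, hence the rescaling by \<open>N\<close> and the integer parts.\<close>

lemma Ktop_basis:
  assumes "openin T U" "\<phi>0 \<in> U"
  shows "\<exists>b\<in>B. \<phi>0 b > 0 \<and> (\<forall>\<phi>\<in>K. \<phi> b > 0 \<longrightarrow> \<phi> \<in> U)"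
proof -
  have U: "U \<subseteq> K" if "generate_topology_on {{\<phi> \<in> K. \<phi> a \<in> V} |a V. a \<in> B \<and> open V} U" for U
    using that openin_subset[of T U, unfolded topspace_Ktop]
    unfolding Ktop_def openin_topology_generated_by_iff by simp
  define d where "d N k a = \<guillemotleft>N\<guillemotright>\<^bsub>L\<^esub> \<otimes>\<^bsub>L\<^esub> a \<ominus>\<^bsub>L\<^esub> \<guillemotleft>k\<guillemotright>\<^bsub>L\<^esub>" for N k :: int and a
  have dB: "d N k a \<in> B" if "a \<in> B" for N k a
    using that by (simp add: d_def B_minus B_mult B_of_int)
  have dK: "\<phi> (d N k a) = of_int N * \<phi> a - of_int k" if "a \<in> B" "\<phi> \<in> K" for N k a \<phi>
    using that by (simp add: d_def K_minus K_mult B_mult B_of_int K_of_int)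
  have "generate_topology_on {{\<phi> \<in> K. \<phi> a \<in> V} |a V. a \<in> B \<and> open V} U"
    using assms(1) unfolding Ktop_def openin_topology_generated_by_iff .
  then show ?thesis using assms(2)
  proof (induction)
    case Empty then show ?case by simp
  next
    case (UN \<K>) then show ?case by blast
  next
    case (Basis s)
    then obtain a V where s: "s = {\<phi> \<in> K. \<phi> a \<in> V}" "a \<in> B" "open V" by blast
    then have K0: "\<phi>0 \<in> K" "\<phi>0 a \<in> V" using Basis by auto
    then obtain e where e: "e > 0" "\<And>y. \<bar>y - \<phi>0 a\<bar> < e \<Longrightarrow> y \<in> V"
      using s(3) by (auto simp: open_dist dist_real_def)
    define N where "N = \<lceil>3 / e\<rceil>"
    have N: "3 / e \<le> of_int N" "N > 0" using e(1) by (auto simp: N_def)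
    then have Ne: "3 \<le> of_int N * e" using e(1) by (simp add: field_simps)
    define k where "k = \<lfloor>of_int N * \<phi>0 a\<rfloor>"
    \<comment> \<open>At \<open>\<phi>0\<close> the square is at most 1, since \<open>k\<close> is
      an integer part. Where \<open>?b\<close> is positive the square is below 4, so
      \<open>N \<phi>(a)\<close> is within 2 of \<open>k\<close>. The distances 2 and 1 add up to
      the 3 in the choice of \<open>N\<close>.\<close>
    let ?b = "\<guillemotleft>3\<guillemotright>\<^bsub>L\<^esub> \<ominus>\<^bsub>L\<^esub> d N k a \<otimes>\<^bsub>L\<^esub> d N k a"
    have b: "?b \<in> B" using s by (simp add: B_minus B_mult B_of_int dB)
    have val: "\<phi> ?b = 3 - (of_int N * \<phi> a - of_int k) * (of_int N * \<phi> a - of_int k)" if "\<phi> \<in> K" for \<phi>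
      using that s by (simp add: K_minus K_mult B_mult B_of_int K_of_int dB dK)
    have "\<phi>0 ?b > 0"
      unfolding val[OF K0(1)] using square_frac_le_one[of "of_int N * \<phi>0 a"] by (simp add: k_def)
    moreover have "\<phi> \<in> s" if K: "\<phi> \<in> K" and p: "\<phi> ?b > 0" for \<phi>
    proof -
      have "\<bar>of_int N * \<phi> a - of_int k\<bar> < 2"
        using p by (intro square_lt_four) (simp add: val[OF K])
      moreover have "\<bar>of_int N * \<phi>0 a - of_int k\<bar> \<le> 1" unfolding k_def by linarith
      ultimately have "\<bar>of_int N * \<phi> a - of_int N * \<phi>0 a\<bar> < of_int N * e" using Ne by linarith
      moreover have "of_int N * \<phi> a - of_int N * \<phi>0 a = of_int N * (\<phi> a - \<phi>0 a)" by (simp add: algebra_simps)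
      ultimately have "\<bar>\<phi> a - \<phi>0 a\<bar> < e" using N(2) by (simp add: abs_mult)
      then show ?thesis using e K s by simp
    qed
    ultimately show ?case using b by blast
  next
    case (Int U V)
    obtain b where b: "b \<in> B" "\<phi>0 b > 0" "\<And>\<phi>. \<phi> \<in> K \<Longrightarrow> \<phi> b > 0 \<Longrightarrow> \<phi> \<in> U" using Int by blast
    obtain c where c: "c \<in> B" "\<phi>0 c > 0" "\<And>\<phi>. \<phi> \<in> K \<Longrightarrow> \<phi> c > 0 \<Longrightarrow> \<phi> \<in> V" using Int by blast
    have K0: "\<phi>0 \<in> K" using Int U by blast
    \<comment> \<open>Scaling by \<open>N\<close> makes both integer parts at least 2, so that a
      value within 2 of them is still positive.\<close>
    define N where "N = max \<lceil>2 / \<phi>0 b\<rceil> \<lceil>2 / \<phi>0 c\<rceil>"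
    have "2 / \<phi>0 b \<le> of_int N" "2 / \<phi>0 c \<le> of_int N" unfolding N_def by linarith+
    then have N: "2 \<le> of_int N * \<phi>0 b" "2 \<le> of_int N * \<phi>0 c" using b(2) c(2) by (simp_all add: field_simps)
    have N0: "N \<ge> 0" using N(1) b(2) by (smt (verit) mult_neg_pos of_int_less_0_iff)
    define k l where "k = \<lfloor>of_int N * \<phi>0 b\<rfloor>" "l = \<lfloor>of_int N * \<phi>0 c\<rfloor>"
    have kl: "k \<ge> 2" "l \<ge> 2" using N by (auto simp: k_l_def le_floor_iff)
    \<comment> \<open>The product of \<open>b\<close> and \<open>c\<close> would also be positive
      where both are negative. The sum of two squares keeps both values close to positive integers
      at once.\<close>
    let ?b = "\<guillemotleft>3\<guillemotright>\<^bsub>L\<^esub> \<ominus>\<^bsub>L\<^esub> (d N k b \<otimes>\<^bsub>L\<^esub> d N k b \<oplus>\<^bsub>L\<^esub> d N l c \<otimes>\<^bsub>L\<^esub> d N l c)"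
    have bB: "?b \<in> B" using b c by (simp add: B_minus B_mult B_add B_of_int dB)
    have val: "\<phi> ?b = 3 - ((of_int N * \<phi> b - of_int k) * (of_int N * \<phi> b - of_int k)
        + (of_int N * \<phi> c - of_int l) * (of_int N * \<phi> c - of_int l))" if "\<phi> \<in> K" for \<phi>
      using that b c by (simp add: K_minus K_add B_add K_mult B_mult B_of_int K_of_int dB dK)
    have "\<phi>0 ?b > 0"
      unfolding val[OF K0]
      using square_frac_le_one[of "of_int N * \<phi>0 b"] square_frac_le_one[of "of_int N * \<phi>0 c"]
      by (simp add: k_l_def)
    moreover have "\<phi> \<in> U \<inter> V" if K: "\<phi> \<in> K" and p: "\<phi> ?b > 0" for \<phi>
    proof -
      have "\<bar>of_int N * \<phi> b - of_int k\<bar> < 2" "\<bar>of_int N * \<phi> c - of_int l\<bar> < 2"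
        using p[unfolded val[OF K]] zero_le_square[of "of_int N * \<phi> b - of_int k"]
          zero_le_square[of "of_int N * \<phi> c - of_int l"]
        by (intro square_lt_four; linarith)+
      then have "of_int N * \<phi> b > 0" "of_int N * \<phi> c > 0" using kl by linarith+
      then have "\<phi> b > 0" "\<phi> c > 0" using N0 by (auto simp: zero_less_mult_iff)
      then show ?thesis using b c K by blast
    qed
    ultimately show ?case using bB by blast
  qed
qed

lemma Ofin_open: "s \<in> S \<Longrightarrow> openin T (Ofin R leq s)"
  using Ktop_basic[OF inverse_B, of s "{0<..}"] by (simp add: Ofin_def)

lemma Ofin_dense:
  assumes ar: "archimedean R leq" and lo: "localizable R leq" and s: "s \<in> S"
  shows "T closure_of Ofin R leq s = topspace T"
  unfolding dense_intersects_open
proof (intro allI impI notI, elim conjE)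
  fix U assume U: "openin T U" "U \<noteq> {}" and disj: "Ofin R leq s \<inter> U = {}"
  then obtain \<phi>0 where \<phi>0: "\<phi>0 \<in> U" by blast
  then have K0: "\<phi>0 \<in> K" using U openin_subset topspace_Ktop by blast
  obtain b where b: "b \<in> B" "\<phi>0 b > 0" "\<And>\<phi>. \<phi> \<in> K \<Longrightarrow> \<phi> b > 0 \<Longrightarrow> \<phi> \<in> U"
    using Ktop_basis[OF U(1) \<phi>0] by blast
  \<comment> \<open>Every character is nonnegative here: on \<open>U\<close> the factor
    \<open>1 / s\<close> vanishes, and off \<open>U\<close> the value of \<open>b\<close> is
    nonpositive. Cancelling \<open>1 / s\<close> makes \<open>- b\<close> positive, against
    \<open>\<phi>0 b > 0\<close>.\<close>
  have "\<ominus>\<^bsub>L\<^esub> b \<otimes>\<^bsub>L\<^esub> fr \<one> s \<in> LP"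
  proof (rule K_separation[OF ar lo])
    show "\<ominus>\<^bsub>L\<^esub> b \<otimes>\<^bsub>L\<^esub> fr \<one> s \<in> B" using b s by (simp add: B_mult B_neg inverse_B)
    fix \<phi> assume K: "\<phi> \<in> K"
    have "\<phi> (\<ominus>\<^bsub>L\<^esub> b \<otimes>\<^bsub>L\<^esub> fr \<one> s) = - (\<phi> b) * \<phi> (fr \<one> s)"
      using b s K by (simp add: K_mult K_neg B_neg inverse_B)
    moreover have "\<phi> (fr \<one> s) = 0 \<or> \<phi> b \<le> 0"
      using b(3)[OF K] disj K K_inverse_nonneg[OF K s] by (force simp: Ofin_def)
    ultimately show "0 \<le> \<phi> (\<ominus>\<^bsub>L\<^esub> b \<otimes>\<^bsub>L\<^esub> fr \<one> s)"
      using K_inverse_nonneg[OF K s] by (auto simp: mult_nonpos_nonneg)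
  qed
  moreover obtain r t where rt: "\<ominus>\<^bsub>L\<^esub> b = fr r t" "r \<in> carrier R" "t \<in> S"
    using Rloc_cases[of "\<ominus>\<^bsub>L\<^esub> b"] B_carr b by auto
  ultimately have "\<ominus>\<^bsub>L\<^esub> b \<in> LP" using s by (simp add: Rloc_mult fr_LP_iff Loc_mult)
  then show False using K_nonneg[OF K0 B_neg] b K_neg[OF K0] by fastforce
qed

end

section \<open>Almost everywhere defined continuous functions\<close>

text \<open>Covers both \<open>Dloc\<close> and the dense open sets, so that the ring structure and
  its order are worked out once.\<close>

locale domains =
  fixes T :: "'x topology" and D :: "'x set set"
  assumes D_open: "A \<in> D \<Longrightarrow> openin T A"
    and D_top: "topspace T \<in> D"
    and D_Int: "A \<in> D \<Longrightarrow> A' \<in> D \<Longrightarrow> A \<inter> A' \<in> D"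
begin

abbreviation "F \<equiv> pfuns T D"
abbreviation "cls \<equiv> acls T D"
abbreviation "C \<equiv> Capprox T D"

lemma F_iff: "p \<in> F \<longleftrightarrow> fst p \<in> D \<and> continuous_map (subtopology T (fst p)) euclideanreal (snd p)"
  by (cases p) (simp add: pfuns_def)

lemma F_dom: "p \<in> F \<Longrightarrow> fst p \<in> D"
  by (simp add: F_iff)

lemma continuous_restrict:
  assumes "continuous_map (subtopology T A) euclideanreal f" "A' \<subseteq> A"
  shows "continuous_map (subtopology T A') euclideanreal f"
  using continuous_map_from_subtopology[OF assms(1), of A'] assms(2)
  by (simp add: subtopology_subtopology Int_absorb1)

lemma padd_F: "p \<in> F \<Longrightarrow> q \<in> F \<Longrightarrow> padd p q \<in> F"
  and pmult_F: "p \<in> F \<Longrightarrow> q \<in> F \<Longrightarrow> pmult p q \<in> F"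
  by (auto simp: F_iff padd_def pmult_def D_Int intro!: continuous_intros intro: continuous_restrict)

lemma const_F: "A \<in> D \<Longrightarrow> (A, \<lambda>_. c) \<in> F"
  by (simp add: F_iff)

lemma approx_refl: "p \<in> F \<Longrightarrow> approx_rel D p p"
  unfolding approx_rel_def by (intro bexI[of _ "fst p"]) (auto simp: F_dom)

lemma approx_sym: "approx_rel D p q \<Longrightarrow> approx_rel D q p"
  unfolding approx_rel_def by (metis inf_commute)

lemma approx_trans:
  assumes "approx_rel D p q" "approx_rel D q r" shows "approx_rel D p r"
proof -
  obtain A A' where A: "A \<in> D" "A \<subseteq> fst p \<inter> fst q" "\<forall>x\<in>A. snd p x = snd q x"
    "A' \<in> D" "A' \<subseteq> fst q \<inter> fst r" "\<forall>x\<in>A'. snd q x = snd r x"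
    using assms unfolding approx_rel_def by metis
  then show ?thesis unfolding approx_rel_def by (intro bexI[of _ "A \<inter> A'"]) (auto simp: D_Int)
qed

lemma approx_cong:
  assumes "approx_rel D p p'" "approx_rel D q q'"
  shows "approx_rel D (padd p q) (padd p' q')" "approx_rel D (pmult p q) (pmult p' q')"
proof -
  obtain A A' where A: "A \<in> D" "A \<subseteq> fst p \<inter> fst p'" "\<forall>x\<in>A. snd p x = snd p' x"
    "A' \<in> D" "A' \<subseteq> fst q \<inter> fst q'" "\<forall>x\<in>A'. snd q x = snd q' x"
    using assms unfolding approx_rel_def by metis
  then show "approx_rel D (padd p q) (padd p' q')" "approx_rel D (pmult p q) (pmult p' q')"
    unfolding approx_rel_def by (intro bexI[of _ "A \<inter> A'"]; auto simp: D_Int padd_def pmult_def)+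
qed

lemma cls_eqI: "approx_rel D p q \<Longrightarrow> cls p = cls q"
  unfolding acls_def using approx_sym approx_trans by blast

lemma cls_self: "p \<in> F \<Longrightarrow> p \<in> cls p"
  by (simp add: acls_def approx_refl)

lemma mem_cls: "q \<in> cls p \<longleftrightarrow> q \<in> F \<and> approx_rel D q p"
  by (simp add: acls_def)

lemma some_cls:
  assumes "p \<in> F"
  shows "(SOME q. q \<in> cls p) \<in> F" "approx_rel D (SOME q. q \<in> cls p) p"
proof -
  have "(SOME q. q \<in> cls p) \<in> cls p" using cls_self[OF assms] by (rule someI)
  then show "(SOME q. q \<in> cls p) \<in> F" "approx_rel D (SOME q. q \<in> cls p) p" by (simp_all add: mem_cls)
qed

lemma C_add: "p \<in> F \<Longrightarrow> q \<in> F \<Longrightarrow> cls p \<oplus>\<^bsub>C\<^esub> cls q = cls (padd p q)"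
  and C_mult: "p \<in> F \<Longrightarrow> q \<in> F \<Longrightarrow> cls p \<otimes>\<^bsub>C\<^esub> cls q = cls (pmult p q)"
  by (simp_all add: Capprox_def cls_eqI approx_cong some_cls)

lemma C_zero: "\<zero>\<^bsub>C\<^esub> = cls (topspace T, \<lambda>_. 0)" and C_one: "\<one>\<^bsub>C\<^esub> = cls (topspace T, \<lambda>_. 1)"
  and C_carrier: "carrier C = cls ` F"
  by (simp_all add: Capprox_def)

lemma C_cases:
  assumes "c \<in> carrier C" obtains p where "c = cls p" "p \<in> F"
  using assms by (auto simp: C_carrier)

lemma F_sub: "p \<in> F \<Longrightarrow> fst p \<subseteq> topspace T"
  using D_open F_dom openin_subset by blast

lemma C_cring: "cring C"
proof (rule cringI)
  note F = padd_F pmult_F const_F[OF D_top]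
  show "abelian_group C"
  proof (rule abelian_groupI)
    fix x y assume "x \<in> carrier C" "y \<in> carrier C"
    then obtain p q where p: "x = cls p" "p \<in> F" "y = cls q" "q \<in> F" using C_cases by metis
    show "x \<oplus>\<^bsub>C\<^esub> y \<in> carrier C" using p F by (simp add: C_add C_carrier)
    show "x \<oplus>\<^bsub>C\<^esub> y = y \<oplus>\<^bsub>C\<^esub> x" using p by (simp add: C_add) (simp add: padd_def Int_commute add.commute)
    fix z assume "z \<in> carrier C"
    then obtain r where r: "z = cls r" "r \<in> F" using C_cases by metis
    show "x \<oplus>\<^bsub>C\<^esub> y \<oplus>\<^bsub>C\<^esub> z = x \<oplus>\<^bsub>C\<^esub> (y \<oplus>\<^bsub>C\<^esub> z)"
      using p r F by (simp add: C_add) (simp add: padd_def Int_assoc add.assoc)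
  next
    show "\<zero>\<^bsub>C\<^esub> \<in> carrier C" using F by (simp add: C_zero C_carrier)
  next
    fix x assume "x \<in> carrier C"
    then obtain p where p: "x = cls p" "p \<in> F" using C_cases by metis
    show "\<zero>\<^bsub>C\<^esub> \<oplus>\<^bsub>C\<^esub> x = x" using p F F_sub[OF p(2)] by (simp add: C_zero C_add) (simp add: padd_def Int_absorb1)
    let ?q = "(fst p, \<lambda>x. - snd p x)"
    have q: "?q \<in> F" using p(2) by (auto simp: F_iff intro!: continuous_intros)
    \<comment> \<open>The one ring law here that does not already hold for the pairs themselves: the
      sum has domain \<open>fst p\<close>, and only its class is that of the zero function on the
      whole space.\<close>
    have "approx_rel D (padd ?q p) (topspace T, \<lambda>_. 0)"
      unfolding approx_rel_def using p F_sub[OF p(2)] by (intro bexI[of _ "fst p"]) (auto simp: padd_def F_dom)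
    then have "cls ?q \<oplus>\<^bsub>C\<^esub> x = \<zero>\<^bsub>C\<^esub>" using p q by (simp add: C_zero C_add cls_eqI)
    then show "\<exists>y\<in>carrier C. y \<oplus>\<^bsub>C\<^esub> x = \<zero>\<^bsub>C\<^esub>" using q C_carrier by auto
  qed
  show "comm_monoid C"
  proof (rule comm_monoidI)
    fix x y assume "x \<in> carrier C" "y \<in> carrier C"
    then obtain p q where p: "x = cls p" "p \<in> F" "y = cls q" "q \<in> F" using C_cases by metis
    show "x \<otimes>\<^bsub>C\<^esub> y \<in> carrier C" using p F by (simp add: C_mult C_carrier)
    show "x \<otimes>\<^bsub>C\<^esub> y = y \<otimes>\<^bsub>C\<^esub> x" using p by (simp add: C_mult) (simp add: pmult_def Int_commute mult.commute)
    fix z assume "z \<in> carrier C"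
    then obtain r where r: "z = cls r" "r \<in> F" using C_cases by metis
    show "x \<otimes>\<^bsub>C\<^esub> y \<otimes>\<^bsub>C\<^esub> z = x \<otimes>\<^bsub>C\<^esub> (y \<otimes>\<^bsub>C\<^esub> z)"
      using p r F by (simp add: C_mult) (simp add: pmult_def Int_assoc mult.assoc)
  next
    show "\<one>\<^bsub>C\<^esub> \<in> carrier C" using F by (simp add: C_one C_carrier)
  next
    fix x assume "x \<in> carrier C"
    then obtain p where p: "x = cls p" "p \<in> F" using C_cases by metis
    show "\<one>\<^bsub>C\<^esub> \<otimes>\<^bsub>C\<^esub> x = x" using p F F_sub[OF p(2)] by (simp add: C_one C_mult) (simp add: pmult_def Int_absorb1)
  qed
  fix x y z assume "x \<in> carrier C" "y \<in> carrier C" "z \<in> carrier C"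
  then obtain p q r where p: "x = cls p" "p \<in> F" "y = cls q" "q \<in> F" "z = cls r" "r \<in> F" using C_cases by metis
  have "pmult (padd p q) r = padd (pmult p r) (pmult q r)"
    by (auto simp: pmult_def padd_def algebra_simps)
  then show "(x \<oplus>\<^bsub>C\<^esub> y) \<otimes>\<^bsub>C\<^esub> z = x \<otimes>\<^bsub>C\<^esub> z \<oplus>\<^bsub>C\<^esub> y \<otimes>\<^bsub>C\<^esub> z"
    using p F by (simp add: C_add C_mult)
qed

text \<open>\<open>Capprox_le\<close> lets both representatives vary; intersecting the sets on which
  they agree with the zero function and with \<open>p\<close> fixes both.\<close>

lemma C_nonneg_iff:
  assumes p: "p \<in> F"
  shows "Capprox_le D \<zero>\<^bsub>C\<^esub> (cls p) \<longleftrightarrow> (\<exists>A\<in>D. A \<subseteq> fst p \<and> (\<forall>x\<in>A. 0 \<le> snd p x))"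
proof
  assume "Capprox_le D \<zero>\<^bsub>C\<^esub> (cls p)"
  then obtain z q A where z: "z \<in> cls (topspace T, \<lambda>_. 0)" "q \<in> cls p" "A \<in> D" "A \<subseteq> fst z \<inter> fst q"
    "\<forall>x\<in>A. snd z x \<le> snd q x" unfolding Capprox_le_def C_zero by blast
  obtain A1 where A1: "A1 \<in> D" "\<forall>x\<in>A1. snd z x = 0" using z(1) unfolding mem_cls approx_rel_def by auto
  obtain A2 where A2: "A2 \<in> D" "A2 \<subseteq> fst p" "\<forall>x\<in>A2. snd q x = snd p x" using z(2) unfolding mem_cls approx_rel_def by auto
  show "\<exists>A\<in>D. A \<subseteq> fst p \<and> (\<forall>x\<in>A. 0 \<le> snd p x)"
    using z A1 A2 by (intro bexI[of _ "A \<inter> A1 \<inter> A2"]) (auto simp: D_Int)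
next
  assume "\<exists>A\<in>D. A \<subseteq> fst p \<and> (\<forall>x\<in>A. 0 \<le> snd p x)"
  then obtain A where A: "A \<in> D" "A \<subseteq> fst p" "\<forall>x\<in>A. 0 \<le> snd p x" by blast
  then show "Capprox_le D \<zero>\<^bsub>C\<^esub> (cls p)"
    unfolding Capprox_le_def C_zero using cls_self[OF p] cls_self[OF const_F[OF D_top, of 0]] openin_subset[OF D_open]
    by (intro bexI[of _ "(topspace T, \<lambda>_. 0)"] bexI[of _ p] bexI[of _ A]) auto
qed

end

section \<open>Dense open domains\<close>

lemma dense_opens_Int:
  assumes "A \<in> dense_opens T" "A' \<in> dense_opens T"
  shows "A \<inter> A' \<in> dense_opens T"
proof -
  have "A \<inter> A' \<inter> U \<noteq> {}" if U: "openin T U" "U \<noteq> {}" for U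
  proof -
    have "A' \<inter> U \<noteq> {}" "openin T (A' \<inter> U)"
      using assms U by (auto simp: dense_opens_def dense_intersects_open)
    then have "A \<inter> (A' \<inter> U) \<noteq> {}" using assms(1) unfolding dense_opens_def dense_intersects_open by blast
    then show ?thesis by (simp add: Int_assoc)
  qed
  then show ?thesis using assms by (auto simp: dense_opens_def dense_intersects_open)
qed

interpretation ae: domains T "dense_opens T" for T
  by unfold_locales (auto simp: dense_opens_Int, auto simp: dense_opens_def closure_of_topspace)

text \<open>The points with a negative value form an open set of the whole space, because the domain
  is open; if nonempty, it would meet the dense set \<open>A\<close>.\<close>

lemma nonneg_if_dense:
  assumes p: "p \<in> pfuns T (dense_opens T)" and A: "A \<in> dense_opens T" "A \<subseteq> fst p" "\<And>x. x \<in> A \<Longrightarrow> 0 \<le> snd p x"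
    and x: "x \<in> fst p"
  shows "0 \<le> snd p x"
proof (rule ccontr)
  assume neg: "\<not> 0 \<le> snd p x"
  define U where "U = {y \<in> topspace (subtopology T (fst p)). snd p y \<in> {..<0}}"
  have op: "openin T (fst p)" using ae.D_open[OF ae.F_dom[OF p]] .
  have "openin (subtopology T (fst p)) U"
    unfolding U_def using p by (intro openin_continuous_map_preimage[where Y = euclideanreal]) (auto simp: ae.F_iff)
  then have "openin T U" using op openin_trans_full by blast
  moreover have "x \<in> U" using x neg ae.F_sub[OF p] by (auto simp: U_def)
  ultimately obtain y where "y \<in> A" "y \<in> U" using A(1) unfolding dense_opens_def dense_intersects_open by blast
  then show False using A(3)[of y] by (simp add: U_def)
qed

text \<open>No shrinking of the domain remains, so infinitely many inequalities can be evaluated at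
  a common point. The archimedean property of subrings depends on this.\<close>

lemma Cae_nonneg_iff:
  assumes p: "p \<in> pfuns T (dense_opens T)"
  shows "Cae_le T \<zero>\<^bsub>Cae T\<^esub> (acls T (dense_opens T) p) \<longleftrightarrow> (\<forall>x\<in>fst p. 0 \<le> snd p x)"
  unfolding Cae_def Cae_le_def ae.C_nonneg_iff[OF p]
  using nonneg_if_dense[OF p] ae.F_dom[OF p] by blast

text \<open>Agreement on a member of \<open>D\<close> is agreement on a dense open set, so the
  representative chosen by \<open>J\<close> does not matter.\<close>

lemma (in domains) dense_embedding:
  assumes dense: "D \<subseteq> dense_opens T"
  defines "J \<equiv> \<lambda>c. acls T (dense_opens T) (SOME p. p \<in> c)"
  shows "\<And>p. p \<in> F \<Longrightarrow> J (cls p) = acls T (dense_opens T) p"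
    and "c \<in> carrier C \<Longrightarrow> p \<in> c \<Longrightarrow> q \<in> c \<Longrightarrow> acls T (dense_opens T) p = acls T (dense_opens T) q"
    and "order_embedding C (Capprox_le D) (Cae T) (Cae_le T) J"
proof -
  have approx: "approx_rel (dense_opens T) p q" if "approx_rel D p q" for p q
    using that dense unfolding approx_rel_def by blast
  have sub: "F \<subseteq> pfuns T (dense_opens T)" using dense by (auto simp: pfuns_def)
  show J: "J (cls p) = acls T (dense_opens T) p" if "p \<in> F" for p
    unfolding J_def using that by (intro ae.cls_eqI approx some_cls)
  show "acls T (dense_opens T) p = acls T (dense_opens T) q" if c: "c \<in> carrier C" "p \<in> c" "q \<in> c"
  proof -
    obtain r where "c = cls r" using c(1) C_cases by metis
    then have "approx_rel D p r" "approx_rel D q r" using c by (simp_all add: mem_cls)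
    then show ?thesis using approx_sym approx_trans by (intro ae.cls_eqI approx) blast
  qed
  show "order_embedding C (Capprox_le D) (Cae T) (Cae_le T) J"
    unfolding order_embedding_def positive_map_def
  proof (intro conjI ballI impI ring_hom_memI)
    fix x assume "x \<in> carrier C"
    then obtain p where p: "x = cls p" "p \<in> F" using C_cases by metis
    then have pd: "p \<in> pfuns T (dense_opens T)" using sub by blast
    show "J x \<in> carrier (Cae T)" using p pd by (simp add: J Cae_def ae.C_carrier)
    show "Cae_le T \<zero>\<^bsub>Cae T\<^esub> (J x)" if le: "Capprox_le D \<zero>\<^bsub>C\<^esub> x"
    proof -
      obtain A where A: "A \<in> D" "A \<subseteq> fst p" "\<forall>x\<in>A. 0 \<le> snd p x" using le C_nonneg_iff[OF p(2)] p(1) by auto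
      then have "A \<in> dense_opens T" using dense by blast
      then show ?thesis using A p pd unfolding Cae_def Cae_le_def by (auto simp: J ae.C_nonneg_iff)
    qed
    \<comment> \<open>Nonnegativity spreads from a dense set to all of \<open>fst p\<close>, and
      \<open>fst p\<close> is itself a member of \<open>D\<close>.\<close>
    show "Capprox_le D \<zero>\<^bsub>C\<^esub> x" if "Cae_le T \<zero>\<^bsub>Cae T\<^esub> (J x)"
      using that p pd F_dom[OF p(2)] by (auto simp: J Cae_nonneg_iff C_nonneg_iff intro!: bexI[of _ "fst p"])
    fix y assume "y \<in> carrier C"
    then obtain q where q: "y = cls q" "q \<in> F" using C_cases by metis
    then have qd: "q \<in> pfuns T (dense_opens T)" using sub by blast
    show "J (x \<otimes>\<^bsub>C\<^esub> y) = J x \<otimes>\<^bsub>Cae T\<^esub> J y" "J (x \<oplus>\<^bsub>C\<^esub> y) = J x \<oplus>\<^bsub>Cae T\<^esub> J y"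
      using p q pd qd by (simp_all add: J C_add C_mult padd_F pmult_F Cae_def ae.C_add ae.C_mult)
  next
    show "J \<one>\<^bsub>C\<^esub> = \<one>\<^bsub>Cae T\<^esub>" by (simp add: C_one J const_F D_top Cae_def ae.C_one)
  qed
qed

section \<open>The extended Gelfand transformation\<close>

lemma order_embedding_nonneg_iff:
  assumes "order_embedding R leR S leS \<Phi>" "r \<in> carrier R"
  shows "leS \<zero>\<^bsub>S\<^esub> (\<Phi> r) \<longleftrightarrow> leR \<zero>\<^bsub>R\<^esub> r"
  using assms unfolding order_embedding_def positive_map_def by blast

context po_ring
begin

abbreviation "D \<equiv> Dloc R leq"

lemma Ofin_K: "\<phi> \<in> Ofin R leq s \<Longrightarrow> \<phi> \<in> K"
  by (simp add: Ofin_def)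

lemma Ofin_one: "Ofin R leq \<one> = K"
  by (auto simp: Ofin_def Rloc_one[symmetric] K_one)

lemma Ofin_mult: "s \<in> S \<Longrightarrow> t \<in> S \<Longrightarrow> Ofin R leq (s \<otimes> t) = Ofin R leq s \<inter> Ofin R leq t"
  using K_inverse_nonneg by (fastforce simp: Ofin_def K_inverse_mult zero_less_mult_iff)

sublocale D: domains "Ktop R leq" "Dloc R leq"
proof unfold_locales
  show "openin T A" if "A \<in> D" for A using that Ofin_open by (auto simp: Dloc_def)
  show "topspace T \<in> D" using Ofin_one Loc_one by (auto simp: Dloc_def topspace_Ktop)
  show "A \<inter> A' \<in> D" if "A \<in> D" "A' \<in> D" for A A'
    using that Ofin_mult Loc_mult unfolding Dloc_def by blast
qed

lemma Ofin_D: "s \<in> S \<Longrightarrow> Ofin R leq s \<in> D"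
  by (auto simp: Dloc_def)

text \<open>The function \<open>r_s\<close> with its denominator as an argument; in
  \<open>gelfand\<close> the denominator is hidden behind \<open>SOME\<close>.\<close>

definition G :: "'a \<Rightarrow> 'a \<Rightarrow> (('a \<times> 'a) set \<Rightarrow> real) pfun" where
  "G r s = (Ofin R leq s, \<lambda>\<phi>. inverse (\<phi> (fr \<one> s)) * \<phi> (fr r s))"

lemma G_F:
  assumes "s \<in> S" "fr r s \<in> B"
  shows "G r s \<in> D.F"
proof -
  have "continuous_map (subtopology T (Ofin R leq s)) euclideanreal (\<lambda>\<phi>. inverse (\<phi> (fr \<one> s)) * \<phi> (fr r s))"
    using assms by (intro continuous_intros continuous_map_from_subtopology continuous_eval inverse_B)
      (auto simp: Ofin_def)
  then show ?thesis using assms Ofin_D by (simp add: G_def D.F_iff)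
qed

lemma K_cross:
  assumes K: "\<phi> \<in> K" and r: "r \<in> carrier R" and s: "s \<in> S" "t \<in> S" and B: "fr r s \<in> B"
  shows "\<phi> (fr r (s \<otimes> t)) = \<phi> (fr r s) * \<phi> (fr \<one> t)"
  using K_mult[OF K B inverse_B[OF s(2)]] r s by (simp add: Rloc_mult)

text \<open>Both cross products are the value of the character at \<open>r / (s t)\<close>, and on
  the domain of \<open>s t\<close> one may divide by both inverses.\<close>

lemma G_independent:
  assumes r: "r \<in> carrier R" and s: "s \<in> S" "t \<in> S" and B: "fr r s \<in> B" "fr r t \<in> B"
  shows "approx_rel D (G r s) (G r t)"
  unfolding approx_rel_def
proof (intro bexI conjI ballI)
  show "Ofin R leq (s \<otimes> t) \<in> D" using s by (intro Ofin_D Loc_mult)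
  show "Ofin R leq (s \<otimes> t) \<subseteq> fst (G r s) \<inter> fst (G r t)" using s by (simp add: Ofin_mult G_def)
  fix \<phi> assume "\<phi> \<in> Ofin R leq (s \<otimes> t)"
  then have "\<phi> \<in> Ofin R leq s" "\<phi> \<in> Ofin R leq t" using Ofin_mult[OF s] by auto
  then have \<phi>: "\<phi> \<in> K" "\<phi> (fr \<one> s) > 0" "\<phi> (fr \<one> t) > 0" by (simp_all add: Ofin_def)
  have "\<phi> (fr r s) * \<phi> (fr \<one> t) = \<phi> (fr r t) * \<phi> (fr \<one> s)"
    using K_cross[OF \<phi>(1) r s B(1)] K_cross[OF \<phi>(1) r s(2,1) B(2)] s Loc_carr by (simp add: m_comm)
  then show "snd (G r s) \<phi> = snd (G r t) \<phi>" using \<phi> by (simp add: G_def field_simps)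
qed

lemma localizable_fr_B:
  assumes "localizable R leq" "r \<in> carrier R"
  obtains s where "s \<in> S" "fr r s \<in> B" "s \<ominus> r \<in> P"
proof -
  obtain s where s: "s \<in> S" "s \<ominus> r \<in> P" "s \<oplus> r \<in> P" using localizableD assms by metis
  then have "fr r s \<in> B" using assms(2) Loc_carr by (subst fr_B_iff) (auto intro!: exI[of _ 1])
  with s that show thesis by blast
qed

lemma gelfand_eq:
  assumes r: "r \<in> carrier R" and s: "s \<in> S" and B: "fr r s \<in> B"
  shows "gelfand R leq r = D.cls (G r s)"
proof -
  let ?s = "SOME s. s \<in> S \<and> fr r s \<in> B"
  have "?s \<in> S \<and> fr r ?s \<in> B" by (rule someI[of _ s]) (use s B in simp)
  then have "D.cls (G r ?s) = D.cls (G r s)" using G_independent r s B by (intro D.cls_eqI) blast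
  then show ?thesis by (simp add: gelfand_def Let_def G_def)
qed

lemma gelfand_hom:
  assumes lo: "localizable R leq"
  shows "gelfand R leq \<in> ring_hom R D.C"
proof (rule ring_hom_memI)
  fix r assume r: "r \<in> carrier R"
  obtain s where s: "s \<in> S" "fr r s \<in> B" using localizable_fr_B[OF lo r] by metis
  have sc: "s \<in> carrier R" using s Loc_carr by blast
  show "gelfand R leq r \<in> carrier D.C" using gelfand_eq[OF r s] G_F[OF s] by (simp add: D.C_carrier)
  fix r' assume r': "r' \<in> carrier R"
  obtain s' where s': "s' \<in> S" "fr r' s' \<in> B" using localizable_fr_B[OF lo r'] by metis
  have sc': "s' \<in> carrier R" using s' Loc_carr by blast
  note gr = gelfand_eq[OF r s] and gr' = gelfand_eq[OF r' s']
  have B: "fr (r \<otimes> r') (s \<otimes> s') \<in> B" using B_mult[OF s(2) s'(2)] r r' s s' by (simp add: Rloc_mult)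
  have "approx_rel D (G (r \<otimes> r') (s \<otimes> s')) (pmult (G r s) (G r' s'))"
    unfolding approx_rel_def
  proof (intro bexI conjI ballI)
    show "Ofin R leq (s \<otimes> s') \<in> D" using s s' by (intro Ofin_D Loc_mult)
    show "Ofin R leq (s \<otimes> s') \<subseteq> fst (G (r \<otimes> r') (s \<otimes> s')) \<inter> fst (pmult (G r s) (G r' s'))"
      using s s' by (simp add: Ofin_mult G_def pmult_def)
    fix \<phi> assume "\<phi> \<in> Ofin R leq (s \<otimes> s')"
    then have \<phi>: "\<phi> \<in> K" by (rule Ofin_K)
    have "\<phi> (fr (r \<otimes> r') (s \<otimes> s')) = \<phi> (fr r s) * \<phi> (fr r' s')"
      using K_mult[OF \<phi> s(2) s'(2)] r r' s s' by (simp add: Rloc_mult)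
    then show "snd (G (r \<otimes> r') (s \<otimes> s')) \<phi> = snd (pmult (G r s) (G r' s')) \<phi>"
      using s s' by (simp add: G_def pmult_def K_inverse_mult[OF \<phi>])
  qed
  then show "gelfand R leq (r \<otimes> r') = gelfand R leq r \<otimes>\<^bsub>D.C\<^esub> gelfand R leq r'"
    using r r' s s' B by (simp add: gelfand_eq[of "r \<otimes> r'" "s \<otimes> s'"] gr gr' Loc_mult D.C_mult G_F D.cls_eqI)
  \<comment> \<open>For sums a common denominator is used, so that both summands are evaluated with
    the same factor \<open>1 / t\<close>.\<close>
  define t where "t = s \<otimes> s'"
  have t: "t \<in> S" using s s' by (simp add: t_def Loc_mult)
  have Bt: "fr r t \<in> B" "fr r' t \<in> B"
    using fr_B_mult_denom[OF r s(1) s'(1) s(2)] fr_B_mult_denom[OF r' s'(1) s(1) s'(2)] sc sc'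
    by (simp_all add: t_def m_comm)
  then have Bs: "fr (r \<oplus> r') t \<in> B" using B_add[OF Bt] r r' t by (simp add: Rloc_add_same)
  have "approx_rel D (G (r \<oplus> r') t) (padd (G r t) (G r' t))"
    unfolding approx_rel_def
  proof (intro bexI conjI ballI)
    show "Ofin R leq t \<in> D" using t by (rule Ofin_D)
    show "Ofin R leq t \<subseteq> fst (G (r \<oplus> r') t) \<inter> fst (padd (G r t) (G r' t))"
      by (simp add: G_def padd_def)
    fix \<phi> assume "\<phi> \<in> Ofin R leq t"
    then have \<phi>: "\<phi> \<in> K" by (rule Ofin_K)
    have "\<phi> (fr (r \<oplus> r') t) = \<phi> (fr r t) + \<phi> (fr r' t)"
      using K_add[OF \<phi> Bt] r r' t by (simp add: Rloc_add_same)
    then show "snd (G (r \<oplus> r') t) \<phi> = snd (padd (G r t) (G r' t)) \<phi>"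
      by (simp add: G_def padd_def algebra_simps)
  qed
  then show "gelfand R leq (r \<oplus> r') = gelfand R leq r \<oplus>\<^bsub>D.C\<^esub> gelfand R leq r'"
    using r r' t Bt Bs by (simp add: gelfand_eq[of _ t] D.C_add G_F D.cls_eqI)
next
  have "approx_rel D (G \<one> \<one>) (topspace T, \<lambda>_. 1)"
    unfolding approx_rel_def
    by (rule bexI[of _ "Ofin R leq \<one>"]) (auto simp: G_def topspace_Ktop Ofin_D Loc_one Ofin_K, auto simp: Ofin_def)
  then show "gelfand R leq \<one> = \<one>\<^bsub>D.C\<^esub>"
    using inverse_B[OF Loc_one] by (simp add: gelfand_eq[of _ \<one>] Loc_one D.C_one D.cls_eqI)
qed

text \<open>The factor \<open>inverse (\<phi> (fr \<one> s))\<close> is positive on the domain, so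
  the sign is that of the bounded fraction.\<close>

lemma gelfand_nonneg:
  assumes r: "r \<in> carrier R" and s: "s \<in> S" and B: "fr r s \<in> B"
  shows "Capprox_le D \<zero>\<^bsub>D.C\<^esub> (gelfand R leq r) \<longleftrightarrow>
    (\<exists>t\<in>S. Ofin R leq t \<subseteq> Ofin R leq s \<and> (\<forall>\<phi>\<in>Ofin R leq t. 0 \<le> \<phi> (fr r s)))"
proof -
  have "(0 \<le> snd (G r s) \<phi>) = (0 \<le> \<phi> (fr r s))" if "\<phi> \<in> Ofin R leq s" for \<phi>
    using that by (simp add: G_def Ofin_def zero_le_mult_iff)
  moreover have "fst (G r s) = Ofin R leq s" by (simp add: G_def)
  ultimately have "Capprox_le D \<zero>\<^bsub>D.C\<^esub> (gelfand R leq r) \<longleftrightarrow>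
    (\<exists>A\<in>D. A \<subseteq> Ofin R leq s \<and> (\<forall>\<phi>\<in>A. 0 \<le> \<phi> (fr r s)))"
    unfolding gelfand_eq[OF assms] D.C_nonneg_iff[OF G_F[OF s B]] by (metis subsetD)
  then show ?thesis by (auto simp: Dloc_def)
qed

lemma gelfand_order_embedding:
  assumes ar: "archimedean R leq" and lo: "localizable R leq"
  shows "order_embedding R leq D.C (Capprox_le D) (gelfand R leq)"
  unfolding order_embedding_def positive_map_def
proof (intro conjI ballI impI gelfand_hom lo)
  fix r assume r: "r \<in> carrier R"
  obtain s where s: "s \<in> S" "fr r s \<in> B" using localizable_fr_B[OF lo r] by metis
  show "Capprox_le D \<zero>\<^bsub>D.C\<^esub> (gelfand R leq r)" if "leq \<zero> r"
  proof -
    have "fr r s \<in> LP" using r s that by (simp add: fr_LP_iff pos_cone_def)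
    then show ?thesis unfolding gelfand_nonneg[OF r s] using s K_nonneg Ofin_K by blast
  qed
  assume "Capprox_le D \<zero>\<^bsub>D.C\<^esub> (gelfand R leq r)"
  then obtain t where t: "t \<in> S" "Ofin R leq t \<subseteq> Ofin R leq s" "\<And>\<phi>. \<phi> \<in> Ofin R leq t \<Longrightarrow> 0 \<le> \<phi> (fr r s)"
    unfolding gelfand_nonneg[OF r s] by blast
  have "fr r s \<otimes>\<^bsub>L\<^esub> fr \<one> t \<in> LP"
  proof (rule K_separation[OF ar lo])
    show "fr r s \<otimes>\<^bsub>L\<^esub> fr \<one> t \<in> B" using s t by (intro B_mult inverse_B)
    fix \<phi> assume K: "\<phi> \<in> K"
    have "\<phi> (fr \<one> t) = 0 \<or> \<phi> \<in> Ofin R leq t" using K_inverse_nonneg[OF K t(1)] K by (auto simp: Ofin_def)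
    then show "0 \<le> \<phi> (fr r s \<otimes>\<^bsub>L\<^esub> fr \<one> t)"
      using t(3) K_inverse_nonneg[OF K t(1)] by (auto simp: K_mult[OF K s(2) inverse_B[OF t(1)]])
  qed
  then have "r \<in> P" using r s t by (simp add: Rloc_mult fr_LP_iff Loc_mult)
  then show "leq \<zero> r" by (simp add: pos_cone_def)
qed

text \<open>A single denominator \<open>s\<close> is chosen that makes \<open>g / s\<close> bounded
  and dominates \<open>h\<close>. Then \<open>n g + h\<close> positive gives
  \<open>n \<phi>(g / s) + 1 \<ge> 0\<close> for all \<open>n\<close>, so every character is
  nonnegative on \<open>g / s\<close>, and the embedding reflects this to \<open>g\<close>.\<close>

lemma embedding_imp_archimedean:
  assumes lo: "localizable R leq"
    and oe: "order_embedding R leq D.C (Capprox_le D) (gelfand R leq)"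
  shows "archimedean R leq"
  unfolding archimedean_def
proof (intro ballI impI)
  fix g h assume g: "g \<in> carrier R" and h: "h \<in> carrier R"
    and k: "\<forall>k::nat. k \<ge> 1 \<longrightarrow> [k] \<cdot> g \<oplus> h \<in> P"
  obtain s1 where s1: "s1 \<in> S" "fr g s1 \<in> B" using localizable_fr_B[OF lo g] by metis
  obtain s2 where s2: "s2 \<in> S" "s2 \<ominus> h \<in> P" using localizable_fr_B[OF lo h] by metis
  define s where "s = s1 \<otimes> s2"
  note c = Loc_carr[OF s1(1)] Loc_carr[OF s2(1)]
  have s: "s \<in> S" "fr g s \<in> B"
    using s1 s2 g by (simp_all add: s_def Loc_mult fr_B_mult_denom)
  have sc: "s \<in> carrier R" using s Loc_carr by blast
  have "s \<ominus> h = (s1 \<ominus> \<one>) \<otimes> s2 \<oplus> (s2 \<ominus> h)" unfolding s_def using c h by algebra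
  then have sh: "s \<ominus> h \<in> P" using s1 s2 by (simp add: P_add P_mult Loc_minus_one Loc_P)
  have "0 \<le> \<phi> (fr g s)" if K: "\<phi> \<in> K" for \<phi>
  proof (rule ccontr)
    assume "\<not> 0 \<le> \<phi> (fr g s)"
    then obtain n :: nat where n: "1 < real n * - \<phi> (fr g s)"
      using reals_Archimedean3[of "- \<phi> (fr g s)"] by (metis neg_0_less_iff_less not_le)
    then have "n \<ge> 1" by (cases n) auto
    then have "[n] \<cdot> g \<oplus> h \<oplus> (s \<ominus> h) \<in> P" using k sh P_add by blast
    moreover have "x \<oplus> h \<oplus> (s \<ominus> h) = x \<oplus> s" if "x \<in> carrier R" for x using that h sc by algebra
    ultimately have "\<guillemotleft>n\<guillemotright>\<^sub>\<nat> \<otimes> g \<oplus> s \<in> P" using g by (simp add: add_pow_eq_of_nat)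
    moreover have e: "\<guillemotleft>n\<guillemotright>\<^sub>\<nat>\<^bsub>L\<^esub> \<otimes>\<^bsub>L\<^esub> fr g s \<oplus>\<^bsub>L\<^esub> \<one>\<^bsub>L\<^esub> = fr (\<guillemotleft>n\<guillemotright>\<^sub>\<nat> \<otimes> g \<oplus> s) s"
      using g s sc by (simp add: Rloc_of_nat Rloc_mult Rloc_one Rloc_add Loc_one)
    ultimately have "\<guillemotleft>n\<guillemotright>\<^sub>\<nat>\<^bsub>L\<^esub> \<otimes>\<^bsub>L\<^esub> fr g s \<oplus>\<^bsub>L\<^esub> \<one>\<^bsub>L\<^esub> \<in> LP" using g s sc by (simp add: fr_LP_iff)
    then have "0 \<le> \<phi> (\<guillemotleft>n\<guillemotright>\<^sub>\<nat>\<^bsub>L\<^esub> \<otimes>\<^bsub>L\<^esub> fr g s \<oplus>\<^bsub>L\<^esub> \<one>\<^bsub>L\<^esub>)"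
      by (intro K_nonneg[OF K] B_add B_mult B_of_nat B_one s)
    then have "0 \<le> real n * \<phi> (fr g s) + 1"
      using s by (simp add: K_add[OF K] K_mult[OF K] K_of_nat[OF K] K_one[OF K] B_mult B_of_nat B_one)
    with n show False by simp
  qed
  then have "Capprox_le D \<zero>\<^bsub>D.C\<^esub> (gelfand R leq g)"
    unfolding gelfand_nonneg[OF g s] using s Ofin_K by blast
  then show "g \<in> P" using oe g unfolding order_embedding_def by (simp add: pos_cone_def)
qed

section \<open>Consequences of strong localizability and of representations by functions\<close>

lemma strongly_localizable_imp_localizable:
  assumes sl: "strongly_localizable R leq"
  shows "localizable R leq"
  unfolding localizable_def
proof
  have S: "\<one> \<oplus> p \<in> S" if "p \<in> P" for p using sl that by (auto simp: strongly_localizable_def)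
  fix r assume r: "r \<in> carrier R"
  \<comment> \<open>This is the integer 4, made cancellable by strong localizability. It completes
    the square: \<open>4 (1 + r^2 - r) = (2 r - 1)^2 + 3\<close>, whence \<open>1 + r^2\<close>
    bounds \<open>r\<close>.\<close>
  have "\<one> \<oplus> (\<one> \<oplus> \<one> \<oplus> \<one>) \<in> S" by (intro S P_add P_one)
  note div4 = Loc_cancel[OF this]
  have bound: "\<one> \<oplus> r \<otimes> r \<ominus> r \<in> P" if r: "r \<in> carrier R" for r
  proof (rule div4)
    have "(\<one> \<oplus> r \<otimes> r \<ominus> r) \<otimes> (\<one> \<oplus> (\<one> \<oplus> \<one> \<oplus> \<one>)) = (r \<oplus> r \<ominus> \<one>) \<otimes> (r \<oplus> r \<ominus> \<one>) \<oplus> (\<one> \<oplus> \<one> \<oplus> \<one>)"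
      using r by algebra
    then show "(\<one> \<oplus> r \<otimes> r \<ominus> r) \<otimes> (\<one> \<oplus> (\<one> \<oplus> \<one> \<oplus> \<one>)) \<in> P" using r by (simp add: P_add P_one P_sq)
  qed (use r in simp)
  have "\<one> \<oplus> (\<ominus> r) \<otimes> (\<ominus> r) \<ominus> (\<ominus> r) = r \<ominus> (\<ominus> (\<one> \<oplus> r \<otimes> r))" using r by algebra
  then have "leq (\<ominus> (\<one> \<oplus> r \<otimes> r)) r" "leq r (\<one> \<oplus> r \<otimes> r)"
    using r bound[of r] bound[of "\<ominus> r"] by (simp_all add: leq_iff)
  then show "\<exists>s\<in>S. leq (\<ominus> s) r \<and> leq r s" using S P_sq r by blast
qed

text \<open>Positivity in \<open>R\<close> amounts to nonnegativity of a representing function on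
  its whole domain, so both conclusions reduce to statements about real numbers at single
  points.\<close>

lemma Cae_embedding_imp:
  assumes hom: "\<Phi> \<in> ring_hom R (Cae X)"
    and pos: "\<And>r. r \<in> carrier R \<Longrightarrow> r \<in> P \<longleftrightarrow> Cae_le X \<zero>\<^bsub>Cae X\<^esub> (\<Phi> r)"
  shows "archimedean R leq" "strongly_localizable R leq"
proof -
  let ?cls = "acls X (dense_opens X)" and ?F = "pfuns X (dense_opens X)"
  have "\<exists>p. p \<in> ?F \<and> \<Phi> r = ?cls p" if "r \<in> carrier R" for r
    using ring_hom_closed[OF hom that] by (auto simp: Cae_def ae.C_carrier)
  then obtain p where p: "\<And>r. r \<in> carrier R \<Longrightarrow> p r \<in> ?F" "\<And>r. r \<in> carrier R \<Longrightarrow> \<Phi> r = ?cls (p r)"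
    by metis
  have P_iff: "r \<in> P \<longleftrightarrow> (\<forall>x\<in>fst q. 0 \<le> snd q x)" if "r \<in> carrier R" "q \<in> ?F" "\<Phi> r = ?cls q" for r q
    using that by (simp add: pos Cae_nonneg_iff)
  have P_sub: "r \<in> P" if r: "r \<in> carrier R" and A: "A \<in> dense_opens X" "A \<subseteq> fst (p r)" "\<And>x. x \<in> A \<Longrightarrow> 0 \<le> snd (p r) x" for r A
    using P_iff[OF r p[OF r]] nonneg_if_dense[OF p(1)[OF r] A] by blast
  have add: "\<Phi> (r \<oplus> s) = ?cls (padd q q')"
    if "r \<in> carrier R" "s \<in> carrier R" "q \<in> ?F" "q' \<in> ?F" "\<Phi> r = ?cls q" "\<Phi> s = ?cls q'" for r s q q'
    using ring_hom_add[OF hom that(1,2)] that by (simp add: Cae_def ae.C_add)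
  have mult: "\<Phi> (r \<otimes> s) = ?cls (pmult q q')"
    if "r \<in> carrier R" "s \<in> carrier R" "q \<in> ?F" "q' \<in> ?F" "\<Phi> r = ?cls q" "\<Phi> s = ?cls q'" for r s q q'
    using ring_hom_mult[OF hom that(1,2)] that by (simp add: Cae_def ae.C_mult)
  have one: "\<Phi> \<one> = ?cls (topspace X, \<lambda>_. 1)" using ring_hom_one[OF hom] by (simp add: Cae_def ae.C_one)
  show "archimedean R leq"
    unfolding archimedean_def
  proof (intro ballI impI)
    fix g h assume g: "g \<in> carrier R" and h: "h \<in> carrier R"
      and k: "\<forall>k::nat. k \<ge> 1 \<longrightarrow> [k] \<cdot> g \<oplus> h \<in> P"
    define q where "q k = (fst (p g), \<lambda>x. real k * snd (p g) x)" for k :: nat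
    have qF: "q k \<in> ?F" for k using p(1)[OF g] by (auto simp: q_def ae.F_iff intro!: continuous_intros)
    \<comment> \<open>The induction starts at the multiple 1, where the representing function is
      \<open>p g\<close> itself; the archimedean condition speaks only of multiples from 1
      on.\<close>
    have q: "\<Phi> ([Suc k] \<cdot> g) = ?cls (q (Suc k))" for k
    proof (induction k)
      case 0 then show ?case using p[OF g] g by (simp add: q_def)
    next
      case (Suc k)
      have "padd (q (Suc k)) (p g) = q (Suc (Suc k))" by (auto simp: padd_def q_def algebra_simps)
      then show ?case using add[OF _ g qF p(1)[OF g] Suc p(2)[OF g]] g by simp
    qed
    show "g \<in> P"
    proof (rule P_sub[OF g])
      show "fst (p g) \<inter> fst (p h) \<in> dense_opens X" by (intro ae.D_Int ae.F_dom p g h)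
      fix x assume x: "x \<in> fst (p g) \<inter> fst (p h)"
      \<comment> \<open>All multiples of \<open>g\<close> are represented on the domain of
        \<open>p g\<close>, so one dense open set serves every \<open>k\<close> and no infinite
        intersection of domains arises.\<close>
      have nn: "0 \<le> real (Suc k) * snd (p g) x + snd (p h) x" for k
      proof -
        have kc: "[Suc k] \<cdot> g \<in> carrier R" using g by blast
        have "\<Phi> ([Suc k] \<cdot> g \<oplus> h) = ?cls (padd (q (Suc k)) (p h))"
          by (rule add[OF kc h qF p(1)[OF h] q p(2)[OF h]])
        moreover have "[Suc k] \<cdot> g \<oplus> h \<in> P" using k[rule_format, of "Suc k"] by (simp only: le_add1 plus_1_eq_Suc[symmetric])
        ultimately have "\<forall>x\<in>fst (padd (q (Suc k)) (p h)). 0 \<le> snd (padd (q (Suc k)) (p h)) x"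
          using P_iff[OF a_closed[OF kc h] ae.padd_F[OF qF p(1)[OF h]]] by blast
        then show ?thesis using x by (simp add: padd_def q_def)
      qed
      show "0 \<le> snd (p g) x"
      proof (rule ccontr)
        assume "\<not> 0 \<le> snd (p g) x"
        then obtain n :: nat where n: "snd (p h) x < real n * - snd (p g) x"
          using reals_Archimedean3[of "- snd (p g) x"] by (metis neg_0_less_iff_less not_le)
        with \<open>\<not> 0 \<le> snd (p g) x\<close> nn[of n] show False by (simp add: algebra_simps)
      qed
    qed simp
  qed
  have "\<one> \<oplus> t \<in> S" if t: "t \<in> P" for t
  proof (rule LocI)
    have tc: "t \<in> carrier R" using t P_carr by blast
    show "\<one> \<oplus> t \<in> carrier R" using tc by simp
    have "\<one> \<oplus> t \<ominus> \<one> = t" using tc by algebra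
    then show "\<one> \<oplus> t \<ominus> \<one> \<in> P" using t by simp
    fix r assume r: "r \<in> carrier R" "r \<otimes> (\<one> \<oplus> t) \<in> P"
    define o1 where "o1 = (topspace X, \<lambda>_::'b. 1::real)"
    have o1: "o1 \<in> ?F" "\<Phi> \<one> = ?cls o1" using ae.const_F[OF ae.D_top] one by (auto simp: o1_def)
    let ?q = "pmult (p r) (padd o1 (p t))"
    have nn: "\<forall>x\<in>fst ?q. 0 \<le> snd ?q x"
      using P_iff[OF _ _ mult[OF r(1) _ p(1)[OF r(1)] _ p(2)[OF r(1)] add[OF one_closed tc o1(1) p(1)[OF tc] o1(2) p(2)[OF tc]]]]
        r tc by (simp add: ae.padd_F ae.pmult_F o1 p)
    have tp: "\<forall>x\<in>fst (p t). 0 \<le> snd (p t) x" using t P_iff[OF tc p[OF tc]] by simp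
    show "r \<in> P"
    proof (rule P_sub[OF r(1)])
      show "fst (p r) \<inter> fst (p t) \<in> dense_opens X" by (intro ae.D_Int ae.F_dom p r tc)
      fix x assume x: "x \<in> fst (p r) \<inter> fst (p t)"
      then have "x \<in> topspace X" using ae.F_sub[OF p(1)[OF r(1)]] by blast
      then have "0 \<le> snd (p r) x * (1 + snd (p t) x)" using nn x by (auto simp: pmult_def padd_def o1_def)
      moreover have "0 < 1 + snd (p t) x" using tp x by (simp add: add_pos_nonneg)
      ultimately show "0 \<le> snd (p r) x" by (simp add: zero_le_mult_iff)
    qed simp
  qed
  moreover have "s \<in> {\<one> \<oplus> q | q. q \<in> P}" if "s \<in> S" for s using that unfolding Loc_def by blast
  ultimately show "strongly_localizable R leq" unfolding strongly_localizable_def using P_sq by blast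
qed

lemma iso_to_subring_imp:
  assumes "iso_to_subring_Cae R leq X"
  shows "archimedean R leq" "strongly_localizable R leq"
proof -
  obtain Q \<Phi> where Q: "subring Q (Cae X)" "po_iso R leq ((Cae X)\<lparr>carrier := Q\<rparr>) (Cae_le X) \<Phi>"
    using assms unfolding iso_to_subring_Cae_def by blast
  have iso: "\<Phi> \<in> ring_hom R ((Cae X)\<lparr>carrier := Q\<rparr>)" "bij_betw \<Phi> (carrier R) Q"
    using Q(2) by (simp_all add: po_iso_def ring_iso_def)
  have hom: "\<Phi> \<in> ring_hom R (Cae X)"
    using iso(1) subringE(1)[OF Q(1)] by (auto simp: ring_hom_def)
  have "r \<in> P \<longleftrightarrow> Cae_le X \<zero>\<^bsub>Cae X\<^esub> (\<Phi> r)" if r: "r \<in> carrier R" for r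
  proof
    show "Cae_le X \<zero>\<^bsub>Cae X\<^esub> (\<Phi> r)" if "r \<in> P"
      using Q(2) r that by (simp add: po_iso_def positive_map_def pos_cone_def)
    assume "Cae_le X \<zero>\<^bsub>Cae X\<^esub> (\<Phi> r)"
    moreover have "\<Phi> r \<in> Q" using iso(2) r bij_betwE by blast
    ultimately have "leq \<zero> (inv_into (carrier R) \<Phi> (\<Phi> r))"
      using Q(2) by (simp add: po_iso_def positive_map_def)
    moreover have "inv_into (carrier R) \<Phi> (\<Phi> r) = r" using iso(2) r by (simp add: bij_betw_def)
    ultimately show "r \<in> P" using r by (simp add: pos_cone_def)
  qed
  then show "archimedean R leq" "strongly_localizable R leq" using Cae_embedding_imp[OF hom] by blast+
qed

text \<open>Injectivity comes from the order: if \<open>r\<close> and \<open>r'\<close> have the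
  same image, then \<open>r \<ominus> r'\<close> and its negative both map to zero and are both
  positive.\<close>

lemma order_embedding_imp_iso:
  assumes oe: "order_embedding R leq (Cae X) (Cae_le X) \<Phi>"
  shows "iso_to_subring_Cae R leq X"
  unfolding iso_to_subring_Cae_def
proof (intro exI conjI)
  have "cring (Cae X)" unfolding Cae_def by (rule ae.C_cring)
  then interpret Cae: cring "Cae X" .
  have hom: "\<Phi> \<in> ring_hom R (Cae X)"
    and pos: "\<And>r. r \<in> carrier R \<Longrightarrow> leq \<zero> r \<longleftrightarrow> Cae_le X \<zero>\<^bsub>Cae X\<^esub> (\<Phi> r)"
    using oe order_embedding_nonneg_iff[OF oe] by (simp_all add: order_embedding_def)
  interpret h: ring_hom_ring R "Cae X" \<Phi>
    by (rule ring_hom_ringI2[OF ring_axioms Cae.ring_axioms hom])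
  show "subring (\<Phi> ` carrier R) (Cae X)" by (rule h.img_is_subring[OF carrier_is_subring])
  have refl: "Cae_le X \<zero>\<^bsub>Cae X\<^esub> \<zero>\<^bsub>Cae X\<^esub>" using pos[of \<zero>] P_zero by (simp add: pos_cone_def)
  have inj: "inj_on \<Phi> (carrier R)"
  proof (rule inj_onI)
    have diff: "r \<ominus> r' \<in> P" if r: "r \<in> carrier R" "r' \<in> carrier R" "\<Phi> r = \<Phi> r'" for r r'
    proof -
      have "\<Phi> (r \<ominus> r') = \<Phi> r \<oplus>\<^bsub>Cae X\<^esub> (\<ominus>\<^bsub>Cae X\<^esub> \<Phi> r)"
        using r by (simp add: a_minus_def)
      also have "\<dots> = \<zero>\<^bsub>Cae X\<^esub>" using r(1) by (intro Cae.r_neg h.hom_closed)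
      finally show ?thesis using pos[of "r \<ominus> r'"] refl r by (simp add: pos_cone_def)
    qed
    fix r r' assume r: "r \<in> carrier R" "r' \<in> carrier R" "\<Phi> r = \<Phi> r'"
    have "\<ominus> (r \<ominus> r') = r' \<ominus> r" using r(1,2) by algebra
    then have "r \<ominus> r' = \<zero>" using diff[OF r] diff[OF r(2,1) r(3)[symmetric]] by (intro P_antisym) simp_all
    then show "r = r'" using r(1,2) by (rule diff_eqI)
  qed
  show "po_iso R leq ((Cae X)\<lparr>carrier := \<Phi> ` carrier R\<rparr>) (Cae_le X) \<Phi>"
    unfolding po_iso_def
  proof (intro conjI)
    show "\<Phi> \<in> ring_iso R ((Cae X)\<lparr>carrier := \<Phi> ` carrier R\<rparr>)"
      using hom inj by (auto simp: ring_iso_def ring_hom_def bij_betw_def)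
    show "positive_map R leq ((Cae X)\<lparr>carrier := \<Phi> ` carrier R\<rparr>) (Cae_le X) \<Phi>"
      using pos by (simp add: positive_map_def)
    show "positive_map ((Cae X)\<lparr>carrier := \<Phi> ` carrier R\<rparr>) (Cae_le X) R leq (inv_into (carrier R) \<Phi>)"
      unfolding positive_map_def using pos inj by auto
  qed
qed

lemma Dloc_dense:
  assumes "archimedean R leq" "localizable R leq"
  shows "D \<subseteq> dense_opens T"
  using Ofin_dense[OF assms] Ofin_open by (auto simp: Dloc_def dense_opens_def)

lemma iso_to_subring_Ktop:
  assumes "archimedean R leq" "localizable R leq"
  shows "iso_to_subring_Cae R leq T"
proof (rule order_embedding_imp_iso)
  let ?J = "\<lambda>c. acls T (dense_opens T) (SOME p. p \<in> c)"
  have g: "order_embedding R leq D.C (Capprox_le D) (gelfand R leq)"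
    by (rule gelfand_order_embedding[OF assms])
  have J: "order_embedding D.C (Capprox_le D) (Cae T) (Cae_le T) ?J"
    by (rule D.dense_embedding(3)[OF Dloc_dense[OF assms]])
  have c: "gelfand R leq r \<in> carrier D.C" if "r \<in> carrier R" for r
    using g that ring_hom_closed by (fastforce simp: order_embedding_def)
  show "order_embedding R leq (Cae T) (Cae_le T) (?J \<circ> gelfand R leq)"
    unfolding order_embedding_def positive_map_def
  proof (intro conjI ballI impI)
    show "?J \<circ> gelfand R leq \<in> ring_hom R (Cae T)"
      using g J unfolding order_embedding_def by (intro ring_hom_trans) auto
    fix r assume r: "r \<in> carrier R"
    have "Cae_le T \<zero>\<^bsub>Cae T\<^esub> ((?J \<circ> gelfand R leq) r) \<longleftrightarrow> leq \<zero> r"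
      using order_embedding_nonneg_iff[OF J c[OF r]] order_embedding_nonneg_iff[OF g r] by simp
    then show "leq \<zero> r \<Longrightarrow> Cae_le T \<zero>\<^bsub>Cae T\<^esub> ((?J \<circ> gelfand R leq) r)"
      and "Cae_le T \<zero>\<^bsub>Cae T\<^esub> ((?J \<circ> gelfand R leq) r) \<Longrightarrow> leq \<zero> r" by blast+
  qed
qed

end

text \<open>Condition (i) ranges over all spaces, but types cannot be quantified inside a formula.
  The implication from (i) is therefore stated for points of an arbitrary type \<open>'x\<close>,
  while the converse names the type of the characters, on which the witness
  \<open>Ktop R leq\<close> lives.\<close>

theorem theorem31:
  fixes R :: "'a ring" and leq :: "'a \<Rightarrow> 'a \<Rightarrow> bool"
  assumes "po_cring R leq"
  shows
    \<comment> \<open>(i) for a space X on an arbitrary type implies (iii)\<close>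
    "((\<exists>X :: 'x topology. compact_space X \<and> Hausdorff_space X \<and> iso_to_subring_Cae R leq X)
        \<longrightarrow> archimedean R leq \<and> localizable R leq)
     \<comment> \<open>(i) (for spaces on the type of K(R)) \<longleftrightarrow> (ii)\<close>
     \<and> ((\<exists>X :: (('a \<times> 'a) set \<Rightarrow> real) topology.
            compact_space X \<and> Hausdorff_space X \<and> iso_to_subring_Cae R leq X)
        \<longleftrightarrow> (localizable R leq \<and>
             order_embedding R leq (Capprox (Ktop R leq) (Dloc R leq))
               (Capprox_le (Dloc R leq)) (gelfand R leq)))
     \<comment> \<open>(ii) \<longleftrightarrow> (iii)\<close>
     \<and> ((localizable R leq \<and>
             order_embedding R leq (Capprox (Ktop R leq) (Dloc R leq))
               (Capprox_le (Dloc R leq)) (gelfand R leq))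
        \<longleftrightarrow> (archimedean R leq \<and> localizable R leq))
     \<comment> \<open>(iii) \<longleftrightarrow> (iv)\<close>
     \<and> ((archimedean R leq \<and> localizable R leq)
        \<longleftrightarrow> (archimedean R leq \<and> strongly_localizable R leq))
     \<comment> \<open>Moreover part\<close>
     \<and> ((archimedean R leq \<and> localizable R leq) \<longrightarrow>
          (\<forall>s\<in>Loc R leq. Ktop R leq closure_of Ofin R leq s = topspace (Ktop R leq))
          \<and> (\<forall>c\<in>carrier (Capprox (Ktop R leq) (Dloc R leq)). \<forall>p\<in>c. \<forall>q\<in>c.
                acls (Ktop R leq) (dense_opens (Ktop R leq)) p
                = acls (Ktop R leq) (dense_opens (Ktop R leq)) q)
          \<and> order_embedding (Capprox (Ktop R leq) (Dloc R leq)) (Capprox_le (Dloc R leq))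
              (Cae (Ktop R leq)) (Cae_le (Ktop R leq))
              (\<lambda>c. acls (Ktop R leq) (dense_opens (Ktop R leq)) (SOME p. p \<in> c)))"
proof -
  interpret po_ring R leq
    using assms po_cring_def by (intro po_ring.intro po_ring_axioms.intro) blast+
  have i_iii: "archimedean R leq \<and> localizable R leq"
    if "iso_to_subring_Cae R leq X" for X :: "'x topology"
    using iso_to_subring_imp[OF that] strongly_localizable_imp_localizable by blast
  \<comment> \<open>Stated again because \<open>'x\<close> is fixed within the proof and cannot be
    specialised to the type of the characters.\<close>
  have i_iii': "archimedean R leq \<and> localizable R leq"
    if "iso_to_subring_Cae R leq X" for X :: "(('a \<times> 'a) set \<Rightarrow> real) topology"
    using iso_to_subring_imp[OF that] strongly_localizable_imp_localizable by blast
  have iii_i: "\<exists>X :: (('a \<times> 'a) set \<Rightarrow> real) topology.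
      compact_space X \<and> Hausdorff_space X \<and> iso_to_subring_Cae R leq X"
    if "archimedean R leq \<and> localizable R leq"
    using that compact_Ktop Hausdorff_Ktop iso_to_subring_Ktop by blast
  have ii_iii: "(localizable R leq \<and> order_embedding R leq D.C (Capprox_le D) (gelfand R leq))
      \<longleftrightarrow> (archimedean R leq \<and> localizable R leq)"
    using gelfand_order_embedding embedding_imp_archimedean by blast
  \<comment> \<open>The forward direction passes through (i): strong localizability is read off from
    the representation of \<open>R\<close> by functions on its character space.\<close>
  have iii_iv: "(archimedean R leq \<and> localizable R leq)
      \<longleftrightarrow> (archimedean R leq \<and> strongly_localizable R leq)"
    using iii_i iso_to_subring_imp strongly_localizable_imp_localizable by blast
  have moreover_part: "(\<forall>s\<in>S. T closure_of Ofin R leq s = topspace T)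
      \<and> (\<forall>c\<in>carrier D.C. \<forall>p\<in>c. \<forall>q\<in>c. acls T (dense_opens T) p = acls T (dense_opens T) q)
      \<and> order_embedding D.C (Capprox_le D) (Cae T) (Cae_le T) (\<lambda>c. acls T (dense_opens T) (SOME p. p \<in> c))"
    if al: "archimedean R leq \<and> localizable R leq"
  proof (intro conjI ballI)
    have ar: "archimedean R leq" and lo: "localizable R leq" using al by auto
    show "T closure_of Ofin R leq s = topspace T" if "s \<in> S" for s by (rule Ofin_dense[OF ar lo that])
    show "acls T (dense_opens T) p = acls T (dense_opens T) q" if "c \<in> carrier D.C" "p \<in> c" "q \<in> c" for c p q
      by (rule D.dense_embedding(2)[OF Dloc_dense[OF ar lo] that])
    show "order_embedding D.C (Capprox_le D) (Cae T) (Cae_le T) (\<lambda>c. acls T (dense_opens T) (SOME p. p \<in> c))"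
      by (rule D.dense_embedding(3)[OF Dloc_dense[OF ar lo]])
  qed
  show ?thesis
  proof (intro conjI)
    show "(\<exists>X :: 'x topology. compact_space X \<and> Hausdorff_space X \<and> iso_to_subring_Cae R leq X)
        \<longrightarrow> archimedean R leq \<and> localizable R leq"
      using i_iii by blast
    show "(\<exists>X :: (('a \<times> 'a) set \<Rightarrow> real) topology.
            compact_space X \<and> Hausdorff_space X \<and> iso_to_subring_Cae R leq X)
        \<longleftrightarrow> (localizable R leq \<and> order_embedding R leq D.C (Capprox_le D) (gelfand R leq))"
      unfolding ii_iii using i_iii' iii_i by blast
    show "(localizable R leq \<and> order_embedding R leq D.C (Capprox_le D) (gelfand R leq))
        \<longleftrightarrow> (archimedean R leq \<and> localizable R leq)"
      by (rule ii_iii)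
    show "(archimedean R leq \<and> localizable R leq)
        \<longleftrightarrow> (archimedean R leq \<and> strongly_localizable R leq)"
      by (rule iii_iv)
    show "(archimedean R leq \<and> localizable R leq) \<longrightarrow>
        (\<forall>s\<in>S. T closure_of Ofin R leq s = topspace T)
        \<and> (\<forall>c\<in>carrier D.C. \<forall>p\<in>c. \<forall>q\<in>c. acls T (dense_opens T) p = acls T (dense_opens T) q)
        \<and> order_embedding D.C (Capprox_le D) (Cae T) (Cae_le T) (\<lambda>c. acls T (dense_opens T) (SOME p. p \<in> c))"
      using moreover_part by (rule impI)
  qed
qed

end
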